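(* Let $\Lambda$, $M$, the intensities, the arrays $\mathrm B,\Theta,\mathrm E,\mathrm T$ and the generator $\mathbf R$ be as in the context. For $\underline y\in\{0,1\}^\Lambda$ put $$U_l(\underline y)=\sum_{n\in\mathbb Z_+}\frac{\overline\lambda_l(n;\underline y)}{\overline\mu_l(n;\underline y)},\qquad L_r(\underline y)=\sum_{n\in\mathbb Z_+}\frac{\overline\lambda_r(n;\underline y)\,\overline\gamma_r(n)}{\overline\mu_r(n;\underline y)},$$ and assume that for every $\underline y\in\{0,1\}^\Lambda$ with $|\underline y|=M$ one has $U_l(\underline y)<\infty$ and $L_j(\underline y)<\infty$ for all $l,j\in\Lambda$ with $y_l=0$, $y_j=1$. Then the continuous-time Markov process on $\{(\underline y,\underline n)\in\{0,1\}^\Lambda\times\mathbb Z_+^\Lambda:\ |\underline y|=M\}$ with generator $\mathbf R$ is positive recurrent and reversible. Its stationary probabilities are $$\pi(\underline y,\underline n)=\frac{\mathbf 1(|\underline y|=M)}{\Xi_{\Lambda,M}}\prod_{q\in\Lambda}\frac{\overline\lambda_q(n_q;\underline y)}{\overline\mu_q(n_q;\underline y)}\prod_{j\in\Lambda:\,y_j=1}\overline\gamma_j(n_j),\qquad \Xi_{\Lambda,M}=\sum_{\underline y\in\{0,1\}^\Lambda:\,|\underline y|=M}\ \prod_{r:\,y_r=1}L_r(\underline y)\prod_{l:\,y_l=0}U_l(\underline y).$$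
   Context: $\Lambda$ is a finite set of sites, $\mathbb Z_+=\{0,1,2,\dots\}$, and $M$ is a nonnegative integer with $M\le\#\Lambda$. A state is $(\underline y,\underline n)$ with $\underline y=(y_s)_{s\in\Lambda}\in\{0,1\}^\Lambda$ (configuration of sites occupied by distinguished customers) and $\underline n=(n_i)_{i\in\Lambda}\in\mathbb Z_+^\Lambda$ (numbers of tasks). $|\underline y|=\sum_s y_s$; write $j\in\underline y$ if $y_j=1$ and $j\notin\underline y$ if $y_j=0$. $\underline e^i$ is the unit vector at $i$, $\underline e^{i\to k}=\underline e^k-\underline e^i$, and $\mathbf 1$ is the indicator. Intensities. $\lambda_i(n;\underline y)\ge0$ ($n\ge0$) and $\mu_i(n;\underline y)$ ($n\ge1$) satisfy $\sup\lambda_i(n;\underline y)<\infty$ and $\inf\mu_i(n;\underline y)>0$ (over all $i,n,\underline y$), and $\lambda_i(n;\underline y)>0$ whenever $\lambda_i(n+1;\underline y)>0$. The values $\gamma_i(n)\ge0$ satisfy $\gamma_i(0)=1$ and $\gamma_i(n)>0$ whenever $\gamma_i(n+1)>0$. Set $\overline\lambda_i(0;\underline y)=\overline\mu_i(0;\underline y)=\overline\gamma_i(0)=1$ and, for $n\ge1$, $$\overline\lambda_i(n;\underline y)=\prod_{0\le m<n}\lambda_i(m;\underline y),\quad \overline\mu_i(n;\underline y)=\prod_{1\le m\le n}\mu_i(m;\underline y),\quad\overline\gamma_i(n)=\prod_{0\le m<n}\gamma_i(m).$$ It is understood that $\overline\gamma_j(n_j)>0$ wherever its reciprocal appears below. Arrays.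 The collections $\mathrm B(\underline n;\underline y)=(\beta_{kl}(n_k,n_l;\underline y))$, $\Theta(\underline n;\underline y)=(\theta_{kl}(n_k,n_l;\underline y))$, $\mathrm E(\underline n;\underline y)=(\epsilon_{ij}(n_i,n_j;\underline y))$, $\mathrm T(\underline n;\underline y)=(\tau_{jj'}(\underline n;\underline y))$ are irreducible, meaning that their off-diagonal entries are strictly positive. They satisfy: $$\frac{\lambda_k(n_k-1;\underline y)}{\mu_k(n_k;\underline y)}\beta_{kl}(n_k,n_l;\underline y)=\frac{\lambda_l(n_l;\underline y)}{\mu_l(n_l+1;\underline y)}\beta_{lk}(n_l+1,n_k-1;\underline y),\quad k\ne l,\ k,l\notin\underline y,\ n_k\ge1;$$ $$\frac{\lambda_j(n_j-1;\underline y)}{\mu_j(n_j;\underline y)}\theta_{jk}(n_j,n_k;\underline y)=\frac{\lambda_k(n_k;\underline y)}{\mu_k(n_k+1;\underline y)}\theta_{kj}(n_k+1,n_j-1;\underline y),\quad j\in\underline y,\ k\notin\underline y,\ n_j\ge1;$$ $$\frac{\lambda_i(n_i-1;\underline y)\gamma_i(n_i-1)}{\mu_i(n_i;\underline y)}\epsilon_{ij}(n_i,n_j;\underline y)=\frac{\lambda_j(n_j;\underline y)\gamma_j(n_j)}{\mu_j(n_j+1;\underline y)}\epsilon_{ji}(n_j+1,n_i-1;\underline y),\quad i\ne j,\ i,j\in\underline y,\ n_i\ge1;$$ $$\tau_{jj'}(\underline n;\underline y)\prod_{q\in\Lambda}\frac{\overline\lambda_q(n_q;\underline y)}{\overline\mu_q(n_q;\underline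 y)}=\tau_{j'j}(\underline n;\underline y+\underline e^{j\to j'})\prod_{q\in\Lambda}\frac{\overline\lambda_q(n_q;\underline y+\underline e^{j\to j'})}{\overline\mu_q(n_q;\underline y+\underline e^{j\to j'})},\quad j\in\underline y,\ j'\notin\underline y.$$ The generator $\mathbf R$ has the following off-diagonal entries (all others are zero): - $R[(\underline y,\underline n);(\underline y,\underline n+\underline e^p)]=\lambda_p(n_p;\underline y)[\gamma_p(n_p)]^{y_p}$ and $R[(\underline y,\underline n);(\underline y,\underline n-\underline e^p)]=\mu_p(n_p;\underline y)\mathbf 1(n_p\ge1)$, $p\in\Lambda$; - $R[(\underline y,\underline n);(\underline y,\underline n+\underline e^{k\to l})]=\beta_{kl}(n_k,n_l;\underline y)\mathbf 1(n_k\ge1)$, $k\ne l$, $k,l\notin\underline y$; - $R[(\underline y,\underline n);(\underline y,\underline n+\underline e^{i\to j})]=\epsilon_{ij}(n_i,n_j;\underline y)\mathbf 1(n_i\ge1)$, $i\ne j$, $i,j\in\underline y$; - $R[(\underline y,\underline n);(\underline y,\underline n+\underline e^{i\to l})]=\theta_{il}(n_i,n_l;\underline y)\mathbf 1(n_i\ge1)$, $i\in\underline y$, $l\notin\underline y$; - $R[(\underline y,\underline n);(\underline y,\underline n+\underline e^{k\to j})]=\theta_{kj}(n_k,n_j;\underline y)\gamma_j(n_j)\mathbf 1(n_k\ge1)$, $j\in\underline y$, $k\notin\underline y$; - $R[(\underline y,\underline n);(\underline y+\underline e^{j\to j'},\underline n)]=[\overline\gamma_j(n_j)]^{-1}\tau_{jj'}(\underline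 n;\underline y)$, $j\in\underline y$, $j'\notin\underline y$.
   Formalization: Nonexplosion is assumed when the rates λγ at occupied sites are unbounded (the process may otherwise explode); positive recurrence is stated for the class of states with π>0, which is entered almost surely from every state, since states with π=0 are transient. *)

theory Defs
  imports "HOL-Probability.Probability"
begin

section \<open>Continuous-time Markov processes with a given generator\<close>

text \<open>
  A generator is a conservative matrix \<open>Q\<close>: nonnegative off-diagonal entries and
  \<open>Q x x = - (\<Sum>y\<noteq>x. Q x y)\<close>. The process with generator \<open>Q\<close> is realised by its jump chain
  and its holding times: at the state \<open>x\<close> it stays for an exponential time with parameter
  \<open>- Q x x\<close> and then moves to \<open>y \<noteq> x\<close> with probability \<open>Q x y / (- Q x x)\<close>.
\<close>

definition exit_rate :: "('x \<Rightarrow> 'x \<Rightarrow> real) \<Rightarrow> 'x \<Rightarrow> real" where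
  "exit_rate Q x = - Q x x"

definition jump_pmf :: "('x \<Rightarrow> 'x \<Rightarrow> real) \<Rightarrow> 'x \<Rightarrow> 'x pmf" where
  "jump_pmf Q x =
     (if exit_rate Q x = 0 then return_pmf x
      else embed_pmf (\<lambda>y. if y = x then 0 else Q x y / exit_rate Q x))"

text \<open>
  The randomness: independent variables \<open>\<xi> (m, x)\<close> with law \<open>jump_pmf Q x\<close> (the destination of
  the \<open>m\<close>-th jump, should it be made from \<open>x\<close>) and independent standard exponential variables.
  The processes for all initial states live on this one probability space; the law of the process
  started at \<open>x\<close> is obtained from the functions below with first state \<open>x\<close>.
\<close>

type_synonym 'x noise = "(nat \<times> 'x \<Rightarrow> 'x) \<times> (nat \<Rightarrow> real)"

definition noise_measure :: "('x \<Rightarrow> 'x \<Rightarrow> real) \<Rightarrow> 'x noise measure" where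
  "noise_measure Q =
     (\<Pi>\<^sub>M i\<in>UNIV. measure_pmf (jump_pmf Q (snd i))) \<Otimes>\<^sub>M
     (\<Pi>\<^sub>M m\<in>UNIV. density lborel (\<lambda>u. ennreal (exponential_density 1 u)))"

primrec jump_chain :: "'x \<Rightarrow> 'x noise \<Rightarrow> nat \<Rightarrow> 'x" where
  "jump_chain x \<omega> 0 = x"
| "jump_chain x \<omega> (Suc m) = fst \<omega> (m, jump_chain x \<omega> m)"

definition holding_time :: "('x \<Rightarrow> 'x \<Rightarrow> real) \<Rightarrow> 'x \<Rightarrow> 'x noise \<Rightarrow> nat \<Rightarrow> ennreal" where
  "holding_time Q x \<omega> m =
     (let q = exit_rate Q (jump_chain x \<omega> m)
      in if q = 0 then \<infinity> else ennreal (snd \<omega> m / q))"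

definition jump_time :: "('x \<Rightarrow> 'x \<Rightarrow> real) \<Rightarrow> 'x \<Rightarrow> 'x noise \<Rightarrow> nat \<Rightarrow> ennreal" where
  "jump_time Q x \<omega> m = (\<Sum>k<m. holding_time Q x \<omega> k)"

text \<open>The value \<open>None\<close> is the cemetery, entered when infinitely many jumps have accumulated.\<close>

definition process :: "('x \<Rightarrow> 'x \<Rightarrow> real) \<Rightarrow> 'x \<Rightarrow> real \<Rightarrow> 'x noise \<Rightarrow> 'x option" where
  "process Q x t \<omega> =
     (if \<exists>m. ennreal t < jump_time Q x \<omega> (Suc m)
      then Some (jump_chain x \<omega> (LEAST m. ennreal t < jump_time Q x \<omega> (Suc m)))
      else None)"

text \<open>
  The process is defined for all times when the total time of all its jumps is almost surely
  infinite. This is not automatic for the network below: \<open>gam\<close> need not be bounded, and with one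
  site, \<open>M = 1\<close>, \<open>lam = 1\<close>, \<open>gam n = 4 ^ n\<close>, \<open>mu n = 2 * 4 ^ (n - 1)\<close> all sums are
  finite but the process explodes.
\<close>

definition nonexplosive :: "('x \<Rightarrow> 'x \<Rightarrow> real) \<Rightarrow> 'x set \<Rightarrow> bool" where
  "nonexplosive Q S \<longleftrightarrow>
     (\<forall>x\<in>S. AE \<omega> in noise_measure Q. (\<Sum>m. holding_time Q x \<omega> m) = \<infinity>)"

definition transition_prob :: "('x \<Rightarrow> 'x \<Rightarrow> real) \<Rightarrow> real \<Rightarrow> 'x \<Rightarrow> 'x \<Rightarrow> real" where
  "transition_prob Q t x y =
     measure (noise_measure Q) {\<omega> \<in> space (noise_measure Q). process Q x t \<omega> = Some y}"

definition stationary_distribution ::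
    "('x \<Rightarrow> 'x \<Rightarrow> real) \<Rightarrow> 'x set \<Rightarrow> ('x \<Rightarrow> real) \<Rightarrow> bool" where
  "stationary_distribution Q S \<nu> \<longleftrightarrow>
     (\<forall>x\<in>S. 0 \<le> \<nu> x) \<and> (\<nu> has_sum 1) S \<and>
     (\<forall>t\<ge>0. \<forall>y\<in>S. ((\<lambda>x. \<nu> x * transition_prob Q t x y) has_sum \<nu> y) S)"

text \<open>
  Reversibility: for the process \<open>X\<close> with initial law \<open>\<nu>\<close> and every \<open>T\<close>, the families
  \<open>X t\<close> and \<open>X (T - t)\<close>, \<open>0 \<le> t \<le> T\<close>, have the same finite-dimensional distributions. A list of
  pairs \<open>(t, z)\<close> encodes the event that \<open>X t = z\<close> for each listed pair.
\<close>

definition cylinder_prob ::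
    "('x \<Rightarrow> 'x \<Rightarrow> real) \<Rightarrow> 'x set \<Rightarrow> ('x \<Rightarrow> real) \<Rightarrow> (real \<times> 'x) list \<Rightarrow> real" where
  "cylinder_prob Q S \<nu> c =
     (\<Sum>\<^sub>\<infinity>x\<in>S. \<nu> x *
        measure (noise_measure Q)
          {\<omega> \<in> space (noise_measure Q). \<forall>(t, z)\<in>set c. process Q x t \<omega> = Some z})"

definition reversible_process ::
    "('x \<Rightarrow> 'x \<Rightarrow> real) \<Rightarrow> 'x set \<Rightarrow> ('x \<Rightarrow> real) \<Rightarrow> bool" where
  "reversible_process Q S \<nu> \<longleftrightarrow>
     (\<forall>T\<ge>0. \<forall>c. (\<forall>(t, z)\<in>set c. 0 \<le> t \<and> t \<le> T \<and> z \<in> S) \<longrightarrow>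
        cylinder_prob Q S \<nu> c = cylinder_prob Q S \<nu> (map (\<lambda>(t, z). (T - t, z)) c))"

text \<open>First return time to the initial state, after having left it (\<open>\<infinity>\<close> if there is none).\<close>

definition return_time :: "('x \<Rightarrow> 'x \<Rightarrow> real) \<Rightarrow> 'x \<Rightarrow> 'x noise \<Rightarrow> ennreal" where
  "return_time Q x \<omega> =
     Inf (ennreal ` {t. 0 \<le> t \<and> jump_time Q x \<omega> 1 \<le> ennreal t \<and> process Q x t \<omega> = Some x})"

text \<open>An absorbing state is positive recurrent by convention.\<close>

definition positive_recurrent_state :: "('x \<Rightarrow> 'x \<Rightarrow> real) \<Rightarrow> 'x \<Rightarrow> bool" where
  "positive_recurrent_state Q x \<longleftrightarrow>
     exit_rate Q x = 0 \<or> (\<integral>\<^sup>+ \<omega>. return_time Q x \<omega> \<partial>noise_measure Q) < \<infinity>"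

definition leads_to :: "('x \<Rightarrow> 'x \<Rightarrow> real) \<Rightarrow> 'x \<Rightarrow> 'x \<Rightarrow> bool" where
  "leads_to Q = (\<lambda>x y. x \<noteq> y \<and> Q x y > 0)\<^sup>*\<^sup>*"

text \<open>
  Positive recurrence of a process on \<open>S\<close> with set \<open>C\<close> of recurrent states: \<open>C\<close> is a closed
  communicating class of positive recurrent states, and from the states outside \<open>C\<close>, if any, the
  process almost surely enters \<open>C\<close>. For \<open>C = S\<close> this says that the process is irreducible and
  that all its states are positive recurrent.
\<close>

definition positive_recurrent_process ::
    "('x \<Rightarrow> 'x \<Rightarrow> real) \<Rightarrow> 'x set \<Rightarrow> 'x set \<Rightarrow> bool" where
  "positive_recurrent_process Q S C \<longleftrightarrow>
     C \<noteq> {} \<and> C \<subseteq> S \<and>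
     (\<forall>x\<in>C. {y. leads_to Q x y} = C) \<and>
     (\<forall>x\<in>C. positive_recurrent_state Q x) \<and>
     (\<forall>x\<in>S. AE \<omega> in noise_measure Q. \<exists>t\<ge>0. process Q x t \<omega> \<in> Some ` C)"


section \<open>The network\<close>

text \<open>
  The sites are the elements of a finite type. A configuration in \<open>{0,1}\<^sup>\<Lambda>\<close> is represented by the
  set \<open>y\<close> of its occupied sites, so that \<open>|y|\<close> is \<open>card y\<close>. The arguments \<open>lam\<close>, \<open>mu\<close>,
  \<open>gam\<close>, \<open>beta\<close>, \<open>theta\<close>, \<open>eps\<close>, \<open>tau\<close> stand for the families denoted by the
  corresponding Greek letters; \<open>beta k l a b y\<close> is \<open>\<beta>\<^sub>k\<^sub>l(a, b; y)\<close>.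
\<close>

type_synonym 's state = "'s set \<times> ('s \<Rightarrow> nat)"

definition states :: "nat \<Rightarrow> ('s::finite) state set" where
  "states M = {(y, n). card y = M}"

definition lam_bar :: "('s \<Rightarrow> nat \<Rightarrow> 's set \<Rightarrow> real) \<Rightarrow> 's \<Rightarrow> nat \<Rightarrow> 's set \<Rightarrow> real" where
  "lam_bar lam i n y = (\<Prod>m<n. lam i m y)"

definition mu_bar :: "('s \<Rightarrow> nat \<Rightarrow> 's set \<Rightarrow> real) \<Rightarrow> 's \<Rightarrow> nat \<Rightarrow> 's set \<Rightarrow> real" where
  "mu_bar mu i n y = (\<Prod>m=1..n. mu i m y)"

definition gam_bar :: "('s \<Rightarrow> nat \<Rightarrow> real) \<Rightarrow> 's \<Rightarrow> nat \<Rightarrow> real" where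
  "gam_bar gam i n = (\<Prod>m<n. gam i m)"

text \<open>\<open>n + e\<^sup>k\<^sup>\<rightarrow>\<^sup>l\<close> for \<open>k \<noteq> l\<close> and \<open>n k \<ge> 1\<close>:\<close>

definition move_task :: "'s \<Rightarrow> 's \<Rightarrow> ('s \<Rightarrow> nat) \<Rightarrow> ('s \<Rightarrow> nat)" where
  "move_task k l n = n(k := n k - 1, l := n l + 1)"

text \<open>\<open>y + e\<^sup>j\<^sup>\<rightarrow>\<^sup>j\<^sup>'\<close> for \<open>j \<in> y\<close>, \<open>j' \<notin> y\<close>:\<close>

definition move_customer :: "'s \<Rightarrow> 's \<Rightarrow> 's set \<Rightarrow> 's set" where
  "move_customer j j' y = insert j' (y - {j})"

text \<open>
  The transitions listed below have pairwise different targets, so for a given pair of states at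
  most one term of the sum is nonzero.
\<close>

definition rate ::
  "('s::finite \<Rightarrow> nat \<Rightarrow> 's set \<Rightarrow> real) \<Rightarrow> ('s \<Rightarrow> nat \<Rightarrow> 's set \<Rightarrow> real) \<Rightarrow> ('s \<Rightarrow> nat \<Rightarrow> real) \<Rightarrow>
   ('s \<Rightarrow> 's \<Rightarrow> nat \<Rightarrow> nat \<Rightarrow> 's set \<Rightarrow> real) \<Rightarrow> ('s \<Rightarrow> 's \<Rightarrow> nat \<Rightarrow> nat \<Rightarrow> 's set \<Rightarrow> real) \<Rightarrow>
   ('s \<Rightarrow> 's \<Rightarrow> nat \<Rightarrow> nat \<Rightarrow> 's set \<Rightarrow> real) \<Rightarrow> ('s \<Rightarrow> 's \<Rightarrow> ('s \<Rightarrow> nat) \<Rightarrow> 's set \<Rightarrow> real) \<Rightarrow>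
   's state \<Rightarrow> 's state \<Rightarrow> real"
where
  "rate lam mu gam beta theta eps tau x x' =
     (let (y, n) = x; (y', n') = x' in
        (\<Sum>p\<in>UNIV. if y' = y \<and> n' = n(p := n p + 1)
            then lam p (n p) y * gam p (n p) ^ (if p \<in> y then 1 else 0) else 0)
      + (\<Sum>p\<in>UNIV. if y' = y \<and> n' = n(p := n p - 1) \<and> n p \<ge> 1
            then mu p (n p) y else 0)
      + (\<Sum>k\<in>-y. \<Sum>l\<in>-y - {k}. if y' = y \<and> n' = move_task k l n \<and> n k \<ge> 1
            then beta k l (n k) (n l) y else 0)
      + (\<Sum>i\<in>y. \<Sum>j\<in>y - {i}. if y' = y \<and> n' = move_task i j n \<and> n i \<ge> 1
            then eps i j (n i) (n j) y else 0)
      + (\<Sum>i\<in>y. \<Sum>l\<in>-y. if y' = y \<and> n' = move_task i l n \<and> n i \<ge> 1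
            then theta i l (n i) (n l) y else 0)
      + (\<Sum>k\<in>-y. \<Sum>j\<in>y. if y' = y \<and> n' = move_task k j n \<and> n k \<ge> 1
            then theta k j (n k) (n j) y * gam j (n j) else 0)
      + (\<Sum>j\<in>y. \<Sum>j'\<in>-y. if y' = move_customer j j' y \<and> n' = n
            then inverse (gam_bar gam j (n j)) * tau j j' n y else 0))"

definition generator ::
  "('s::finite \<Rightarrow> nat \<Rightarrow> 's set \<Rightarrow> real) \<Rightarrow> ('s \<Rightarrow> nat \<Rightarrow> 's set \<Rightarrow> real) \<Rightarrow> ('s \<Rightarrow> nat \<Rightarrow> real) \<Rightarrow>
   ('s \<Rightarrow> 's \<Rightarrow> nat \<Rightarrow> nat \<Rightarrow> 's set \<Rightarrow> real) \<Rightarrow> ('s \<Rightarrow> 's \<Rightarrow> nat \<Rightarrow> nat \<Rightarrow> 's set \<Rightarrow> real) \<Rightarrow>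
   ('s \<Rightarrow> 's \<Rightarrow> nat \<Rightarrow> nat \<Rightarrow> 's set \<Rightarrow> real) \<Rightarrow> ('s \<Rightarrow> 's \<Rightarrow> ('s \<Rightarrow> nat) \<Rightarrow> 's set \<Rightarrow> real) \<Rightarrow>
   's state \<Rightarrow> 's state \<Rightarrow> real"
where
  "generator lam mu gam beta theta eps tau x x' =
     (if x' = x then - (\<Sum>\<^sub>\<infinity>z\<in>-{x}. rate lam mu gam beta theta eps tau x z)
      else rate lam mu gam beta theta eps tau x x')"

definition U_sum ::
  "('s \<Rightarrow> nat \<Rightarrow> 's set \<Rightarrow> real) \<Rightarrow> ('s \<Rightarrow> nat \<Rightarrow> 's set \<Rightarrow> real) \<Rightarrow> 's \<Rightarrow> 's set \<Rightarrow> real"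
where
  "U_sum lam mu l y = (\<Sum>n. lam_bar lam l n y / mu_bar mu l n y)"

definition L_sum ::
  "('s \<Rightarrow> nat \<Rightarrow> 's set \<Rightarrow> real) \<Rightarrow> ('s \<Rightarrow> nat \<Rightarrow> 's set \<Rightarrow> real) \<Rightarrow> ('s \<Rightarrow> nat \<Rightarrow> real) \<Rightarrow>
   's \<Rightarrow> 's set \<Rightarrow> real"
where
  "L_sum lam mu gam r y = (\<Sum>n. lam_bar lam r n y * gam_bar gam r n / mu_bar mu r n y)"

definition Xi ::
  "('s::finite \<Rightarrow> nat \<Rightarrow> 's set \<Rightarrow> real) \<Rightarrow> ('s \<Rightarrow> nat \<Rightarrow> 's set \<Rightarrow> real) \<Rightarrow> ('s \<Rightarrow> nat \<Rightarrow> real) \<Rightarrow>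
   nat \<Rightarrow> real"
where
  "Xi lam mu gam M =
     (\<Sum>y | card y = M. (\<Prod>r\<in>y. L_sum lam mu gam r y) * (\<Prod>l\<in>-y. U_sum lam mu l y))"

definition equilibrium ::
  "('s::finite \<Rightarrow> nat \<Rightarrow> 's set \<Rightarrow> real) \<Rightarrow> ('s \<Rightarrow> nat \<Rightarrow> 's set \<Rightarrow> real) \<Rightarrow> ('s \<Rightarrow> nat \<Rightarrow> real) \<Rightarrow>
   nat \<Rightarrow> 's state \<Rightarrow> real"
where
  "equilibrium lam mu gam M x =
     (let (y, n) = x in
        (if card y = M then 1 else 0) / Xi lam mu gam M *
        (\<Prod>q\<in>UNIV. lam_bar lam q (n q) y / mu_bar mu q (n q) y) *
        (\<Prod>j\<in>y. gam_bar gam j (n j)))"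

end

theory Submission imports Defs begin

text \<open>
  Detailed balance holds for \<open>\<pi> = eqm\<close> transition by transition; everything else is derived from it.
  The first jump decomposes the noise into an exponential time, a destination and an independent copy
  of the noise. This gives recursions for the probabilities of being in a given state after exactly
  \<open>m\<close> jumps, from which the Markov property and \<open>\<pi> x * P\<^sub>t x y = \<pi> y * P\<^sub>t y x\<close> follow by induction on
  \<open>m\<close>, the latter by expanding a path at both of its ends. Reversibility of all finite-dimensional
  distributions is then a telescoping product. Uniqueness of the stationary law uses that
  \<open>\<bar>\<nu> - \<pi>\<bar>\<close> is again invariant while \<open>P\<^sub>1\<close> is positive on the support of \<open>\<pi>\<close>. The chain killed at \<open>x\<close>
  is self-adjoint for the weights \<open>\<pi> q\<close>, which bounds the mean return time by \<open>1 / (\<pi> x * q x)\<close>.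
  If the arrival rates are bounded, explosion is excluded by a maximum principle for
  \<open>x \<mapsto> E\<^sub>x (exp (- \<zeta>))\<close>, with \<open>\<zeta>\<close> the explosion time and the number of tasks as barrier. Off the
  support of \<open>\<pi>\<close> there are no arrivals at all, so the number of tasks is a Lyapunov function there.
\<close>

section \<open>Splitting off the first step of the noise\<close>

text \<open>The process is given by its jump chain and holding times, so no semigroup is available
  at the start, and the noise lets only the first jump be split off. Symmetry of the transition
  probabilities also asks for a splitting at the last jump, which therefore has to come out of the
  induction itself. Counting jumps keeps every recursion an integral of a finite sum, and with
  values in \<open>ennreal\<close> no integrability has to be tracked.

  The intensities may vanish from some level on. Then \<open>eqm\<close> has zeros inside
  \<open>states M\<close>, although departures lead from there back into its support; the recurrent
  class is this support, and no argument may assume irreducibility on all of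
  \<open>states M\<close>. The balance equations of the arrays spread one vanishing arrival
  intensity to every other site, which is why states of weight zero see no arrivals.

  Explosion cannot be excluded in general when \<open>lam * gam\<close> is unbounded at occupied
  sites; there its absence enters as the hypothesis \<open>well_defined\<close>. The rest of the
  proof takes nonexplosion as given, so both situations share it.\<close>

lemma measurable_PiM_UNIV:
  assumes "\<And>i. (\<lambda>\<omega>. f \<omega> i) \<in> measurable N (M i)"
  shows "f \<in> measurable N (PiM UNIV M)"
  by (rule measurable_PiM_single') (auto intro: assms measurable_space[OF assms])

text \<open>Reindexing a product along an injection gives a product; here the injection is
  \<open>case_option i0 e\<close> from \<open>'i option\<close>, and a product over
  \<open>'i option\<close> splits off the component \<open>None\<close>. Coordinates outside the
  range of the injection are simply dropped.\<close>

lemma distr_PiM_split_component: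
  fixes M :: "'i \<Rightarrow> 'a measure"
  assumes M: "\<And>i. prob_space (M i)" and e: "inj e" "i0 \<notin> range e" and Me: "\<And>i. M (e i) = M i"
  shows "distr (PiM UNIV M) (M i0 \<Otimes>\<^sub>M PiM UNIV M) (\<lambda>f. (f i0, \<lambda>i. f (e i))) =
    M i0 \<Otimes>\<^sub>M PiM UNIV M"
proof -
  define M' where "M' = case_option (M i0) M"
  define t where "t = case_option i0 e"
  have t_inj: "inj t"
  proof (rule injI)
    show "j = k" if "t j = t k" for j k
      using that e by (cases j; cases k) (auto simp: t_def dest: injD)
  qed
  have Mt: "M (t j) = M' j" for j by (cases j) (simp_all add: t_def M'_def Me)
  have M': "prob_space (M' j)" for j by (cases j) (simp_all add: M'_def M)
  have re: "distr (PiM UNIV M) (PiM UNIV M') (\<lambda>f j. f (t j)) = PiM UNIV M'"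
    using distr_PiM_reindex[of UNIV M t UNIV] t_inj M by (simp add: Mt restrict_def)
  have reS: "distr (PiM (range Some) M') (PiM UNIV M) (\<lambda>f j. f (Some j)) = PiM UNIV M"
    using distr_PiM_reindex[of "range Some" M' Some UNIV] M' by (simp add: M'_def restrict_def)
  have U: "insert None (range Some) = UNIV" using UNIV_option_conv by metis
  have ins: "distr (M i0 \<Otimes>\<^sub>M PiM (range Some) M') (PiM UNIV M') (\<lambda>(x, X). X(None := x)) = PiM UNIV M'"
    using distr_pair_PiM_eq_PiM[of "range Some" M' None] M' M by (simp add: M'_def U)
  have m1: "(\<lambda>f j. f (t j)) \<in> measurable (PiM UNIV M) (PiM UNIV M')"
    using measurable_component_singleton[of "t _" UNIV M]
    by (intro measurable_PiM_UNIV) (simp add: Mt)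
  have m2: "(\<lambda>F. (F None, \<lambda>i. F (Some i))) \<in> measurable (PiM UNIV M') (M i0 \<Otimes>\<^sub>M PiM UNIV M)"
    using measurable_component_singleton[of None UNIV M']
      measurable_component_singleton[of "Some _" UNIV M']
    by (intro measurable_Pair measurable_PiM_UNIV) (simp_all add: M'_def)
  have m3 [measurable]: "(\<lambda>(x, X). X(None := x)) \<in> measurable (M i0 \<Otimes>\<^sub>M PiM (range Some) M') (PiM UNIV M')"
    using measurable_add_dim[of None "range Some" M'] unfolding U
    by (simp add: M'_def measurable_split_conv measurable_pair_swap_iff[of _ "PiM _ _"] case_prod_beta)
  have m4: "(\<lambda>X j. X (Some j)) \<in> measurable (PiM (range Some) M') (PiM UNIV M)"
    using measurable_component_singleton[of "Some _" "range Some" M']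
    by (intro measurable_PiM_UNIV) (simp add: M'_def)
  have "distr (PiM UNIV M) (M i0 \<Otimes>\<^sub>M PiM UNIV M) (\<lambda>f. (f i0, \<lambda>i. f (e i))) =
    distr (distr (PiM UNIV M) (PiM UNIV M') (\<lambda>f j. f (t j))) (M i0 \<Otimes>\<^sub>M PiM UNIV M) (\<lambda>F. (F None, \<lambda>i. F (Some i)))"
    by (subst distr_distr[OF m2 m1]) (simp add: comp_def t_def)
  also have "\<dots> = distr (distr (M i0 \<Otimes>\<^sub>M PiM (range Some) M') (PiM UNIV M') (\<lambda>(x, X). X(None := x)))
      (M i0 \<Otimes>\<^sub>M PiM UNIV M) (\<lambda>F. (F None, \<lambda>i. F (Some i)))"
    unfolding re ins ..
  also have "\<dots> = distr (M i0 \<Otimes>\<^sub>M PiM (range Some) M') (M i0 \<Otimes>\<^sub>M PiM UNIV M) (\<lambda>(x, X). (x, \<lambda>j. X (Some j)))"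
    by (subst distr_distr[OF m2 m3]) (simp add: comp_def split_beta')
  also have "\<dots> = distr (M i0) (M i0) (\<lambda>x. x) \<Otimes>\<^sub>M distr (PiM (range Some) M') (PiM UNIV M) (\<lambda>f j. f (Some j))"
    by (rule pair_measure_distr[symmetric])
      (use m4 in \<open>auto simp: reS intro!: prob_space_imp_sigma_finite prob_space_PiM M M'\<close>)
  finally show ?thesis by (simp add: reS distr_id)
qed

section \<open>The law of the noise and the noise after the first jump\<close>

definition std_exponential :: "real measure" where
  "std_exponential = density lborel (\<lambda>u. ennreal (exponential_density 1 u))"

text \<open>Destinations are indexed by jump number and current state, so dropping the whole row of
  jump number 0 leaves a noise that serves a process restarted from any state.\<close>

definition shift_noise :: "'x noise \<Rightarrow> 'x noise" where
  "shift_noise \<omega> = ((\<lambda>i. fst \<omega> (Suc (fst i), snd i)), (\<lambda>m. snd \<omega> (Suc m)))"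

lemma prob_space_std_exponential: "prob_space std_exponential"
  unfolding std_exponential_def by (rule prob_space_exponential_density) simp

lemma sets_std_exponential [measurable_cong, simp]: "sets std_exponential = sets borel"
  by (simp add: std_exponential_def)

lemma space_std_exponential [simp]: "space std_exponential = UNIV"
  by (simp add: std_exponential_def)

lemma AE_std_exponential: "AE a in std_exponential. 0 < a"
proof -
  have "AE a in lborel. a \<noteq> (0::real)" by (rule AE_lborel_singleton)
  then show ?thesis unfolding std_exponential_def
    by (subst AE_density) (auto simp: exponential_density_def)
qed

lemma nn_integral_std_exponential:
  assumes [measurable]: "f \<in> borel_measurable borel"
  shows "(\<integral>\<^sup>+a. f a \<partial>std_exponential) = (\<integral>\<^sup>+a. ennreal (exp (- a)) * f a * indicator {0..} a \<partial>lborel)"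
  unfolding std_exponential_def
  by (subst nn_integral_density)
     (auto intro!: nn_integral_cong simp: exponential_density_def split: split_indicator)

lemma noise_measure_eq: "noise_measure Q =
  (\<Pi>\<^sub>M i\<in>UNIV. measure_pmf (jump_pmf Q (snd i))) \<Otimes>\<^sub>M (\<Pi>\<^sub>M m\<in>UNIV. std_exponential)"
  by (simp add: noise_measure_def std_exponential_def)

lemma prob_space_noise: "prob_space (noise_measure Q)"
  unfolding noise_measure_eq
  by (intro prob_space_pair prob_space_PiM measure_pmf.prob_space_axioms prob_space_std_exponential)

lemma sets_noise: "sets (noise_measure Q) =
  sets (PiM UNIV (\<lambda>_. count_space UNIV) \<Otimes>\<^sub>M PiM UNIV (\<lambda>_. borel))"
  unfolding noise_measure_eq
  by (intro sets_pair_measure_cong sets_PiM_cong) auto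

lemma space_noise [simp]: "space (noise_measure Q) = UNIV"
  using sets_eq_imp_space_eq[OF sets_noise[of Q]] by (simp add: space_pair_measure space_PiM)

lemma measurable_fst_noise [measurable]: "(\<lambda>\<omega>. fst \<omega> i) \<in> measurable (noise_measure Q) (count_space UNIV)"
  unfolding measurable_cong_sets[OF sets_noise refl]
  by (rule measurable_compose[OF measurable_fst measurable_component_singleton]) simp

lemma measurable_snd_noise [measurable]: "(\<lambda>\<omega>. snd \<omega> i) \<in> borel_measurable (noise_measure Q)"
  unfolding measurable_cong_sets[OF sets_noise refl]
  by (rule measurable_compose[OF measurable_snd measurable_component_singleton]) simp

lemma measurable_shift_noise [measurable]: "shift_noise \<in> measurable (noise_measure Q) (noise_measure Q)"
  unfolding measurable_cong_sets[OF refl sets_noise] shift_noise_def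
  by (intro measurable_Pair measurable_PiM_single') (auto split: prod.split)

text \<open>The variables \<open>\<xi> (0, z)\<close> with \<open>z \<noteq> x\<close> are never
  read by the process from \<open>x\<close> and disappear: neither the first destination nor the
  shifted family contains them. What the shift keeps has the law of the whole noise and is
  independent of the first destination and the first exponential variable.\<close>

lemma nn_integral_noise_first_step:
  assumes countable: "countable (UNIV :: 'x set)"
    and g: "\<And>y. (\<lambda>(a, \<omega>). g y a \<omega>) \<in> borel_measurable (borel \<Otimes>\<^sub>M noise_measure Q)"
  shows "(\<integral>\<^sup>+\<omega>. g (fst \<omega> (0, x :: 'x)) (snd \<omega> 0) (shift_noise \<omega>) \<partial>noise_measure Q) =
    (\<integral>\<^sup>+a. \<integral>\<^sup>+y. \<integral>\<^sup>+\<omega>. g y a \<omega> \<partial>noise_measure Q \<partial>measure_pmf (jump_pmf Q x) \<partial>std_exponential)"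
proof -
  define A where "A = (\<Pi>\<^sub>M i\<in>(UNIV::(nat \<times> 'x) set). measure_pmf (jump_pmf Q (snd i)))"
  define B where "B = (\<Pi>\<^sub>M m\<in>(UNIV::nat set). std_exponential)"
  let ?J = "measure_pmf (jump_pmf Q x)"
  interpret A: prob_space A unfolding A_def by (intro prob_space_PiM measure_pmf.prob_space_axioms)
  interpret B: prob_space B unfolding B_def by (intro prob_space_PiM prob_space_std_exponential)
  interpret E: prob_space std_exponential by (rule prob_space_std_exponential)
  have N: "noise_measure Q = A \<Otimes>\<^sub>M B" by (simp add: noise_measure_eq A_def B_def)
  interpret AB: pair_prob_space A B ..
  interpret JA: pair_sigma_finite ?J A ..
  interpret EB: pair_sigma_finite std_exponential B ..
  have sf: "sigma_finite_measure (std_exponential \<Otimes>\<^sub>M B)"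
    by (intro prob_space_imp_sigma_finite prob_space_pair E.prob_space_axioms B.prob_space_axioms)
  interpret EA: pair_sigma_finite std_exponential A ..
  interpret JE: pair_sigma_finite ?J std_exponential ..
  have dA: "distr A (?J \<Otimes>\<^sub>M A) (\<lambda>f. (f (0, x), \<lambda>i. f (Suc (fst i), snd i))) = ?J \<Otimes>\<^sub>M A"
    using distr_PiM_split_component[of "\<lambda>i. measure_pmf (jump_pmf Q (snd i))"
        "\<lambda>i. (Suc (fst i), snd i)" "(0, x)"]
    unfolding A_def by (simp add: measure_pmf.prob_space_axioms inj_on_def image_iff prod_eq_iff)
  have dB: "distr B (std_exponential \<Otimes>\<^sub>M B) (\<lambda>h. (h 0, \<lambda>m. h (Suc m))) = std_exponential \<Otimes>\<^sub>M B"
    using distr_PiM_split_component[of "\<lambda>_. std_exponential" Suc 0]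
    unfolding B_def by (auto simp: prob_space_std_exponential)
  have sA: "(\<lambda>f. (f (0, x), \<lambda>i. f (Suc (fst i), snd i))) \<in> measurable A (?J \<Otimes>\<^sub>M A)"
    unfolding A_def
    by (intro measurable_Pair measurable_PiM_single') (auto simp: space_PiM split: prod.splits)
  have sB: "(\<lambda>h. (h 0, \<lambda>m. h (Suc m))) \<in> measurable B (std_exponential \<Otimes>\<^sub>M B)"
    unfolding B_def by (intro measurable_Pair measurable_PiM_single') (auto simp: space_PiM)
  \<comment> \<open>\<open>g\<close> is only known to be measurable for each fixed \<open>y\<close>;
    as \<open>y\<close> takes countably many discrete values, this adds up to joint
    measurability.\<close>
  have g' [measurable]: "(\<lambda>(y, a, f, h). g y a (f, h)) \<in> borel_measurable (?J \<Otimes>\<^sub>M (std_exponential \<Otimes>\<^sub>M (A \<Otimes>\<^sub>M B)))"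
  proof -
    have eq: "sets (?J \<Otimes>\<^sub>M (std_exponential \<Otimes>\<^sub>M (A \<Otimes>\<^sub>M B))) = sets (count_space UNIV \<Otimes>\<^sub>M (borel \<Otimes>\<^sub>M noise_measure Q))"
      unfolding N by (intro sets_pair_measure_cong) auto
    have "(\<lambda>(y, p). g y (fst p) (snd p)) \<in> borel_measurable (count_space UNIV \<Otimes>\<^sub>M (borel \<Otimes>\<^sub>M noise_measure Q))"
      using g by (intro measurable_pair_measure_countable1[OF countable]) (auto simp: case_prod_beta)
    then show ?thesis unfolding measurable_cong_sets[OF eq refl] by (simp add: case_prod_beta)
  qed
  have [measurable]: "(\<lambda>\<omega>. g (fst \<omega> (0, x)) (snd \<omega> 0) (shift_noise \<omega>)) \<in> borel_measurable (A \<Otimes>\<^sub>M B)"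
  proof -
    have "(\<lambda>(f, h). (f (0, x), h 0, \<lambda>i. f (Suc (fst i), snd i), \<lambda>m. h (Suc m))) \<in>
       measurable (A \<Otimes>\<^sub>M B) (?J \<Otimes>\<^sub>M (std_exponential \<Otimes>\<^sub>M (A \<Otimes>\<^sub>M B)))"
      using measurable_compose[OF measurable_fst sA, of B] measurable_compose[OF measurable_snd sB, of A]
      by (simp add: measurable_split_conv measurable_pair_iff comp_def split_beta)
    from measurable_compose[OF this g'] show ?thesis
      by (simp add: shift_noise_def case_prod_beta comp_def)
  qed
  have mf: "(\<lambda>p. g y (fst p) (f, snd p)) \<in> borel_measurable (std_exponential \<Otimes>\<^sub>M B)"
    if "f \<in> space A" for y f
  proof -
    have "(\<lambda>p. (y, fst p, f, snd p)) \<in> measurable (std_exponential \<Otimes>\<^sub>M B)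
        (?J \<Otimes>\<^sub>M (std_exponential \<Otimes>\<^sub>M (A \<Otimes>\<^sub>M B)))"
      using that by measurable
    from measurable_compose[OF this g'] show ?thesis by simp
  qed
  have mB: "(\<lambda>(a, f). \<integral>\<^sup>+h. g y a (f, h) \<partial>B) \<in> borel_measurable (std_exponential \<Otimes>\<^sub>M A)" for y
  proof -
    have "(\<lambda>q. (y, fst (fst q), snd (fst q), snd q)) \<in> measurable ((std_exponential \<Otimes>\<^sub>M A) \<Otimes>\<^sub>M B)
        (?J \<Otimes>\<^sub>M (std_exponential \<Otimes>\<^sub>M (A \<Otimes>\<^sub>M B)))"
      by measurable
    from measurable_compose[OF this g']
    have "(\<lambda>p. \<integral>\<^sup>+h. g y (fst p) (snd p, h) \<partial>B) \<in> borel_measurable (std_exponential \<Otimes>\<^sub>M A)"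
      by (intro B.borel_measurable_nn_integral) (simp add: split_beta' comp_def)
    then show ?thesis by (simp add: split_beta')
  qed
  have mAB: "g y a \<in> borel_measurable (A \<Otimes>\<^sub>M B)" for y a
  proof -
    have "(\<lambda>q. (y, a, fst q, snd q)) \<in> measurable (A \<Otimes>\<^sub>M B)
        (?J \<Otimes>\<^sub>M (std_exponential \<Otimes>\<^sub>M (A \<Otimes>\<^sub>M B)))"
      by measurable
    from measurable_compose[OF this g'] show ?thesis by simp
  qed
  have mJE: "(\<lambda>(y, a). \<integral>\<^sup>+\<omega>. g y a \<omega> \<partial>(A \<Otimes>\<^sub>M B)) \<in> borel_measurable (?J \<Otimes>\<^sub>M std_exponential)"
  proof -
    have "(\<lambda>q. (fst (fst q), snd (fst q), snd q)) \<in> measurable ((?J \<Otimes>\<^sub>M std_exponential) \<Otimes>\<^sub>M (A \<Otimes>\<^sub>M B))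
        (?J \<Otimes>\<^sub>M (std_exponential \<Otimes>\<^sub>M (A \<Otimes>\<^sub>M B)))"
      by measurable
    from measurable_compose[OF this g']
    have "(\<lambda>p. \<integral>\<^sup>+\<omega>. g (fst p) (snd p) \<omega> \<partial>(A \<Otimes>\<^sub>M B)) \<in> borel_measurable (?J \<Otimes>\<^sub>M std_exponential)"
      by (intro sigma_finite_measure.borel_measurable_nn_integral[OF AB.sigma_finite_measure_axioms])
        (simp add: split_beta' comp_def)
    then show ?thesis by (simp add: split_beta')
  qed
  have mG: "(\<lambda>r. \<integral>\<^sup>+p. g (fst r) (fst p) (snd r, snd p) \<partial>(std_exponential \<Otimes>\<^sub>M B)) \<in> borel_measurable (?J \<Otimes>\<^sub>M A)"
  proof (rule sigma_finite_measure.borel_measurable_nn_integral[OF sf])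
    have "(\<lambda>q. (fst (fst q), fst (snd q), snd (fst q), snd (snd q))) \<in>
      measurable ((?J \<Otimes>\<^sub>M A) \<Otimes>\<^sub>M (std_exponential \<Otimes>\<^sub>M B)) (?J \<Otimes>\<^sub>M (std_exponential \<Otimes>\<^sub>M (A \<Otimes>\<^sub>M B)))"
      by measurable
    from measurable_compose[OF this g']
    show "(\<lambda>(r, p). g (fst r) (fst p) (snd r, snd p)) \<in>
      borel_measurable ((?J \<Otimes>\<^sub>M A) \<Otimes>\<^sub>M (std_exponential \<Otimes>\<^sub>M B))"
      by (simp add: split_beta' comp_def)
  qed
  have "(\<integral>\<^sup>+\<omega>. g (fst \<omega> (0, x)) (snd \<omega> 0) (shift_noise \<omega>) \<partial>noise_measure Q) =
    (\<integral>\<^sup>+f. \<integral>\<^sup>+h. g (f (0, x)) (h 0) (shift_noise (f, h)) \<partial>B \<partial>A)"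
    unfolding N by (subst B.nn_integral_fst[symmetric]) (auto simp: case_prod_beta)
  also have "\<dots> = (\<integral>\<^sup>+f. \<integral>\<^sup>+h. g (f (0, x)) (h 0) (\<lambda>i. f (Suc (fst i), snd i), \<lambda>m. h (Suc m)) \<partial>B \<partial>A)"
    by (simp add: shift_noise_def case_prod_beta)
  also have "\<dots> = (\<integral>\<^sup>+f. \<integral>\<^sup>+p. g (f (0, x)) (fst p) (\<lambda>i. f (Suc (fst i), snd i), snd p) \<partial>(std_exponential \<Otimes>\<^sub>M B) \<partial>A)"
  proof (rule nn_integral_cong)
    fix f assume f: "f \<in> space A"
    have "(\<lambda>i. f (Suc (fst i), snd i)) \<in> space A" by (simp add: A_def space_PiM)
    note mf[OF this, of "f (0, x)"]
    then show "(\<integral>\<^sup>+h. g (f (0, x)) (h 0) (\<lambda>i. f (Suc (fst i), snd i), \<lambda>m. h (Suc m)) \<partial>B) =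
       (\<integral>\<^sup>+p. g (f (0, x)) (fst p) (\<lambda>i. f (Suc (fst i), snd i), snd p) \<partial>(std_exponential \<Otimes>\<^sub>M B))"
      by (subst dB[symmetric], subst nn_integral_distr[OF sB]) simp_all
  qed
  also have "\<dots> = (\<integral>\<^sup>+r. \<integral>\<^sup>+p. g (fst r) (fst p) (snd r, snd p) \<partial>(std_exponential \<Otimes>\<^sub>M B) \<partial>(?J \<Otimes>\<^sub>M A))"
    by (subst dA[symmetric], subst nn_integral_distr[OF sA]) (use mG in simp_all)
  \<comment> \<open>From here on only the order of integration changes, from \<open>y\<close>,
    \<open>f\<close>, \<open>a\<close>, \<open>h\<close> to \<open>a\<close>, \<open>y\<close> and
    the pair of \<open>f\<close> and \<open>h\<close>.\<close>
  also have "\<dots> = (\<integral>\<^sup>+y. \<integral>\<^sup>+f. \<integral>\<^sup>+a. \<integral>\<^sup>+h. g y a (f, h) \<partial>B \<partial>std_exponential \<partial>A \<partial>?J)"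
  proof -
    have "(\<integral>\<^sup>+p. g y (fst p) (f, snd p) \<partial>(std_exponential \<Otimes>\<^sub>M B)) = (\<integral>\<^sup>+a. \<integral>\<^sup>+h. g y a (f, h) \<partial>B \<partial>std_exponential)"
      if "f \<in> space A" for y f
      using mf[OF that] by (subst B.nn_integral_fst[symmetric]) simp_all
    then show ?thesis
      using mG by (subst A.nn_integral_fst[symmetric]) (simp_all cong: nn_integral_cong)
  qed
  also have "\<dots> = (\<integral>\<^sup>+y. \<integral>\<^sup>+a. \<integral>\<^sup>+f. \<integral>\<^sup>+h. g y a (f, h) \<partial>B \<partial>A \<partial>std_exponential \<partial>?J)"
    by (intro nn_integral_cong EA.Fubini' mB)
  also have "\<dots> = (\<integral>\<^sup>+y. \<integral>\<^sup>+a. \<integral>\<^sup>+\<omega>. g y a \<omega> \<partial>(A \<Otimes>\<^sub>M B) \<partial>std_exponential \<partial>?J)"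
    by (intro nn_integral_cong B.nn_integral_fst mAB)
  also have "\<dots> = (\<integral>\<^sup>+a. \<integral>\<^sup>+y. \<integral>\<^sup>+\<omega>. g y a \<omega> \<partial>(A \<Otimes>\<^sub>M B) \<partial>?J \<partial>std_exponential)"
    by (rule JE.Fubini'[symmetric, OF mJE])
  finally show ?thesis by (simp add: N)
qed

section \<open>Generators on a countable state space\<close>

text \<open>Holding times are therefore nonnegative in the first-step identities and strictly
  positive where the process has to be located at a jump time.\<close>

lemma AE_noise_positive:
  fixes Q :: "'x \<Rightarrow> 'x \<Rightarrow> real"
  shows "AE \<omega> in noise_measure Q. \<forall>m. 0 < snd \<omega> m"
proof (subst AE_all_countable, rule)
  fix m :: nat
  interpret A: prob_space "\<Pi>\<^sub>M i\<in>UNIV. measure_pmf (jump_pmf Q (snd i))"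
    by (intro prob_space_PiM measure_pmf.prob_space_axioms)
  interpret B: product_prob_space "\<lambda>_. std_exponential" UNIV
    by (intro product_prob_spaceI prob_space_std_exponential)
  have "AE h in (\<Pi>\<^sub>M m\<in>UNIV. std_exponential). 0 < h m"
    by (rule B.AE_component) (auto simp: AE_std_exponential)
  moreover interpret pair_sigma_finite "\<Pi>\<^sub>M i\<in>UNIV. measure_pmf (jump_pmf Q (snd i))"
    "\<Pi>\<^sub>M m\<in>UNIV. std_exponential" ..
  have "{\<omega>. 0 < snd \<omega> m} \<in> sets (noise_measure Q)"
    using measurable_sets[OF measurable_snd_noise, of "{0<..}" m Q] by (simp add: vimage_def)
  ultimately show "AE \<omega> in noise_measure Q. 0 < snd \<omega> m"
    using space_noise[of Q] unfolding noise_measure_eq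
    by (intro AE_pair_measure) auto
qed

text \<open>Finitely many targets per state, with no bound over the states: integrals against the
  jump law become finite sums, through which limits and integrals pass freely, while unbounded exit
  rates and hence explosion remain possible.\<close>

locale generator_matrix =
  fixes Q :: "'x \<Rightarrow> 'x \<Rightarrow> real"
  assumes countable_states: "countable (UNIV :: 'x set)"
    and rate_nonneg: "x \<noteq> y \<Longrightarrow> 0 \<le> Q x y"
    and finite_targets: "finite {y. y \<noteq> x \<and> Q x y \<noteq> 0}"
    and diagonal: "Q x x = - (\<Sum>y | y \<noteq> x \<and> Q x y \<noteq> 0. Q x y)"
begin

abbreviation "N \<equiv> noise_measure Q"
abbreviation "q \<equiv> exit_rate Q"

definition targets :: "'x \<Rightarrow> 'x set" where "targets x = {y. y \<noteq> x \<and> Q x y \<noteq> 0}"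

lemma finite_set_targets [simp]: "finite (targets x)"
  unfolding targets_def by (rule finite_targets)

lemma rate_pos: "y \<in> targets x \<Longrightarrow> 0 < Q x y"
  using rate_nonneg[of x y] by (auto simp: targets_def)

lemma exit_rate_eq: "q x = (\<Sum>y\<in>targets x. Q x y)"
  using diagonal[of x] by (simp add: exit_rate_def targets_def)

lemma exit_rate_nonneg [simp]: "0 \<le> q x"
  unfolding exit_rate_eq by (intro sum_nonneg) (auto dest: rate_pos)

lemma exit_rate_zero_iff: "q x = 0 \<longleftrightarrow> targets x = {}"
  unfolding exit_rate_eq using rate_pos[of _ x]
  by (subst sum_nonneg_eq_0_iff) (auto intro: less_imp_le)

sublocale N: prob_space N
  by (rule prob_space_noise)

lemma nn_integral_jump_pmf:
  assumes "q x \<noteq> 0"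
  shows "(\<integral>\<^sup>+y. f y \<partial>measure_pmf (jump_pmf Q x)) = (\<Sum>y\<in>targets x. ennreal (Q x y / q x) * f y)"
proof -
  have nn: "0 \<le> (if y = x then 0 else Q x y / q x)" for y
    using rate_nonneg[of x y] by auto
  have "(\<integral>\<^sup>+y. ennreal (if y = x then 0 else Q x y / q x) \<partial>count_space UNIV)
      = (\<Sum>y\<in>targets x. ennreal (if y = x then 0 else Q x y / q x))"
    by (rule nn_integral_count_space'[of "targets x"]) (auto simp: targets_def finite_targets)
  also have "\<dots> = ennreal (\<Sum>y\<in>targets x. Q x y / q x)"
    by (subst sum_ennreal) (auto simp: targets_def finite_targets rate_nonneg intro!: arg_cong[where f=ennreal] sum.cong)
  also have "(\<Sum>y\<in>targets x. Q x y / q x) = 1"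
    using assms by (simp add: sum_divide_distrib[symmetric] exit_rate_eq[symmetric])
  finally have pmf: "pmf (jump_pmf Q x) y = (if y = x then 0 else Q x y / q x)" for y
    using assms unfolding jump_pmf_def by (simp add: pmf_embed_pmf[OF nn])
  show ?thesis
    by (subst nn_integral_measure_pmf_support[of "targets x"])
       (auto simp: pmf targets_def finite_targets set_pmf_eq mult.commute intro!: sum.cong split: if_splits)
qed

section \<open>Measurability, and the process in terms of its first jump\<close>

lemma measurable_jump_chain [measurable]: "(\<lambda>\<omega>. jump_chain x \<omega> m) \<in> measurable N (count_space UNIV)"
proof (induction m)
  case (Suc m)
  have "(\<lambda>\<omega>. (\<lambda>z \<omega>. fst \<omega> (m, z)) (jump_chain x \<omega> m) \<omega>) \<in> measurable N (count_space UNIV)"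
    by (rule measurable_compose_countable'[OF _ Suc countable_states]) simp
  then show ?case by simp
qed simp

lemma measurable_holding_time [measurable]: "(\<lambda>\<omega>. holding_time Q x \<omega> m) \<in> borel_measurable N"
proof -
  have [measurable]: "(\<lambda>\<omega>. q (jump_chain x \<omega> m)) \<in> borel_measurable N"
    by (rule measurable_compose[OF measurable_jump_chain]) simp
  show ?thesis unfolding holding_time_def Let_def by measurable
qed

lemma measurable_jump_time [measurable]: "(\<lambda>\<omega>. jump_time Q x \<omega> m) \<in> borel_measurable N"
  unfolding jump_time_def by measurable

text \<open>Measurability jointly in time and noise is needed because after a first jump at the
  random time \<open>u\<close> the process is evaluated at \<open>t - u\<close>.\<close>

lemma measurable_process_joint:
  "(\<lambda>p. process Q x (fst p) (snd p)) \<in> measurable (borel \<Otimes>\<^sub>M N) (count_space UNIV)"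
proof -
  have [measurable]: "(\<lambda>p. jump_time Q x (snd p) m) \<in> borel_measurable (borel \<Otimes>\<^sub>M N)" for m
    by (rule measurable_compose[OF measurable_snd measurable_jump_time])
  have [measurable]: "(\<lambda>p. jump_chain x (snd p) m) \<in> measurable (borel \<Otimes>\<^sub>M N) (count_space UNIV)" for m
    by (rule measurable_compose[OF measurable_snd measurable_jump_chain])
  have L [measurable]: "(\<lambda>p. LEAST m. ennreal (fst p) < jump_time Q x (snd p) (Suc m)) \<in> measurable (borel \<Otimes>\<^sub>M N) (count_space UNIV)"
    by measurable
  have [measurable]: "(\<lambda>p. jump_chain x (snd p) (LEAST m. ennreal (fst p) < jump_time Q x (snd p) (Suc m)))
      \<in> measurable (borel \<Otimes>\<^sub>M N) (count_space UNIV)"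
    by (rule measurable_compose_countable'[OF _ L]) auto
  have [measurable]: "Measurable.pred (borel \<Otimes>\<^sub>M N) (\<lambda>p. \<exists>m. ennreal (fst p) < jump_time Q x (snd p) (Suc m))"
    by measurable
  show ?thesis unfolding process_def
    by (intro measurable_If measurable_compose[OF _ measurable_count_space, of _ _ UNIV Some]) measurable
qed

lemma measurable_process [measurable (raw)]:
  assumes "f \<in> borel_measurable K" "g \<in> measurable K N"
  shows "(\<lambda>k. process Q x (f k) (g k)) \<in> measurable K (count_space UNIV)"
  using measurable_compose[OF measurable_Pair[OF assms] measurable_process_joint] by simp

lemma jump_chain_shift: "jump_chain x \<omega> (Suc m) = jump_chain (fst \<omega> (0, x)) (shift_noise \<omega>) m"
  by (induction m) (simp_all add: shift_noise_def)

lemma holding_time_shift: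
  "holding_time Q x \<omega> (Suc m) = holding_time Q (fst \<omega> (0, x)) (shift_noise \<omega>) m"
  unfolding holding_time_def jump_chain_shift by (simp add: shift_noise_def Let_def)

lemma jump_time_0 [simp]: "jump_time Q x \<omega> 0 = 0"
  by (simp add: jump_time_def)

lemma jump_time_shift:
  "jump_time Q x \<omega> (Suc m) = holding_time Q x \<omega> 0 + jump_time Q (fst \<omega> (0, x)) (shift_noise \<omega>) m"
  unfolding jump_time_def by (simp add: sum.lessThan_Suc_shift holding_time_shift del: sum.lessThan_Suc)

lemma jump_time_Suc: "jump_time Q x \<omega> (Suc m) = jump_time Q x \<omega> m + holding_time Q x \<omega> m"
  by (simp add: jump_time_def)

lemma jump_time_mono: "m \<le> k \<Longrightarrow> jump_time Q x \<omega> m \<le> jump_time Q x \<omega> k"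
  unfolding jump_time_def by (intro sum_mono2) auto

text \<open>Grading the event \<open>process Q x t \<omega> = Some z\<close> by the number
  \<open>m\<close> of jumps made up to time \<open>t\<close> replaces the \<open>LEAST\<close> in
  \<open>process\<close> by an induction on \<open>m\<close>.\<close>

definition at_jump :: "'x \<Rightarrow> real \<Rightarrow> nat \<Rightarrow> 'x \<Rightarrow> 'x noise \<Rightarrow> bool" where
  "at_jump x t m z \<omega> \<longleftrightarrow> jump_time Q x \<omega> m \<le> ennreal t \<and> ennreal t < jump_time Q x \<omega> (Suc m) \<and>
     jump_chain x \<omega> m = z"

lemma measurable_at_jump [measurable (raw)]:
  assumes [measurable]: "f \<in> borel_measurable K" "g \<in> measurable K N"
  shows "Measurable.pred K (\<lambda>k. at_jump x (f k) m z (g k))"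
proof -
  have [measurable]: "(\<lambda>k. jump_time Q x (g k) m) \<in> borel_measurable K" for m
    by (rule measurable_compose[OF _ measurable_jump_time]) measurable
  have [measurable]: "(\<lambda>k. jump_chain x (g k) m) \<in> measurable K (count_space UNIV)"
    by (rule measurable_compose[OF _ measurable_jump_chain]) measurable
  show ?thesis unfolding at_jump_def by measurable
qed

lemma at_jump_LEAST:
  assumes "jump_time Q x \<omega> m \<le> ennreal t" "ennreal t < jump_time Q x \<omega> (Suc m)"
  shows "(LEAST m. ennreal t < jump_time Q x \<omega> (Suc m)) = m"
proof (rule Least_equality)
  fix k assume k: "ennreal t < jump_time Q x \<omega> (Suc k)"
  show "m \<le> k"
  proof (rule ccontr)
    assume "\<not> m \<le> k"
    then have "jump_time Q x \<omega> (Suc k) \<le> jump_time Q x \<omega> m" by (intro jump_time_mono) simp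
    with k assms(1) show False by (metis leD order_trans)
  qed
qed fact

lemma process_eq_Some_iff: "process Q x t \<omega> = Some z \<longleftrightarrow> (\<exists>m. at_jump x t m z \<omega>)"
proof
  assume P: "process Q x t \<omega> = Some z"
  let ?P = "\<lambda>m. ennreal t < jump_time Q x \<omega> (Suc m)"
  from P have ex: "\<exists>m. ?P m" and z: "jump_chain x \<omega> (Least ?P) = z"
    unfolding process_def by (auto split: if_splits)
  have "?P (Least ?P)" using LeastI_ex[OF ex] .
  moreover have "jump_time Q x \<omega> (Least ?P) \<le> ennreal t"
  proof (cases "Least ?P")
    case (Suc k)
    then have "\<not> ?P k" by (metis not_less_Least lessI)
    then show ?thesis unfolding Suc by simp
  qed simp
  ultimately show "\<exists>m. at_jump x t m z \<omega>" using z unfolding at_jump_def by blast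
next
  assume "\<exists>m. at_jump x t m z \<omega>"
  then obtain m where m: "at_jump x t m z \<omega>" ..
  then have "(LEAST m. ennreal t < jump_time Q x \<omega> (Suc m)) = m"
    by (intro at_jump_LEAST) (auto simp: at_jump_def)
  with m show "process Q x t \<omega> = Some z" unfolding process_def at_jump_def by auto
qed

lemma at_jump_unique: "at_jump x t m z \<omega> \<Longrightarrow> at_jump x t k w \<omega> \<Longrightarrow> m = k \<and> z = w"
  using at_jump_LEAST[of x \<omega> m t] at_jump_LEAST[of x \<omega> k t] by (auto simp: at_jump_def)

lemma process_None_iff: "process Q x t \<omega> = None \<longleftrightarrow> (\<forall>m. jump_time Q x \<omega> (Suc m) \<le> ennreal t)"
  by (simp add: process_def linorder_not_less[symmetric])

lemma ennreal_less_add_iff: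
  assumes "0 \<le> u" "u \<le> t"
  shows "ennreal t < ennreal u + b \<longleftrightarrow> ennreal (t - u) < b"
    "ennreal u + b \<le> ennreal t \<longleftrightarrow> b \<le> ennreal (t - u)"
proof -
  show "ennreal u + b \<le> ennreal t \<longleftrightarrow> b \<le> ennreal (t - u)"
    using assms by (cases b) (auto simp: ennreal_plus[symmetric] top_unique simp del: ennreal_plus)
  then show "ennreal t < ennreal u + b \<longleftrightarrow> ennreal (t - u) < b" by (simp add: not_le[symmetric])
qed

context
  fixes x :: 'x and \<omega> :: "'x noise" and u :: real
  assumes q_pos: "0 < q x" and u: "u = snd \<omega> 0 / q x" and u_nonneg: "0 \<le> u"
begin

lemma holding_time_first: "holding_time Q x \<omega> 0 = ennreal u"
  using q_pos by (simp add: holding_time_def u Let_def)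

lemma at_jump_0_first: "0 \<le> t \<Longrightarrow> at_jump x t 0 z \<omega> \<longleftrightarrow> t < u \<and> z = x"
  using u_nonneg by (auto simp: at_jump_def jump_time_Suc holding_time_first ennreal_less_iff)

lemma at_jump_Suc_first:
  assumes "0 \<le> t"
  shows "at_jump x t (Suc m) z \<omega> \<longleftrightarrow> u \<le> t \<and> at_jump (fst \<omega> (0, x)) (t - u) m z (shift_noise \<omega>)"
proof (cases "u \<le> t")
  case True
  then show ?thesis
    unfolding at_jump_def jump_time_shift jump_chain_shift holding_time_first
    using ennreal_less_add_iff[OF u_nonneg True] by simp
next
  case False
  then have "ennreal t < ennreal u" using assms u_nonneg by (simp add: ennreal_less_iff)
  then have "\<not> jump_time Q x \<omega> (Suc m) \<le> ennreal t"
    unfolding jump_time_shift holding_time_first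
    by (metis add.commute le_iff_add leD order_trans)
  then show ?thesis using False by (simp add: at_jump_def)
qed

lemma process_first:
  assumes "0 \<le> t"
  shows "process Q x t \<omega> =
    (if t < u then Some x else process Q (fst \<omega> (0, x)) (t - u) (shift_noise \<omega>))"
proof (cases "t < u")
  case True
  then have "at_jump x t 0 x \<omega>" using assms by (simp add: at_jump_0_first)
  then show ?thesis using True process_eq_Some_iff[of x t \<omega> x] by auto
next
  case False
  have "process Q x t \<omega> = Some z \<longleftrightarrow> process Q (fst \<omega> (0, x)) (t - u) (shift_noise \<omega>) = Some z" for z
  proof -
    have "(\<exists>m. at_jump x t m z \<omega>) \<longleftrightarrow> (\<exists>m. at_jump x t (Suc m) z \<omega>)"
      using False assms by (metis at_jump_0_first not0_implies_Suc)
    then show ?thesis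
      unfolding process_eq_Some_iff using False assms by (simp add: at_jump_Suc_first)
  qed
  then show ?thesis using False by (metis not_None_eq)
qed

end

lemma holding_time_absorbing:
  assumes "q x = 0" shows "holding_time Q x \<omega> 0 = \<infinity>"
  using assms by (simp add: holding_time_def)

lemma at_jump_absorbing:
  assumes "q x = 0" shows "at_jump x t m z \<omega> \<longleftrightarrow> m = 0 \<and> z = x"
  using assms by (cases m) (auto simp: at_jump_def jump_time_shift holding_time_absorbing top_unique)

lemma process_absorbing:
  assumes "q x = 0" shows "process Q x t \<omega> = Some x"
  unfolding process_eq_Some_iff by (simp add: at_jump_absorbing[OF assms])

text \<open>Time is measured by the holding time \<open>u = a / q x\<close> instead of the standard
  exponential variable \<open>a\<close>. The Jacobian \<open>q x\<close> of this substitution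
  cancels the denominators of the jump law, so that the rates \<open>Q x y\<close> themselves
  appear.\<close>

lemma nn_integral_first_step:
  assumes q: "0 < q x"
    and g [measurable]: "\<And>y. (\<lambda>p. g y (fst p) (snd p)) \<in> borel_measurable (borel \<Otimes>\<^sub>M N)"
  shows "(\<integral>\<^sup>+\<omega>. g (fst \<omega> (0, x)) (snd \<omega> 0 / q x) (shift_noise \<omega>) \<partial>N) =
    (\<integral>\<^sup>+u. ennreal (exp (- q x * u)) * (\<Sum>y\<in>targets x. ennreal (Q x y) * (\<integral>\<^sup>+\<omega>. g y u \<omega> \<partial>N))
       * indicator {0..} u \<partial>lborel)"
proof -
  have G [measurable]: "(\<lambda>u. \<integral>\<^sup>+\<omega>. g y u \<omega> \<partial>N) \<in> borel_measurable borel" for y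
    using g[of y] by (intro N.borel_measurable_nn_integral) (simp add: split_beta')
  have "(\<integral>\<^sup>+\<omega>. g (fst \<omega> (0, x)) (snd \<omega> 0 / q x) (shift_noise \<omega>) \<partial>N) =
    (\<integral>\<^sup>+a. \<integral>\<^sup>+y. \<integral>\<^sup>+\<omega>. g y (a / q x) \<omega> \<partial>N \<partial>measure_pmf (jump_pmf Q x) \<partial>std_exponential)"
  proof (rule nn_integral_noise_first_step[where g = "\<lambda>y a \<omega>. g y (a / q x) \<omega>", OF countable_states])
    fix y
    have "(\<lambda>p. (fst p / q x, snd p)) \<in> measurable (borel \<Otimes>\<^sub>M N) (borel \<Otimes>\<^sub>M N)" by measurable
    from measurable_compose[OF this g[of y]]
    show "(\<lambda>(a, \<omega>). g y (a / q x) \<omega>) \<in> borel_measurable (borel \<Otimes>\<^sub>M N)" by (simp add: split_beta')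
  qed
  also have "\<dots> = (\<integral>\<^sup>+a. (\<Sum>y\<in>targets x. ennreal (Q x y / q x) * (\<integral>\<^sup>+\<omega>. g y (a / q x) \<omega> \<partial>N)) \<partial>std_exponential)"
    using q by (simp add: nn_integral_jump_pmf)
  also have "\<dots> = (\<integral>\<^sup>+a. ennreal (exp (- a)) * (\<Sum>y\<in>targets x. ennreal (Q x y / q x) * (\<integral>\<^sup>+\<omega>. g y (a / q x) \<omega> \<partial>N))
        * indicator {0..} a \<partial>lborel)"
    by (rule nn_integral_std_exponential) measurable
  also have "\<dots> = ennreal (q x) * (\<integral>\<^sup>+u. ennreal (exp (- q x * u)) * (\<Sum>y\<in>targets x. ennreal (Q x y / q x) * (\<integral>\<^sup>+\<omega>. g y u \<omega> \<partial>N))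
        * indicator {0..} u \<partial>lborel)"
    using q by (subst nn_integral_real_affine[of _ "q x" 0])
      (auto simp: indicator_def zero_le_mult_iff intro!: arg_cong[where f="\<lambda>z. _ * z"] nn_integral_cong)
  also have "\<dots> = (\<integral>\<^sup>+u. ennreal (exp (- q x * u)) * (\<Sum>y\<in>targets x. ennreal (Q x y) * (\<integral>\<^sup>+\<omega>. g y u \<omega> \<partial>N))
        * indicator {0..} u \<partial>lborel)"
  proof (subst nn_integral_cmult[symmetric], measurable, intro nn_integral_cong)
    fix u
    have e: "ennreal (q x) * ennreal (Q x y / q x) = ennreal (Q x y)" if "y \<in> targets x" for y
      using q rate_pos[OF that] by (simp add: ennreal_mult'[symmetric])
    have *: "ennreal (q x) * (\<Sum>y\<in>targets x. ennreal (Q x y / q x) * (\<integral>\<^sup>+\<omega>. g y u \<omega> \<partial>N)) =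
       (\<Sum>y\<in>targets x. ennreal (Q x y) * (\<integral>\<^sup>+\<omega>. g y u \<omega> \<partial>N))"
      unfolding sum_distrib_left by (intro sum.cong) (simp_all add: e[symmetric] mult.assoc)
    show "ennreal (q x) * (ennreal (exp (- q x * u)) *
        (\<Sum>y\<in>targets x. ennreal (Q x y / q x) * (\<integral>\<^sup>+\<omega>. g y u \<omega> \<partial>N)) * indicator {0..} u) =
      ennreal (exp (- q x * u)) * (\<Sum>y\<in>targets x. ennreal (Q x y) * (\<integral>\<^sup>+\<omega>. g y u \<omega> \<partial>N)) * indicator {0..} u"
      unfolding *[symmetric] by (simp only: ac_simps)
  qed
  finally show ?thesis .
qed

text \<open>\<open>EF\<close> is asked for nonnegative holding times only, which is enough because
  the noise is almost surely positive; the pathwise identities for the first jump may fail for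
  negative ones.\<close>

lemma emeasure_first_step:
  assumes q: "0 < q x"
    and F [measurable]: "\<And>y. Measurable.pred (borel \<Otimes>\<^sub>M N) (\<lambda>p. F y (fst p) (snd p))"
    and E [measurable]: "Measurable.pred N E"
    and EF: "\<And>\<omega>. 0 \<le> snd \<omega> 0 / q x \<Longrightarrow> E \<omega> \<longleftrightarrow> F (fst \<omega> (0, x)) (snd \<omega> 0 / q x) (shift_noise \<omega>)"
  shows "emeasure N {\<omega>. E \<omega>} =
    (\<integral>\<^sup>+u. ennreal (exp (- q x * u)) * (\<Sum>y\<in>targets x. ennreal (Q x y) * emeasure N {\<omega>. F y u \<omega>})
       * indicator {0..} u \<partial>lborel)"
proof -
  have S: "{\<omega>. P \<omega>} \<in> sets N" if "Measurable.pred N P" for P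
    using that by (simp add: pred_def)
  have Fu: "Measurable.pred N (F y u)" for y u
    using measurable_compose[OF measurable_Pair1' F[of y], of u] by (simp add: comp_def)
  have "emeasure N {\<omega>. E \<omega>} = (\<integral>\<^sup>+\<omega>. indicator {\<omega>. E \<omega>} \<omega> \<partial>N)"
    by (simp add: S)
  also have "\<dots> = (\<integral>\<^sup>+\<omega>. (\<lambda>y u \<omega>. indicator {\<omega>. F y u \<omega>} \<omega>) (fst \<omega> (0, x)) (snd \<omega> 0 / q x) (shift_noise \<omega>) \<partial>N)"
  proof (rule nn_integral_cong_AE, use AE_noise_positive in eventually_elim)
    case (elim \<omega>)
    have "0 \<le> snd \<omega> 0 / q x" using elim[rule_format, of 0] q by simp
    then show ?case using EF[of \<omega>] by (simp add: indicator_def)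
  qed
  also have "\<dots> = (\<integral>\<^sup>+u. ennreal (exp (- q x * u)) * (\<Sum>y\<in>targets x. ennreal (Q x y) *
      (\<integral>\<^sup>+\<omega>. indicator {\<omega>. F y u \<omega>} \<omega> \<partial>N)) * indicator {0..} u \<partial>lborel)"
    using F by (intro nn_integral_first_step[OF q]) (simp add: indicator_def)
  finally show ?thesis by (simp add: S Fu)
qed

end

section \<open>The Markov property\<close>

lemma nn_integral_exp_tail:
  assumes "0 < c"
  shows "(\<integral>\<^sup>+u. ennreal (c * exp (- c * u)) * indicator {t..} u \<partial>lborel) = ennreal (exp (- c * t))"
proof -
  have lim: "((\<lambda>u. - exp (- c * u)) \<longlongrightarrow> - 0) at_top"
    using assms
    by (intro tendsto_minus filterlim_compose[OF exp_at_bot])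
      (simp add: filterlim_uminus_at_bot filterlim_tendsto_pos_mult_at_top[OF tendsto_const assms filterlim_ident])
  have "(\<integral>\<^sup>+u. ennreal (c * exp (- c * u)) * indicator {t..} u \<partial>lborel) = ennreal (- 0 - (- exp (- c * t)))"
    by (rule nn_integral_FTC_atLeast[where F = "\<lambda>u. - exp (- c * u)", OF _ _ _ lim])
      (use assms in \<open>auto intro!: derivative_eq_intros\<close>)
  then show ?thesis by simp
qed

context generator_matrix
begin

lemma sets_Collect_noise: "Measurable.pred N E \<Longrightarrow> {\<omega>. E \<omega>} \<in> sets N"
  by (simp add: pred_def)

definition jump_prob :: "nat \<Rightarrow> real \<Rightarrow> 'x \<Rightarrow> 'x \<Rightarrow> ennreal" where
  "jump_prob m t x z = emeasure N {\<omega>. at_jump x t m z \<omega>}"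

lemma measurable_jump_prob [measurable]: "(\<lambda>t. jump_prob m t x z) \<in> borel_measurable borel"
proof -
  have "(\<lambda>t. emeasure N (Pair t -` {p \<in> space (borel \<Otimes>\<^sub>M N). at_jump x (fst p) m z (snd p)})) \<in> borel_measurable borel"
    by (rule N.measurable_emeasure_Pair) measurable
  then show ?thesis by (simp add: jump_prob_def space_pair_measure)
qed

lemma jump_prob_0:
  assumes "0 \<le> t"
  shows "jump_prob 0 t x z = (if z = x then ennreal (exp (- q x * t)) else 0)"
proof (cases "q x = 0")
  case True
  then show ?thesis by (simp add: jump_prob_def at_jump_absorbing[OF True] N.emeasure_space_1[simplified])
next
  case False
  then have q: "0 < q x" by (simp add: less_le)
  have "jump_prob 0 t x z = (\<integral>\<^sup>+u. ennreal (exp (- q x * u)) * (\<Sum>y\<in>targets x. ennreal (Q x y) * emeasure N {\<omega>. t < u \<and> z = x})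
       * indicator {0..} u \<partial>lborel)"
    unfolding jump_prob_def
    by (rule emeasure_first_step[OF q]) (measurable, auto simp: at_jump_0_first[OF q refl _ assms])
  also have "\<dots> = (\<integral>\<^sup>+u. (if z = x then ennreal (q x * exp (- q x * u)) * indicator {t..} u else 0) \<partial>lborel)"
  \<comment> \<open>The conditions \<open>t < u\<close> and \<open>t \<le> u\<close> differ by the
    null set of the single time \<open>t\<close>.\<close>
  proof (rule nn_integral_cong_AE, use AE_lborel_singleton[of t] in eventually_elim)
    case (elim u)
    have "(\<Sum>y\<in>targets x. ennreal (Q x y)) = ennreal (q x)"
      unfolding exit_rate_eq by (rule sum_ennreal) (auto dest: rate_pos)
    then show ?case
      using elim assms q
      by (auto simp: N.emeasure_space_1[simplified] ennreal_mult mult.commute split: split_indicator)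
  qed
  also have "\<dots> = (if z = x then ennreal (exp (- q x * t)) else 0)"
    using nn_integral_exp_tail[OF q] by simp
  finally show ?thesis .
qed

text \<open>The integrated Kolmogorov backward equation, graded by the number of jumps.\<close>

lemma jump_prob_Suc:
  assumes "0 \<le> t"
  shows "jump_prob (Suc m) t x z = (\<integral>\<^sup>+u. ennreal (exp (- q x * u)) *
    (\<Sum>y\<in>targets x. ennreal (Q x y) * jump_prob m (t - u) y z) * indicator {0..t} u \<partial>lborel)"
proof (cases "q x = 0")
  case True
  then show ?thesis by (simp add: jump_prob_def at_jump_absorbing[OF True] exit_rate_zero_iff)
next
  case False
  then have q: "0 < q x" by (simp add: less_le)
  have "jump_prob (Suc m) t x z = (\<integral>\<^sup>+u. ennreal (exp (- q x * u)) * (\<Sum>y\<in>targets x. ennreal (Q x y) *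
     emeasure N {\<omega>. u \<le> t \<and> at_jump y (t - u) m z \<omega>}) * indicator {0..} u \<partial>lborel)"
    unfolding jump_prob_def
    by (rule emeasure_first_step[OF q]) (measurable, auto simp: at_jump_Suc_first[OF q refl _ assms])
  also have "\<dots> = (\<integral>\<^sup>+u. ennreal (exp (- q x * u)) *
    (\<Sum>y\<in>targets x. ennreal (Q x y) * jump_prob m (t - u) y z) * indicator {0..t} u \<partial>lborel)"
    by (intro nn_integral_cong) (auto simp: jump_prob_def split: split_indicator)
  finally show ?thesis .
qed

text \<open>The times in \<open>c\<close> are relative to \<open>s\<close>, so that one and the same
  list describes the future after time \<open>s\<close> and the future of a process restarted at
  time 0.\<close>

definition visits :: "'x \<Rightarrow> real \<Rightarrow> (real \<times> 'x) list \<Rightarrow> 'x noise \<Rightarrow> bool" where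
  "visits x s c \<omega> \<longleftrightarrow> (\<forall>p\<in>set c. process Q x (s + fst p) \<omega> = Some (snd p))"

lemma measurable_visits [measurable (raw)]:
  assumes [measurable]: "f \<in> borel_measurable K" "g \<in> measurable K N"
  shows "Measurable.pred K (\<lambda>k. visits x (f k) c (g k))"
  unfolding visits_def by (intro pred_intros_finite) measurable

text \<open>The Markov property before summation over the number of jumps. A jump before time
  \<open>s\<close> is removed by the first step, which shifts the whole situation. With no jump
  before \<open>s\<close> the claim is that an exponential holding time has no memory.\<close>

lemma emeasure_at_jump_visits:
  assumes "0 \<le> s" and c: "\<And>p. p \<in> set c \<Longrightarrow> 0 \<le> fst p"
  shows "emeasure N {\<omega>. at_jump x s m z \<omega> \<and> visits x s c \<omega>} =
    jump_prob m s x z * emeasure N {\<omega>. visits z 0 c \<omega>}"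
  using assms(1)
proof (induction m arbitrary: x s)
  case 0
  show ?case
  proof (cases "q x = 0")
    case True
    have "visits x s c \<omega> = visits x 0 c \<omega>" for \<omega> by (simp add: visits_def process_absorbing[OF True])
    then show ?thesis using 0
      by (simp add: jump_prob_0 True at_jump_absorbing[OF True])
  next
    case False
    then have q: "0 < q x" by (simp add: less_le)
    \<comment> \<open>\<open>G y v\<close> is \<open>visits x 0 c\<close> read off from the first
      jump: the process waits in \<open>x\<close> up to time \<open>v\<close> and is then run from
      \<open>y\<close>.\<close>
    define G where "G y v \<omega> \<longleftrightarrow> (\<forall>p\<in>set c. (fst p < v \<and> snd p = x) \<or>
      (\<not> fst p < v \<and> process Q y (fst p - v) \<omega> = Some (snd p)))" for y v \<omega>
    have [measurable]: "Measurable.pred (borel \<Otimes>\<^sub>M N) (\<lambda>p. G y (fst p - r) (snd p))" for y r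
      unfolding G_def by (intro pred_intros_finite) measurable
    have [measurable]: "Measurable.pred (borel \<Otimes>\<^sub>M N) (\<lambda>p. G y (fst p) (snd p))" for y
      unfolding G_def by (intro pred_intros_finite) measurable
    have mG [measurable]: "(\<lambda>v. emeasure N {\<omega>. G y v \<omega>}) \<in> borel_measurable borel" for y
    proof -
      have "(\<lambda>v. emeasure N (Pair v -` {p \<in> space (borel \<Otimes>\<^sub>M N). G y (fst p) (snd p)})) \<in> borel_measurable borel"
        by (rule N.measurable_emeasure_Pair) measurable
      then show ?thesis by (simp add: space_pair_measure)
    qed
    have r: "emeasure N {\<omega>. visits x 0 c \<omega>} = (\<integral>\<^sup>+v. ennreal (exp (- q x * v)) *
       (\<Sum>y\<in>targets x. ennreal (Q x y) * emeasure N {\<omega>. G y v \<omega>}) * indicator {0..} v \<partial>lborel)"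
    proof (rule emeasure_first_step[OF q])
      show "visits x 0 c \<omega> \<longleftrightarrow> G (fst \<omega> (0, x)) (snd \<omega> 0 / q x) (shift_noise \<omega>)"
        if "0 \<le> snd \<omega> 0 / q x" for \<omega>
        unfolding visits_def G_def using c by (intro ball_cong) (auto simp: process_first[OF q refl that])
    qed measurable
    have "emeasure N {\<omega>. at_jump x s 0 z \<omega> \<and> visits x s c \<omega>} = (\<integral>\<^sup>+u. ennreal (exp (- q x * u)) *
       (\<Sum>y\<in>targets x. ennreal (Q x y) * emeasure N {\<omega>. s < u \<and> z = x \<and> G y (u - s) \<omega>}) * indicator {0..} u \<partial>lborel)"
    proof (rule emeasure_first_step[OF q])
      show "at_jump x s 0 z \<omega> \<and> visits x s c \<omega> \<longleftrightarrow> s < snd \<omega> 0 / q x \<and> z = x \<and>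
          G (fst \<omega> (0, x)) (snd \<omega> 0 / q x - s) (shift_noise \<omega>)"
        if u: "0 \<le> snd \<omega> 0 / q x" for \<omega>
      proof -
        have "process Q x (s + fst p) \<omega> = Some (snd p) \<longleftrightarrow>
          (fst p < snd \<omega> 0 / q x - s \<and> snd p = x) \<or> (\<not> fst p < snd \<omega> 0 / q x - s \<and>
            process Q (fst \<omega> (0, x)) (fst p - (snd \<omega> 0 / q x - s)) (shift_noise \<omega>) = Some (snd p))"
          if "p \<in> set c" for p
          using c[OF that] 0 by (subst process_first[OF q refl u]) (auto simp: algebra_simps)
        then show ?thesis
          unfolding visits_def G_def at_jump_0_first[OF q refl u 0] by (metis (no_types, lifting))
      qed
    qed measurable
    also have "\<dots> = (\<integral>\<^sup>+u. ennreal (exp (- q x * u)) * ((\<Sum>y\<in>targets x. ennreal (Q x y) *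
        emeasure N {\<omega>. G y (u - s) \<omega>}) * (if z = x then indicator {s<..} u else 0)) \<partial>lborel)"
      using 0 by (intro nn_integral_cong) (auto split: split_indicator)
    \<comment> \<open>The substitution \<open>u = s + v\<close> lets \<open>exp (- q x * s)\<close>
      split off: this is the lack of memory.\<close>
    also have "\<dots> = (\<integral>\<^sup>+v. ennreal (exp (- q x * (s + v))) * ((\<Sum>y\<in>targets x. ennreal (Q x y) *
        emeasure N {\<omega>. G y v \<omega>}) * (if z = x then indicator {s<..} (s + v) else 0)) \<partial>lborel)"
      by (subst nn_integral_real_affine[where c = 1 and t = s]) (simp_all cong: if_cong)
    also have "\<dots> = (\<integral>\<^sup>+v. (if z = x then ennreal (exp (- q x * s)) else 0) * (ennreal (exp (- q x * v)) *
       (\<Sum>y\<in>targets x. ennreal (Q x y) * emeasure N {\<omega>. G y v \<omega>}) * indicator {0..} v) \<partial>lborel)"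
    proof (rule nn_integral_cong_AE, use AE_lborel_singleton[of 0] in eventually_elim)
      case (elim v)
      have "ennreal (exp (- q x * (s + v))) = ennreal (exp (- q x * s)) * ennreal (exp (- q x * v))"
        by (simp add: ennreal_mult[symmetric] exp_add[symmetric] algebra_simps)
      with elim show ?case by (auto simp: mult.assoc split: split_indicator)
    qed
    also have "\<dots> = (if z = x then ennreal (exp (- q x * s)) else 0) * emeasure N {\<omega>. visits x 0 c \<omega>}"
      unfolding r by (rule nn_integral_cmult) measurable
    also have "\<dots> = jump_prob 0 s x z * emeasure N {\<omega>. visits z 0 c \<omega>}"
      using 0 by (simp add: jump_prob_0)
    finally show ?thesis .
  qed
next
  case (Suc m)
  show ?case
  proof (cases "q x = 0")
    case True
    then show ?thesis by (simp add: at_jump_absorbing jump_prob_def)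
  next
    case False
    then have q: "0 < q x" by (simp add: less_le)
    let ?K = "emeasure N {\<omega>. visits z 0 c \<omega>}"
    have "emeasure N {\<omega>. at_jump x s (Suc m) z \<omega> \<and> visits x s c \<omega>} = (\<integral>\<^sup>+u. ennreal (exp (- q x * u)) *
       (\<Sum>y\<in>targets x. ennreal (Q x y) * emeasure N {\<omega>. u \<le> s \<and> at_jump y (s - u) m z \<omega> \<and> visits y (s - u) c \<omega>})
       * indicator {0..} u \<partial>lborel)"
    proof (rule emeasure_first_step[OF q])
      show "at_jump x s (Suc m) z \<omega> \<and> visits x s c \<omega> \<longleftrightarrow> snd \<omega> 0 / q x \<le> s \<and>
          at_jump (fst \<omega> (0, x)) (s - snd \<omega> 0 / q x) m z (shift_noise \<omega>) \<and>
          visits (fst \<omega> (0, x)) (s - snd \<omega> 0 / q x) c (shift_noise \<omega>)"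
        if u: "0 \<le> snd \<omega> 0 / q x" for \<omega>
      proof (cases "snd \<omega> 0 / q x \<le> s")
        case True
        have "process Q x (s + fst p) \<omega> = process Q (fst \<omega> (0, x)) (s - snd \<omega> 0 / q x + fst p) (shift_noise \<omega>)"
          if "p \<in> set c" for p
          using c[OF that] True Suc.prems
          by (subst process_first[OF q refl u]) (auto simp: algebra_simps)
        then have "visits x s c \<omega> = visits (fst \<omega> (0, x)) (s - snd \<omega> 0 / q x) c (shift_noise \<omega>)"
          by (simp add: visits_def)
        then show ?thesis by (simp add: at_jump_Suc_first[OF q refl u Suc.prems] True)
      next
        case False
        then show ?thesis by (simp add: at_jump_Suc_first[OF q refl u Suc.prems])
      qed
    qed measurable
    also have "\<dots> = (\<integral>\<^sup>+u. ennreal (exp (- q x * u)) *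
       (\<Sum>y\<in>targets x. ennreal (Q x y) * jump_prob m (s - u) y z) * indicator {0..s} u * ?K \<partial>lborel)"
      by (intro nn_integral_cong)
        (auto simp: Suc.IH sum_distrib_right mult.assoc split: split_indicator)
    also have "\<dots> = jump_prob (Suc m) s x z * ?K"
      unfolding jump_prob_Suc[OF Suc.prems] by (rule nn_integral_multc) measurable
    finally show ?thesis .
  qed
qed

lemma emeasure_process_visits:
  assumes "0 \<le> s" and c: "\<And>p. p \<in> set c \<Longrightarrow> 0 \<le> fst p"
  shows "emeasure N {\<omega>. process Q x s \<omega> = Some z \<and> visits x s c \<omega>} =
    (\<Sum>m. jump_prob m s x z) * emeasure N {\<omega>. visits z 0 c \<omega>}"
proof -
  have "{\<omega>. process Q x s \<omega> = Some z \<and> visits x s c \<omega>} = (\<Union>m. {\<omega>. at_jump x s m z \<omega> \<and> visits x s c \<omega>})"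
    by (auto simp: process_eq_Some_iff)
  also have "emeasure N \<dots> = (\<Sum>m. emeasure N {\<omega>. at_jump x s m z \<omega> \<and> visits x s c \<omega>})"
    by (rule suminf_emeasure[symmetric])
      (auto simp: disjoint_family_on_def intro!: sets_Collect_noise dest: at_jump_unique)
  also have "\<dots> = (\<Sum>m. jump_prob m s x z) * emeasure N {\<omega>. visits z 0 c \<omega>}"
    by (simp add: emeasure_at_jump_visits[OF assms])
  finally show ?thesis .
qed

lemma emeasure_process: 
  assumes "0 \<le> s"
  shows "emeasure N {\<omega>. process Q x s \<omega> = Some z} = (\<Sum>m. jump_prob m s x z)"
  using emeasure_process_visits[OF assms, where c = "[]" and x = x and z = z] by (simp add: visits_def N.emeasure_space_1[simplified])

lemma transition_prob_eq: "transition_prob Q s x z = measure N {\<omega>. process Q x s \<omega> = Some z}"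
  by (simp add: transition_prob_def)

lemma transition_prob_nonneg [simp]: "0 \<le> transition_prob Q s x z"
  by (simp add: transition_prob_def)

lemma ennreal_transition_prob:
  assumes "0 \<le> s"
  shows "ennreal (transition_prob Q s x z) = (\<Sum>m. jump_prob m s x z)"
  using emeasure_process[OF assms, of x z] by (simp add: transition_prob_eq N.emeasure_eq_measure)

theorem markov_property:
  assumes "0 \<le> s" and c: "\<And>p. p \<in> set c \<Longrightarrow> 0 \<le> fst p"
  shows "measure N {\<omega>. process Q x s \<omega> = Some z \<and> visits x s c \<omega>} =
    transition_prob Q s x z * measure N {\<omega>. visits z 0 c \<omega>}"
  using emeasure_process_visits[OF assms, where x = x and z = z]
  unfolding N.emeasure_eq_measure ennreal_transition_prob[OF assms(1), symmetric]
  by (simp add: ennreal_mult[symmetric])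

end

section \<open>Stationarity and reversibility from detailed balance\<close>

text \<open>Links \<open>has_sum\<close>, in which stationarity is stated, with the nonnegative
  integrals in which probabilities are computed.\<close>

lemma has_sum_iff_nn_integral_count_space:
  fixes f :: "'a \<Rightarrow> real"
  assumes "\<And>x. x \<in> A \<Longrightarrow> 0 \<le> f x" "0 \<le> c"
  shows "(f has_sum c) A \<longleftrightarrow> (\<integral>\<^sup>+x. ennreal (f x) \<partial>count_space A) = ennreal c"
proof -
  have "(f has_sum c) A \<longleftrightarrow> Infinite_Set_Sum.abs_summable_on f A \<and> infsetsum f A = c"
  proof
    assume f: "(f has_sum c) A"
    then have "f summable_on A" by (auto simp: summable_on_def)
    then have "Infinite_Sum.abs_summable_on f A"
      using assms(1) by (subst summable_on_cong[of A _ f]) auto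
    then have "Infinite_Set_Sum.abs_summable_on f A" by (rule abs_summable_equivalent[THEN iffD1])
    with f show "Infinite_Set_Sum.abs_summable_on f A \<and> infsetsum f A = c"
      by (simp add: infsetsum_infsum infsumI)
  next
    assume f: "Infinite_Set_Sum.abs_summable_on f A \<and> infsetsum f A = c"
    then have "f summable_on A"
      using abs_summable_equivalent abs_summable_summable by blast
    with f show "(f has_sum c) A" by (metis infsetsum_infsum has_sum_infsum)
  qed
  also have "\<dots> \<longleftrightarrow> (\<integral>\<^sup>+x. ennreal (f x) \<partial>count_space A) = ennreal c"
    unfolding abs_summable_on_def infsetsum_def
    by (rule nn_integral_eq_integrable[symmetric]) (use assms in \<open>auto simp: AE_count_space\<close>)
  finally show ?thesis .
qed

lemma has_sum_minus:
  fixes f g :: "'a \<Rightarrow> 'b :: {topological_ab_group_add}"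
  assumes "(f has_sum a) A" "(g has_sum b) A"
  shows "((\<lambda>x. f x - g x) has_sum (a - b)) A"
  using has_sum_add[OF assms(1), of "\<lambda>x. - g x" "- b"] assms(2) by (simp add: has_sum_uminus)

text \<open>The inequality \<open>sub\<close> cannot be strict anywhere, since both sides have the same total mass.\<close>

lemma stochastic_subinvariant_imp_invariant:
  fixes \<mu> g :: "'a \<Rightarrow> real"
  assumes P: "\<And>x. x \<in> A \<Longrightarrow> ((\<lambda>y. P x y) has_sum 1) A" "\<And>x y. 0 \<le> P x y"
    and \<mu>: "\<And>x. x \<in> A \<Longrightarrow> 0 \<le> \<mu> x" "(\<mu> has_sum m) A"
    and g: "\<And>y. y \<in> A \<Longrightarrow> ((\<lambda>x. \<mu> x * P x y) has_sum g y) A"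
    and sub: "\<And>y. y \<in> A \<Longrightarrow> \<mu> y \<le> g y"
    and y: "y \<in> A"
  shows "g y = \<mu> y"
proof -
  have row: "((\<lambda>y. case (x, y) of (x, y) \<Rightarrow> \<mu> x * P x y) has_sum \<mu> x) A" if "x \<in> A" for x
    using has_sum_cmult_right[OF P(1)[OF that], of "\<mu> x"] by simp
  have "(\<lambda>(x, y). \<mu> x * P x y) summable_on A \<times> A"
    by (rule summable_on_SigmaI[OF row]) (use \<mu> P(2) in \<open>auto simp: summable_on_def\<close>)
  with row \<mu>(2) have "((\<lambda>(x, y). \<mu> x * P x y) has_sum m) (A \<times> A)"
    by (intro has_sum_SigmaI) auto
  then have "((\<lambda>(y, x). \<mu> x * P x y) has_sum m) (A \<times> A)"
    by (subst (asm) has_sum_swap) simp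
  then have "(g has_sum m) A"
    by (rule has_sum_SigmaD) (use g in auto)
  from has_sum_minus[OF this \<mu>(2)] have "((\<lambda>x. g x - \<mu> x) has_sum 0) A" by simp
  from nonneg_has_sum_le_0D[OF this, of y] sub y show ?thesis by auto
qed

text \<open>The reflection \<open>u \<mapsto> t - u\<close> exchanges the times spent before and
  after a single jump, and with them the exit rates of its two end points.\<close>

lemma nn_integral_exp_reflect:
  "(\<integral>\<^sup>+u. ennreal (exp (- a * u)) * ennreal (exp (- b * (t - u))) * indicator {0..t} u \<partial>lborel) =
   (\<integral>\<^sup>+u. ennreal (exp (- b * u)) * ennreal (exp (- a * (t - u))) * indicator {0..t} u \<partial>lborel)"
  by (subst nn_integral_real_affine[where c = "-1" and t = t])
     (auto intro!: nn_integral_cong split: split_indicator simp: mult.commute)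

context generator_matrix
begin

lemma jump_prob_closed:
  assumes S: "\<And>x. x \<in> S \<Longrightarrow> targets x \<subseteq> S" and "x \<in> S" "z \<notin> S" "0 \<le> t"
  shows "jump_prob m t x z = 0"
  using assms(2,4)
proof (induction m arbitrary: x t)
  case 0
  then show ?case using assms(3) by (auto simp: jump_prob_0)
next
  case (Suc m)
  have "jump_prob (Suc m) t x z = (\<integral>\<^sup>+u. 0 \<partial>(lborel :: real measure))"
    unfolding jump_prob_Suc[OF Suc.prems(2)]
    using Suc.IH S[OF Suc.prems(1)] by (intro nn_integral_cong) (auto split: split_indicator)
  then show ?case by simp
qed

lemma transition_prob_closed:
  assumes "\<And>x. x \<in> S \<Longrightarrow> targets x \<subseteq> S" "x \<in> S" "z \<notin> S" "0 \<le> t"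
  shows "transition_prob Q t x z = 0"
proof -
  have "ennreal (transition_prob Q t x z) = 0"
    using jump_prob_closed[OF assms] by (simp add: ennreal_transition_prob assms)
  then show ?thesis by (simp add: le_zero_eq order_antisym ennreal_eq_0_iff)
qed

text \<open>The cemetery at time \<open>t\<close> would bound all jump times by \<open>t\<close>,
  and with them the sum of the holding times.\<close>

lemma nonexplosive_AE_process:
  assumes "nonexplosive Q S" "x \<in> S"
  shows "AE \<omega> in N. process Q x t \<omega> \<noteq> None"
proof -
  have "AE \<omega> in N. (\<Sum>m. holding_time Q x \<omega> m) = \<infinity>"
    using assms by (simp add: nonexplosive_def)
  then show ?thesis
  proof eventually_elim
    case (elim \<omega>)
    then have "ennreal t < (\<Sum>m. holding_time Q x \<omega> m)" by simp
    then obtain n where n: "ennreal t < jump_time Q x \<omega> n"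
      unfolding suminf_eq_SUP less_SUP_iff jump_time_def by auto
    then obtain m where "n = Suc m" by (cases n) auto
    with n show ?case unfolding process_None_iff by (metis leD)
  qed
qed

text \<open>Absence of explosion turns the bound 1 on the row sums into equality; stationarity and
  uniqueness both rest on it.\<close>

lemma transition_prob_has_sum:
  assumes S: "\<And>x. x \<in> S \<Longrightarrow> targets x \<subseteq> S" and ne: "nonexplosive Q S" and x: "x \<in> S" and t: "0 \<le> t"
  shows "((\<lambda>y. transition_prob Q t x y) has_sum 1) S"
proof -
  have "1 = emeasure N {\<omega>. process Q x t \<omega> \<noteq> None}"
    using nonexplosive_AE_process[OF ne x, of t]
    by (intro N.emeasure_eq_1_AE[symmetric] sets_Collect_noise) measurable
  also have "{\<omega>. process Q x t \<omega> \<noteq> None} = (\<Union>y. {\<omega>. process Q x t \<omega> = Some y})" by auto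
  also have "emeasure N \<dots> = (\<integral>\<^sup>+y. emeasure N {\<omega>. process Q x t \<omega> = Some y} \<partial>count_space UNIV)"
    by (rule emeasure_UN_countable)
      (auto simp: disjoint_family_on_def intro!: sets_Collect_noise countable_states)
  also have "\<dots> = (\<integral>\<^sup>+y. ennreal (transition_prob Q t x y) \<partial>count_space UNIV)"
    by (simp add: transition_prob_eq N.emeasure_eq_measure)
  also have "\<dots> = (\<integral>\<^sup>+y. ennreal (transition_prob Q t x y) \<partial>count_space S)"
    using transition_prob_closed[OF S x _ t] by (intro nn_integral_count_space_eq) auto
  finally show ?thesis by (subst has_sum_iff_nn_integral_count_space) auto
qed

text \<open>The number of jumps can be the length of a path of positive rates, the same for all
  \<open>t\<close>. Were the integral of the recursion zero, its integrand would vanish almost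
  everywhere on the interval from 0 to \<open>t\<close>, which has positive length.\<close>

lemma jump_prob_pos:
  assumes "leads_to Q x y"
  shows "\<exists>m. \<forall>t>0. 0 < jump_prob m t x y"
  using assms unfolding leads_to_def
proof (induction rule: converse_rtranclp_induct)
  case base
  show ?case by (rule exI[of _ 0]) (simp add: jump_prob_0)
next
  case (step x z)
  then obtain m where m: "\<And>t. 0 < t \<Longrightarrow> 0 < jump_prob m t z y" by blast
  have z: "z \<in> targets x" "0 < Q x z" using step by (auto simp: targets_def)
  have "0 < jump_prob (Suc m) t x y" if t: "0 < t" for t
  proof (rule ccontr)
    let ?f = "\<lambda>u. ennreal (exp (- q x * u)) *
      (\<Sum>w\<in>targets x. ennreal (Q x w) * jump_prob m (t - u) w y) * indicator {0..t} u"
    assume "\<not> 0 < jump_prob (Suc m) t x y"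
    then have "(\<integral>\<^sup>+u. ?f u \<partial>lborel) = 0"
      using jump_prob_Suc[of t m x y] t by (simp add: zero_less_iff_neq_zero)
    then have "AE u in lborel. ?f u = 0"
      by (subst (asm) nn_integral_0_iff_AE) measurable
    then have "AE u in lborel. u \<notin> {0<..<t}"
    proof eventually_elim
      case (elim u)
      show ?case
      proof
        assume u: "u \<in> {0<..<t}"
        then have "ennreal (Q x z) * jump_prob m (t - u) z y = 0"
          using elim z by (auto simp: sum_eq_0_iff)
        then show False using m[of "t - u"] u z by auto
      qed
    qed
    moreover have "{u. \<not> u \<notin> {0<..<t}} = {0<..<t}" by auto
    ultimately have "emeasure lborel {0<..<t} = 0"
      using AE_iff_measurable[of "{0<..<t}" lborel "\<lambda>u. u \<notin> {0<..<t}"] by simp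
    then show False using t by simp
  qed
  then show ?case by blast
qed

lemma transition_prob_pos:
  assumes "leads_to Q x y" "0 < t"
  shows "0 < transition_prob Q t x y"
proof -
  obtain m where "0 < jump_prob m t x y" using jump_prob_pos[OF assms(1)] assms(2) by blast
  also have "\<dots> \<le> (\<Sum>m. jump_prob m t x y)"
    using sum_le_suminf[of "\<lambda>m. jump_prob m t x y" "{m}"] by auto
  also have "\<dots> = ennreal (transition_prob Q t x y)"
    using assms(2) by (simp add: ennreal_transition_prob)
  finally show ?thesis by simp
qed

text \<open>The finite-dimensional law of the process that is in \<open>x\<close> at time
  \<open>s\<close>; the listed times are absolute.\<close>

primrec path_weight :: "real \<Rightarrow> 'x \<Rightarrow> (real \<times> 'x) list \<Rightarrow> real" where
  "path_weight s x [] = 1"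
| "path_weight s x (p # c) = transition_prob Q (fst p - s) x (snd p) * path_weight (fst p) (snd p) c"

lemma measure_visits:
  assumes "sorted (map fst c)" "\<And>p. p \<in> set c \<Longrightarrow> s \<le> fst p"
  shows "measure N {\<omega>. visits x 0 (map (\<lambda>p. (fst p - s, snd p)) c) \<omega>} = path_weight s x c"
  using assms
proof (induction c arbitrary: s x)
  case Nil
  then show ?case by (simp add: visits_def N.prob_space[simplified])
next
  case (Cons p c)
  have eq: "{\<omega>. visits x 0 (map (\<lambda>p. (fst p - s, snd p)) (p # c)) \<omega>} =
    {\<omega>. process Q x (fst p - s) \<omega> = Some (snd p) \<and>
      visits x (fst p - s) (map (\<lambda>p'. (fst p' - fst p, snd p')) c) \<omega>}"
    by (auto simp: visits_def)
  have "measure N {\<omega>. visits x 0 (map (\<lambda>p. (fst p - s, snd p)) (p # c)) \<omega>} =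
    transition_prob Q (fst p - s) x (snd p) *
      measure N {\<omega>. visits (snd p) 0 (map (\<lambda>p'. (fst p' - fst p, snd p')) c) \<omega>}"
    unfolding eq using Cons.prems by (intro markov_property) auto
  also have "\<dots> = path_weight s x (p # c)"
    using Cons.prems by (subst Cons.IH) auto
  finally show ?case .
qed

end

text \<open>\<open>\<pi>\<close> may vanish on part of \<open>S\<close>. It is zero outside
  \<open>S\<close>, so that detailed balance can be asked of all pairs of states and integrals over
  the whole type need no restriction to \<open>S\<close>.\<close>

locale reversible_generator = generator_matrix Q for Q :: "'x \<Rightarrow> 'x \<Rightarrow> real" +
  fixes S :: "'x set" and \<pi> :: "'x \<Rightarrow> real"
  assumes closed: "x \<in> S \<Longrightarrow> {y. y \<noteq> x \<and> Q x y \<noteq> 0} \<subseteq> S"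
    and pi_nonneg: "0 \<le> \<pi> x"
    and pi_outside: "x \<notin> S \<Longrightarrow> \<pi> x = 0"
    and pi_sum: "(\<pi> has_sum 1) S"
    and detailed_balance: "x \<noteq> y \<Longrightarrow> \<pi> x * Q x y = \<pi> y * Q y x"
    and nonexplosive: "nonexplosive Q S"
begin

lemma targets_closed: "x \<in> S \<Longrightarrow> targets x \<subseteq> S"
  using closed[of x] by (simp add: targets_def)

section \<open>Symmetry of the transition probabilities and invariance\<close>

lemma detailed_balance_ennreal:
  "x \<noteq> y \<Longrightarrow> ennreal (\<pi> x) * ennreal (Q x y) = ennreal (\<pi> y) * ennreal (Q y x)"
  using detailed_balance[of x y] rate_nonneg by (simp add: ennreal_mult[symmetric] pi_nonneg)

text \<open>The first jump goes from \<open>x\<close> to \<open>z\<close>. Detailed balance carries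
  the factor \<open>\<pi>\<close> from \<open>x\<close> to \<open>z\<close>, the hypothesis for one
  jump fewer exchanges the ends \<open>z\<close> and \<open>y\<close>, and now the jump next to
  \<open>y\<close> is a first one and can be split off as well. Here \<open>u\<close> and
  \<open>v\<close> are the times spent at the two ends \<open>x\<close> and \<open>y\<close>, and
  two jumps fewer remain in between.\<close>

lemma jump_prob_expand_both:
  assumes sym: "\<And>z t. 0 \<le> t \<Longrightarrow>
      ennreal (\<pi> z) * jump_prob (Suc m) t z y = ennreal (\<pi> y) * jump_prob (Suc m) t y z"
    and t: "0 \<le> t"
  shows "ennreal (\<pi> x) * jump_prob (Suc (Suc m)) t x y =
    (\<integral>\<^sup>+u. \<integral>\<^sup>+v. ennreal (exp (- q x * u)) * ennreal (exp (- q y * v)) *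
       (\<Sum>z\<in>targets x. \<Sum>w\<in>targets y. ennreal (Q z x) * (ennreal (\<pi> y) * ennreal (Q y w)) * jump_prob m (t - u - v) w z)
       * indicator {p. 0 \<le> fst p \<and> 0 \<le> snd p \<and> fst p + snd p \<le> t} (u, v) \<partial>lborel \<partial>lborel)"
proof -
  let ?T = "\<lambda>u v z. \<Sum>w\<in>targets y. ennreal (Q z x) * (ennreal (\<pi> y) * ennreal (Q y w)) * jump_prob m (t - u - v) w z"
  let ?S = "\<lambda>u v. \<Sum>z\<in>targets x. ?T u v z"
  let ?D = "{p. 0 \<le> fst p \<and> 0 \<le> snd p \<and> fst p + snd p \<le> t}"
  have inner: "ennreal (\<pi> x) * ennreal (Q x z) * jump_prob (Suc m) (t - u) z y =
     (\<integral>\<^sup>+v. ennreal (exp (- q y * v)) * ?T u v z * indicator {0..t - u} v \<partial>lborel)" if z: "z \<in> targets x" and u: "u \<in> {0..t}" for z u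
  proof -
    have e: "ennreal (\<pi> x) * ennreal (Q x z) = ennreal (Q z x) * ennreal (\<pi> z)"
      using detailed_balance_ennreal[of x z] z by (auto simp: targets_def mult.commute)
    have "ennreal (\<pi> x) * ennreal (Q x z) * jump_prob (Suc m) (t - u) z y =
      ennreal (Q z x) * (ennreal (\<pi> z) * jump_prob (Suc m) (t - u) z y)"
      unfolding e by (simp only: mult.assoc)
    also have "\<dots> = (ennreal (Q z x) * ennreal (\<pi> y)) * jump_prob (Suc m) (t - u) y z"
      using sym[of "t - u" z] u by (simp add: ac_simps)
    also have "\<dots> = (\<integral>\<^sup>+v. (ennreal (Q z x) * ennreal (\<pi> y)) * (ennreal (exp (- q y * v)) *
       (\<Sum>w\<in>targets y. ennreal (Q y w) * jump_prob m (t - u - v) w z) * indicator {0..t - u} v) \<partial>lborel)"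
      using u by (subst jump_prob_Suc) (simp_all add: nn_integral_cmult)
    also have "\<dots> = (\<integral>\<^sup>+v. ennreal (exp (- q y * v)) * ?T u v z * indicator {0..t - u} v \<partial>lborel)"
      by (intro nn_integral_cong) (simp add: sum_distrib_left sum_distrib_right ac_simps)
    finally show ?thesis .
  qed
  have "ennreal (\<pi> x) * jump_prob (Suc (Suc m)) t x y = (\<integral>\<^sup>+u. ennreal (exp (- q x * u)) *
      (\<Sum>z\<in>targets x. ennreal (\<pi> x) * ennreal (Q x z) * jump_prob (Suc m) (t - u) z y) * indicator {0..t} u \<partial>lborel)"
    unfolding jump_prob_Suc[OF t, of "Suc m"]
    by (subst nn_integral_cmult[symmetric]) (auto simp: sum_distrib_left ac_simps intro!: nn_integral_cong)
  also have "\<dots> = (\<integral>\<^sup>+u. \<integral>\<^sup>+v. ennreal (exp (- q x * u)) * ennreal (exp (- q y * v)) * ?S u v * indicator ?D (u, v) \<partial>lborel \<partial>lborel)"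
  proof (intro nn_integral_cong)
    fix u :: real
    show "ennreal (exp (- q x * u)) *
      (\<Sum>z\<in>targets x. ennreal (\<pi> x) * ennreal (Q x z) * jump_prob (Suc m) (t - u) z y) * indicator {0..t} u =
      (\<integral>\<^sup>+v. ennreal (exp (- q x * u)) * ennreal (exp (- q y * v)) * ?S u v * indicator ?D (u, v) \<partial>lborel)"
    proof (cases "u \<in> {0..t}")
      case True
      have "ennreal (exp (- q x * u)) *
        (\<Sum>z\<in>targets x. ennreal (\<pi> x) * ennreal (Q x z) * jump_prob (Suc m) (t - u) z y) =
        ennreal (exp (- q x * u)) * (\<integral>\<^sup>+v. (\<Sum>z\<in>targets x. ennreal (exp (- q y * v)) * ?T u v z * indicator {0..t - u} v) \<partial>lborel)"
        using inner[OF _ True] by (subst nn_integral_sum) (auto intro!: arg_cong[where f="\<lambda>z. _ * z"] sum.cong)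
      also have "\<dots> = (\<integral>\<^sup>+v. ennreal (exp (- q x * u)) * (\<Sum>z\<in>targets x. ennreal (exp (- q y * v)) * ?T u v z * indicator {0..t - u} v) \<partial>lborel)"
        by (rule nn_integral_cmult[symmetric]) measurable
      also have "\<dots> = (\<integral>\<^sup>+v. ennreal (exp (- q x * u)) * ennreal (exp (- q y * v)) * ?S u v * indicator ?D (u, v) \<partial>lborel)"
      proof (intro nn_integral_cong)
        fix v :: real
        have i: "indicator ?D (u, v) = (indicator {0..t - u} v :: ennreal)"
          using True by (auto simp: indicator_def)
        show "ennreal (exp (- q x * u)) * (\<Sum>z\<in>targets x. ennreal (exp (- q y * v)) * ?T u v z * indicator {0..t - u} v) = ennreal (exp (- q x * u)) * ennreal (exp (- q y * v)) * ?S u v * indicator ?D (u, v)"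
          unfolding i sum_distrib_right[symmetric] sum_distrib_left[symmetric] by (simp only: mult.assoc)
      qed
      finally show ?thesis using True by simp
    next
      case False
      have "indicator ?D (u, v) = (0 :: ennreal)" for v
        using False by (auto simp: indicator_def)
      then show ?thesis using False by simp
    qed
  qed
  finally show ?thesis .
qed

text \<open>Two jumps are removed at a time and the expansion needs the statement for
  \<open>m + 1\<close>, hence the induction with two base cases. The expanded integrand is invariant
  under exchanging \<open>x\<close> with \<open>y\<close> and \<open>u\<close> with
  \<open>v\<close>, by detailed balance at both ends and the statement for \<open>m\<close> in the
  middle.\<close>

lemma jump_prob_sym:
  assumes "0 \<le> t"
  shows "ennreal (\<pi> x) * jump_prob m t x y = ennreal (\<pi> y) * jump_prob m t y x"
  using assms
proof (induction m arbitrary: x y t rule: induct_nat_012)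
  case 0
  then show ?case by (simp add: jump_prob_0)
next
  case 1
  let ?I = "\<lambda>a b. (\<integral>\<^sup>+u. ennreal (exp (- a * u)) * ennreal (exp (- b * (t - u))) * indicator {0..t} u \<partial>lborel)"
  have one: "jump_prob (Suc 0) t x y = (if x = y then 0 else ennreal (Q x y)) * ?I (q x) (q y)" for x y
  proof -
    have "(\<Sum>z\<in>targets x. ennreal (Q x z) * jump_prob 0 (t - u) z y) =
      (if x = y then 0 else ennreal (Q x y)) * ennreal (exp (- q y * (t - u)))" if u: "u \<in> {0..t}" for u
    proof -
      have "(\<Sum>z\<in>targets x. ennreal (Q x z) * jump_prob 0 (t - u) z y) =
        (\<Sum>z\<in>targets x. if z = y then ennreal (Q x y) * ennreal (exp (- q y * (t - u))) else 0)"
        using u by (intro sum.cong) (auto simp: jump_prob_0)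
      then show ?thesis by (auto simp: targets_def finite_targets)
    qed
    note sum_eq = this
    have "jump_prob (Suc 0) t x y = (\<integral>\<^sup>+u. (if x = y then 0 else ennreal (Q x y)) *
      (ennreal (exp (- q x * u)) * ennreal (exp (- q y * (t - u))) * indicator {0..t} u) \<partial>lborel)"
      unfolding jump_prob_Suc[OF 1]
    proof (intro nn_integral_cong)
      fix u :: real
      show "ennreal (exp (- q x * u)) * (\<Sum>z\<in>targets x. ennreal (Q x z) * jump_prob 0 (t - u) z y) * indicator {0..t} u =
        (if x = y then 0 else ennreal (Q x y)) *
          (ennreal (exp (- q x * u)) * ennreal (exp (- q y * (t - u))) * indicator {0..t} u)"
        by (cases "u \<in> {0..t}") (simp_all only: sum_eq, simp_all add: ac_simps)
    qed
    then show ?thesis by (simp add: nn_integral_cmult)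
  qed
  show ?case
    using detailed_balance_ennreal[of x y]
    unfolding one nn_integral_exp_reflect[of "q y" "q x" t] by (auto simp: mult.assoc[symmetric])
next
  case (ge2 m)
  note sym = ge2.IH(1) and symS = ge2.IH(2)
  define F where "F x y u v = ennreal (exp (- q x * u)) * ennreal (exp (- q y * v)) *
       (\<Sum>z\<in>targets x. \<Sum>w\<in>targets y. ennreal (Q z x) * (ennreal (\<pi> y) * ennreal (Q y w)) * jump_prob m (t - u - v) w z)
       * indicator {p. 0 \<le> fst p \<and> 0 \<le> snd p \<and> fst p + snd p \<le> t} (u, v)" for x y u v
  have [measurable]: "(\<lambda>(u, v). F x y u v) \<in> borel_measurable (lborel \<Otimes>\<^sub>M lborel)" for x y
    unfolding F_def by measurable
  have E: "ennreal (\<pi> x) * jump_prob (Suc (Suc m)) t x y = (\<integral>\<^sup>+u. \<integral>\<^sup>+v. F x y u v \<partial>lborel \<partial>lborel)" for x y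
    unfolding F_def by (rule jump_prob_expand_both[OF symS ge2.prems])
  have F: "F x y u v = F y x v u" for u v
  proof (cases "0 \<le> u \<and> 0 \<le> v \<and> u + v \<le> t")
    case True
    have "ennreal (Q z x) * (ennreal (\<pi> y) * ennreal (Q y w)) * jump_prob m (t - u - v) w z =
       ennreal (Q w y) * (ennreal (\<pi> x) * ennreal (Q x z)) * jump_prob m (t - v - u) z w"
      if z: "z \<in> targets x" and w: "w \<in> targets y" for z w
    proof -
      have e: "ennreal (\<pi> y) * ennreal (Q y w) = ennreal (Q w y) * ennreal (\<pi> w)"
        using detailed_balance_ennreal[of y w] w by (auto simp: targets_def mult.commute)
      have "ennreal (Q z x) * (ennreal (\<pi> y) * ennreal (Q y w)) * jump_prob m (t - u - v) w z =
        ennreal (Q z x) * ennreal (Q w y) * (ennreal (\<pi> w) * jump_prob m (t - u - v) w z)"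
        unfolding e by (simp only: mult.assoc)
      also have "\<dots> = ennreal (Q z x) * ennreal (Q w y) * (ennreal (\<pi> w) * jump_prob m (t - v - u) w z)"
        by (simp add: algebra_simps)
      also have "ennreal (Q z x) * ennreal (Q w y) * (ennreal (\<pi> w) * jump_prob m (t - v - u) w z) =
          ennreal (Q w y) * (ennreal (\<pi> z) * ennreal (Q z x)) * jump_prob m (t - v - u) z w"
        using sym[of "t - v - u" w z] True by (simp add: ac_simps)
      also have "ennreal (\<pi> z) * ennreal (Q z x) = ennreal (\<pi> x) * ennreal (Q x z)"
        using detailed_balance_ennreal[of x z] z by (auto simp: targets_def)
      finally show ?thesis .
    qed
    then have "(\<Sum>z\<in>targets x. \<Sum>w\<in>targets y. ennreal (Q z x) * (ennreal (\<pi> y) * ennreal (Q y w)) * jump_prob m (t - u - v) w z) =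
      (\<Sum>z\<in>targets x. \<Sum>w\<in>targets y. ennreal (Q w y) * (ennreal (\<pi> x) * ennreal (Q x z)) * jump_prob m (t - v - u) z w)"
      by (intro sum.cong) auto
    also have "\<dots> = (\<Sum>w\<in>targets y. \<Sum>z\<in>targets x. ennreal (Q w y) * (ennreal (\<pi> x) * ennreal (Q x z)) * jump_prob m (t - v - u) z w)"
      by (rule sum.swap)
    finally show ?thesis
      using True unfolding F_def by (simp add: ac_simps)
  next
    case False
    then show ?thesis by (auto simp: F_def indicator_def)
  qed
  have "(\<integral>\<^sup>+u. \<integral>\<^sup>+v. F x y u v \<partial>lborel \<partial>lborel) = (\<integral>\<^sup>+v. \<integral>\<^sup>+u. F x y u v \<partial>lborel \<partial>lborel)"
    by (rule lborel_pair.Fubini'[symmetric]) measurable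
  also have "\<dots> = (\<integral>\<^sup>+v. \<integral>\<^sup>+u. F y x v u \<partial>lborel \<partial>lborel)" by (simp add: F)
  finally show ?case unfolding E .
qed

theorem transition_prob_sym:
  assumes "0 \<le> t"
  shows "\<pi> x * transition_prob Q t x y = \<pi> y * transition_prob Q t y x"
proof -
  have "ennreal (\<pi> x) * ennreal (transition_prob Q t x y) = ennreal (\<pi> y) * ennreal (transition_prob Q t y x)"
    unfolding ennreal_transition_prob[OF assms] ennreal_suminf_cmult[symmetric]
    by (simp add: jump_prob_sym[OF assms])
  then show ?thesis by (simp add: ennreal_mult[symmetric] pi_nonneg)
qed

text \<open>Symmetry turns this column sum, weighted by \<open>\<pi>\<close>, into
  \<open>\<pi> y\<close> times a row sum, which is 1 without explosion.\<close>

lemma pi_invariant: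
  assumes "0 \<le> t" "y \<in> S"
  shows "((\<lambda>x. \<pi> x * transition_prob Q t x y) has_sum \<pi> y) S"
  using has_sum_cmult_right[OF transition_prob_has_sum[OF targets_closed nonexplosive assms(2,1)], of "\<pi> y"]
  by (simp add: transition_prob_sym[OF assms(1), of y])

section \<open>Finite-dimensional distributions and reversibility\<close>

primrec path_law :: "(real \<times> 'x) list \<Rightarrow> real" where
  "path_law [] = 1"
| "path_law (p # c) = \<pi> (snd p) * path_weight (fst p) (snd p) c"

text \<open>Invariance removes the period before the first listed time, so that
  \<open>path_law\<close> may start with \<open>\<pi>\<close> there.\<close>

lemma cylinder_prob_sorted:
  assumes "sorted (map fst c)" "\<And>p. p \<in> set c \<Longrightarrow> 0 \<le> fst p \<and> snd p \<in> S"
  shows "cylinder_prob Q S \<pi> c = path_law c"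
proof -
  have "cylinder_prob Q S \<pi> c = (\<Sum>\<^sub>\<infinity>x\<in>S. \<pi> x * path_weight 0 x c)"
    unfolding cylinder_prob_def using measure_visits[OF assms(1), of 0] assms(2)
    by (simp add: visits_def split_beta map_idI)
  also have "\<dots> = path_law c"
  proof (cases c)
    case Nil
    then show ?thesis using pi_sum by (simp add: infsumI)
  next
    case (Cons p c')
    then have "((\<lambda>x. \<pi> x * transition_prob Q (fst p) x (snd p) * path_weight (fst p) (snd p) c') has_sum
       (\<pi> (snd p) * path_weight (fst p) (snd p) c')) S"
      using assms(2)[of p] by (intro has_sum_cmult_left pi_invariant) auto
    then show ?thesis by (simp add: Cons infsumI mult.assoc)
  qed
  finally show ?thesis .
qed

text \<open>The accumulator \<open>d\<close> is the part of the path already reversed. Each use of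
  \<open>transition_prob_sym\<close> turns one transition around and hands \<open>\<pi>\<close> on
  to the neighbouring state.\<close>

lemma path_law_reverse_aux:
  assumes "sorted (t # map fst c)"
  shows "path_law (rev (map (\<lambda>p. (T - fst p, snd p)) c) @ (T - t, z) # d) =
    \<pi> z * path_weight t z c * path_weight (T - t) z d"
  using assms
proof (induction c arbitrary: t z d)
  case (Cons p c)
  have "path_law (rev (map (\<lambda>p. (T - fst p, snd p)) (p # c)) @ (T - t, z) # d) =
    \<pi> (snd p) * path_weight (fst p) (snd p) c *
      (transition_prob Q (fst p - t) (snd p) z * path_weight (T - t) z d)"
    using Cons.IH[of "fst p" "snd p" "(T - t, z) # d"] Cons.prems by simp
  also have "\<dots> = \<pi> z * transition_prob Q (fst p - t) z (snd p) *
     path_weight (fst p) (snd p) c * path_weight (T - t) z d"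
    using transition_prob_sym[of "fst p - t" "snd p" z] Cons.prems by (simp add: ac_simps)
  finally show ?case by (simp add: mult.assoc)
qed simp

lemma path_law_reverse:
  assumes "sorted (map fst c)"
  shows "path_law (rev (map (\<lambda>p. (T - fst p, snd p)) c)) = path_law c"
  using path_law_reverse_aux[of "fst (hd c)" "tl c" T "snd (hd c)" "[]"] assms by (cases c) simp_all

theorem reversible: "reversible_process Q S \<pi>"
  unfolding reversible_process_def
proof (intro allI impI)
  fix T :: real and c assume T: "0 \<le> T" and "\<forall>(t, z)\<in>set c. 0 \<le> t \<and> t \<le> T \<and> z \<in> S"
  then have c: "0 \<le> fst p \<and> fst p \<le> T \<and> snd p \<in> S" if "p \<in> set c" for p using that by auto
  \<comment> \<open>A cylinder event depends only on the set of its pairs, so the list may be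
    sorted; reflecting the times reverses the order, which \<open>rev\<close> repairs. Equal times
    are allowed and are covered by transitions of duration 0.\<close>
  define c' where "c' = sort_key fst c"
  have c': "sorted (map fst c')" "set c' = set c" by (simp_all add: c'_def)
  let ?r = "map (\<lambda>p. (T - fst p, snd p))"
  have set_cong: "cylinder_prob Q S \<pi> a = cylinder_prob Q S \<pi> b" if "set a = set b" for a b
    using that by (simp add: cylinder_prob_def)
  have "sorted (map fst (rev (?r c')))"
    using c'(1) by (auto simp: rev_map[symmetric] sorted_wrt_rev sorted_wrt_map sorted_map comp_def
      elim!: sorted_wrt_mono_rel[rotated])
  then have "cylinder_prob Q S \<pi> (rev (?r c')) = path_law (rev (?r c'))"
    using c by (intro cylinder_prob_sorted) (auto simp: c')
  also have "\<dots> = cylinder_prob Q S \<pi> c'"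
    using c by (subst path_law_reverse[OF c'(1)], subst cylinder_prob_sorted[OF c'(1)]) (auto simp: c')
  also have "\<dots> = cylinder_prob Q S \<pi> c" by (rule set_cong) (simp add: c')
  also have "cylinder_prob Q S \<pi> (rev (?r c')) = cylinder_prob Q S \<pi> (map (\<lambda>(t, z). (T - t, z)) c)"
    by (rule set_cong) (simp add: c' split_beta)
  finally show "cylinder_prob Q S \<pi> c = cylinder_prob Q S \<pi> (map (\<lambda>(t, z). (T - t, z)) c)" ..
qed

text \<open>The part of \<open>\<nu>\<close> outside \<open>C\<close> comes first. Symmetry forbids
  any passage from \<open>C\<close> to its complement, so this part is subinvariant and hence
  invariant; then none of its mass may enter \<open>C\<close>, although every state does so with
  positive probability in one unit of time. After that the signed difference \<open>d\<close> lives
  on \<open>C\<close>, and irreducibility lets it keep only one sign; with total mass 0 it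
  vanishes.\<close>

theorem stationary_unique:
  assumes C: "C = {x \<in> S. 0 < \<pi> x}" "C \<noteq> {}"
    and irr: "\<And>x y. x \<in> C \<Longrightarrow> y \<in> C \<Longrightarrow> leads_to Q x y"
    and absorb: "\<And>x. x \<in> S \<Longrightarrow> \<exists>y\<in>C. leads_to Q x y"
    and \<nu>: "stationary_distribution Q S \<nu>" and x: "x \<in> S"
  shows "\<nu> x = \<pi> x"
proof -
  define P where "P = transition_prob Q 1"
  have P: "((\<lambda>y. P x y) has_sum 1) S" if "x \<in> S" for x
    unfolding P_def using transition_prob_has_sum[OF targets_closed nonexplosive that, of 1] by simp
  have P_nn: "0 \<le> P x y" for x y by (simp add: P_def)
  have P_pos: "0 < P x y" if "leads_to Q x y" for x y
    unfolding P_def using transition_prob_pos[OF that] by simp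
  have \<nu>_nn: "0 \<le> \<nu> x" if "x \<in> S" for x using \<nu> that by (simp add: stationary_distribution_def)
  have \<nu>_sum: "(\<nu> has_sum 1) S" using \<nu> by (simp add: stationary_distribution_def)
  have \<nu>_inv: "((\<lambda>x. \<nu> x * P x y) has_sum \<nu> y) S" if "y \<in> S" for y
    using \<nu> that by (simp add: stationary_distribution_def P_def)
  have \<pi>_inv: "((\<lambda>x. \<pi> x * P x y) has_sum \<pi> y) S" if "y \<in> S" for y
    using pi_invariant[of 1 y] that by (simp add: P_def)
  have CS: "C \<subseteq> S" using C by auto
  have P_C: "P x y = 0" if "x \<in> C" "y \<in> S - C" for x y
  proof -
    have "\<pi> y = 0" using that C(1) pi_nonneg[of y] by (auto simp: less_le)
    then show ?thesis using transition_prob_sym[of 1 x y] that C(1) by (auto simp: P_def)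
  qed
  have \<nu>_zero: "\<nu> x = 0" if x: "x \<in> S - C" for x
  proof -
    define \<mu> where "\<mu> x = (if x \<in> C then 0 else \<nu> x)" for x
    have "\<mu> summable_on S"
      by (rule summable_on_comparison_test[of \<nu>]) (use \<nu>_nn \<nu>_sum in \<open>auto simp: \<mu>_def summable_on_def\<close>)
    then have \<mu>_sum: "(\<mu> has_sum infsum \<mu> S) S" by simp
    have "(\<lambda>x. \<mu> x * P x y) summable_on S" if "y \<in> S" for y
      by (rule summable_on_comparison_test[of "\<lambda>x. \<nu> x * P x y"])
        (use \<nu>_nn \<nu>_inv[OF that] P_nn in \<open>auto simp: \<mu>_def summable_on_def\<close>)
    then have g: "((\<lambda>x. \<mu> x * P x y) has_sum (\<Sum>\<^sub>\<infinity>x\<in>S. \<mu> x * P x y)) S" if "y \<in> S" for y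
      using that by simp
    have sub: "\<mu> y \<le> (\<Sum>\<^sub>\<infinity>x\<in>S. \<mu> x * P x y)" if y: "y \<in> S" for y
    proof (cases "y \<in> C")
      case True
      then show ?thesis using \<nu>_nn P_nn by (auto simp: \<mu>_def intro!: infsum_nonneg)
    next
      case False
      have "(\<Sum>\<^sub>\<infinity>x\<in>S. \<mu> x * P x y) = (\<Sum>\<^sub>\<infinity>x\<in>S. \<nu> x * P x y)"
        using P_C[of _ y] False y by (intro infsum_cong) (auto simp: \<mu>_def)
      also have "\<dots> = \<nu> y" using \<nu>_inv[OF y] by (rule infsumI)
      finally show ?thesis using False by (simp add: \<mu>_def)
    qed
    obtain y where y: "y \<in> C" "leads_to Q x y" using absorb x by blast
    have "(\<Sum>\<^sub>\<infinity>x\<in>S. \<mu> x * P x y) = \<mu> y"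
      by (rule stochastic_subinvariant_imp_invariant[OF P P_nn _ \<mu>_sum g sub])
        (use y CS \<nu>_nn in \<open>auto simp: \<mu>_def\<close>)
    then have "((\<lambda>x. \<mu> x * P x y) has_sum 0) S" using g[of y] y CS by (auto simp: \<mu>_def)
    from nonneg_has_sum_le_0D[OF this, of x] have "\<mu> x * P x y = 0"
      using x \<nu>_nn P_nn by (auto simp: \<mu>_def)
    then show ?thesis using P_pos[OF y(2)] x by (simp add: \<mu>_def)
  qed
  define d where "d x = \<nu> x - \<pi> x" for x
  have d_sum: "(d has_sum 0) S" using has_sum_minus[OF \<nu>_sum pi_sum] by (simp add: d_def[abs_def])
  have d_inv: "((\<lambda>x. d x * P x y) has_sum d y) S" if "y \<in> S" for y
    using has_sum_minus[OF \<nu>_inv[OF that] \<pi>_inv[OF that]] by (simp add: d_def left_diff_distrib)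
  have abs_summable: "(\<lambda>x. \<bar>d x\<bar>) summable_on S"
  proof (rule summable_on_comparison_test[of "\<lambda>x. \<nu> x + \<pi> x"])
    show "(\<lambda>x. \<nu> x + \<pi> x) summable_on S"
      using has_sum_add[OF \<nu>_sum pi_sum] by (auto simp: summable_on_def)
    show "\<bar>d x\<bar> \<le> \<nu> x + \<pi> x" if "x \<in> S" for x using \<nu>_nn[OF that] pi_nonneg[of x] by (simp add: d_def)
  qed simp
  have abs_P: "((\<lambda>x. \<bar>d x\<bar> * P x y) has_sum (\<Sum>\<^sub>\<infinity>x\<in>S. \<bar>d x\<bar> * P x y)) S" if y: "y \<in> S" for y
  proof -
    have "(\<lambda>x. \<bar>d x\<bar> * P x y) summable_on S"
    proof (rule summable_on_comparison_test[OF abs_summable])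
      show "\<bar>d x\<bar> * P x y \<le> \<bar>d x\<bar>" for x
        unfolding P_def transition_prob_eq using N.prob_le_1 by (intro mult_left_le) auto
    qed (use P_nn in auto)
    then show ?thesis by simp
  qed
  have abs_eq: "(\<Sum>\<^sub>\<infinity>x\<in>S. \<bar>d x\<bar> * P x y) = \<bar>d y\<bar>" if y: "y \<in> S" for y
  proof (rule stochastic_subinvariant_imp_invariant[OF P P_nn _ has_sum_infsum[OF abs_summable] abs_P _ y])
    fix y assume y: "y \<in> S"
    show "\<bar>d y\<bar> \<le> (\<Sum>\<^sub>\<infinity>x\<in>S. \<bar>d x\<bar> * P x y)"
      using norm_has_sum_bound[OF _ d_inv[OF y]] abs_P[OF y] P_nn by (simp add: abs_mult)
  qed auto
  \<comment> \<open>From both \<open>a\<close> and \<open>b\<close> the state \<open>y\<close> is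
    reached with positive probability, so opposite signs partly cancel there and the triangle
    inequality for \<open>d y\<close> is strict, against \<open>abs_eq\<close>.\<close>
  have same_sign: "\<not> (0 < d a \<and> d b < 0)" if ab: "a \<in> S" "b \<in> S" for a b
  proof
    assume sg: "0 < d a \<and> d b < 0"
    have a: "a \<in> C" "b \<in> C" using sg ab \<nu>_zero pi_nonneg C(1) by (auto simp: d_def less_le not_less)
    obtain y where y: "y \<in> C" using C by blast
    have "P a y > 0" "P b y > 0" using irr a y by (auto intro: P_pos)
    with sg have "d a * P a y > 0" "d b * P b y < 0" by (auto simp: mult_neg_pos)
    moreover have yS: "y \<in> S" using y CS by auto
    have abs': "((\<lambda>x. \<bar>d x\<bar> * P x y) has_sum \<bar>d y\<bar>) S" using abs_P[OF yS] abs_eq[OF yS] by simp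
    consider "d y \<ge> 0" | "d y \<le> 0" by linarith
    then show False
    proof cases
      case 1
      have "d y < \<bar>d y\<bar>"
        by (rule has_sum_strict_mono[OF d_inv[OF yS] abs' _ ab(2)])
          (use P_nn \<open>d b * P b y < 0\<close> sg \<open>P b y > 0\<close> in \<open>auto intro: mult_right_mono\<close>)
      with 1 show False by simp
    next
      case 2
      have "((\<lambda>x. - (d x * P x y)) has_sum - d y) S"
        using d_inv[OF yS] by (simp add: has_sum_uminus)
      then have "- d y < \<bar>d y\<bar>"
      proof (rule has_sum_strict_mono[OF _ abs' _ ab(1)])
        show "- (d x * P x y) \<le> \<bar>d x\<bar> * P x y" for x
          using mult_right_mono[OF abs_ge_minus_self[of "d x"] P_nn[of x y]] by simp
        show "- (d a * P a y) < \<bar>d a\<bar> * P a y"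
          using \<open>d a * P a y > 0\<close> sg by simp
      qed
      with 2 show False by simp
    qed
  qed
  have "d x = 0"
  proof (cases "\<exists>a\<in>S. 0 < d a")
    case True
    then have "\<And>b. b \<in> S \<Longrightarrow> 0 \<le> d b" using same_sign by force
    from nonneg_has_sum_le_0D[OF d_sum _ this x] show ?thesis by simp
  next
    case False
    have "((\<lambda>x. - d x) has_sum 0) S" using d_sum by (simp add: has_sum_uminus)
    from nonneg_has_sum_le_0D[OF this, of x] False x show ?thesis by force
  qed
  then show ?thesis by (simp add: d_def)
qed

end

section \<open>Explosion, hitting times and return times\<close>

lemma nn_integral_exp_decay:
  assumes "0 < c"
  shows "(\<integral>\<^sup>+u. ennreal (exp (- c * u)) * indicator {0..} u \<partial>lborel) = ennreal (1 / c)"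
proof -
  have "ennreal c * (\<integral>\<^sup>+u. ennreal (exp (- c * u)) * indicator {0..} u \<partial>lborel) =
    (\<integral>\<^sup>+u. ennreal (c * exp (- c * u)) * indicator {0..} u \<partial>lborel)"
    using assms by (subst nn_integral_cmult[symmetric]) (auto simp: ennreal_mult mult.assoc intro!: nn_integral_cong)
  also have "\<dots> = 1"
    using nn_integral_exp_tail[of c 0] assms by simp
  finally have *: "ennreal c * (\<integral>\<^sup>+u. ennreal (exp (- c * u)) * indicator {0..} u \<partial>lborel) = 1" .
  have "ennreal (1 / c) = ennreal (1 / c) * (ennreal c * (\<integral>\<^sup>+u. ennreal (exp (- c * u)) * indicator {0..} u \<partial>lborel))"
    unfolding * by simp
  also have "\<dots> = ennreal (1 / c * c) * (\<integral>\<^sup>+u. ennreal (exp (- c * u)) * indicator {0..} u \<partial>lborel)"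
    using assms by (subst ennreal_mult) (auto simp: mult.assoc)
  finally show ?thesis using assms by simp
qed

section \<open>Laplace transforms of the jump times and a criterion against explosion\<close>

context generator_matrix
begin

text \<open>Meant as the mean of \<open>exp (- J)\<close>, with \<open>J\<close> the
  \<open>m\<close>-th jump time from \<open>x\<close>: a holding time contributes the factor
  \<open>q x / (1 + q x)\<close>, whose numerator cancels in the jump law. At an absorbing state the
  empty sum gives 0, the value of \<open>exp\<close> at minus infinity. With the recursion as
  definition only an inequality for the actual jump times has to be shown.\<close>

primrec jump_transform :: "nat \<Rightarrow> 'x \<Rightarrow> real" where
  "jump_transform 0 x = 1"
| "jump_transform (Suc m) x = (\<Sum>y\<in>targets x. Q x y * jump_transform m y) / (1 + q x)"

lemma one_plus_exit_rate_pos [simp]: "0 < 1 + q x"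
  using exit_rate_nonneg[of x] by linarith

lemma one_plus_exit_rate_nonzero [simp]: "1 + q x \<noteq> 0"
  by (rule less_imp_neq[OF one_plus_exit_rate_pos, symmetric])

lemma jump_transform_nonneg: "0 \<le> jump_transform m x"
  by (induction m arbitrary: x)
    (auto intro!: divide_nonneg_nonneg sum_nonneg mult_nonneg_nonneg dest: rate_pos intro: less_imp_le)

lemma jump_transform_decreasing: "jump_transform (Suc m) x \<le> jump_transform m x"
proof (induction m arbitrary: x)
  case 0
  have "(\<Sum>y\<in>targets x. Q x y * jump_transform 0 y) = q x" by (simp add: exit_rate_eq)
  then show ?case by simp
next
  case (Suc m)
  have "(\<Sum>y\<in>targets x. Q x y * jump_transform (Suc m) y) \<le> (\<Sum>y\<in>targets x. Q x y * jump_transform m y)"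
    by (intro sum_mono mult_left_mono Suc.IH) (auto dest: rate_pos)
  then show ?case
    unfolding jump_transform.simps(2)[of "Suc m"] jump_transform.simps(2)[of m x]
    by (intro divide_right_mono) auto
qed

text \<open>Markov's inequality for the variable \<open>exp (- J)\<close>, with \<open>J\<close> the \<open>m\<close>-th jump time.\<close>

lemma emeasure_jump_time_le:
  assumes "0 \<le> t"
  shows "emeasure N {\<omega>. jump_time Q x \<omega> m \<le> ennreal t} \<le> ennreal (exp t * jump_transform m x)"
  using assms
proof (induction m arbitrary: x t)
  case 0
  have "emeasure N {\<omega>. jump_time Q x \<omega> 0 \<le> ennreal t} \<le> 1" by (rule N.measure_le_1)
  also have "1 \<le> ennreal (exp t)" using 0 by simp
  finally show ?case by simp
next
  case (Suc m)
  show ?case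
  proof (cases "q x = 0")
    case True
    then show ?thesis by (simp add: jump_time_shift holding_time_absorbing top_unique)
  next
    case False
    then have q: "0 < q x" by (simp add: less_le)
    let ?s = "\<Sum>y\<in>targets x. Q x y * jump_transform m y"
    let ?E = "\<lambda>u. \<Sum>y\<in>targets x. ennreal (Q x y) *
      emeasure N {\<omega>. u \<le> t \<and> jump_time Q y \<omega> m \<le> ennreal (t - u)}"
    have [measurable]: "(\<lambda>p. jump_time Q y (snd p) m) \<in> borel_measurable (borel \<Otimes>\<^sub>M N)" for y
      by (rule measurable_compose[OF measurable_snd measurable_jump_time])
    have "emeasure N {\<omega>. jump_time Q x \<omega> (Suc m) \<le> ennreal t} = (\<integral>\<^sup>+u. ennreal (exp (- q x * u)) *
      ?E u
       * indicator {0..} u \<partial>lborel)"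
    proof (rule emeasure_first_step[OF q])
      show "jump_time Q x \<omega> (Suc m) \<le> ennreal t \<longleftrightarrow> snd \<omega> 0 / q x \<le> t \<and>
        jump_time Q (fst \<omega> (0, x)) (shift_noise \<omega>) m \<le> ennreal (t - snd \<omega> 0 / q x)"
        if u: "0 \<le> snd \<omega> 0 / q x" for \<omega>
      proof (cases "snd \<omega> 0 / q x \<le> t")
        case True
        show ?thesis
          unfolding jump_time_shift holding_time_first[OF q refl u]
          using ennreal_less_add_iff(2)[OF u True] True by simp
      next
        case False
        then have "ennreal t < ennreal (snd \<omega> 0 / q x)" using Suc.prems u by (simp add: ennreal_less_iff)
        also have "\<dots> \<le> jump_time Q x \<omega> (Suc m)"
          unfolding jump_time_shift holding_time_first[OF q refl u] unfolding le_iff_add by blast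
        finally show ?thesis using False by (simp add: not_le)
      qed
    qed measurable
    also have "\<dots> \<le> (\<integral>\<^sup>+u. ennreal (exp t * ?s) *
       (ennreal (exp (- (1 + q x) * u)) * indicator {0..} u) \<partial>lborel)"
    proof (intro nn_integral_mono)
      fix u :: real
      show "ennreal (exp (- q x * u)) *
        ?E u
         * indicator {0..} u \<le> ennreal (exp t * ?s) *
       (ennreal (exp (- (1 + q x) * u)) * indicator {0..} u)"
      proof (cases "0 \<le> u \<and> u \<le> t")
        case True
        have "?E u
          \<le> (\<Sum>y\<in>targets x. ennreal (Q x y) * ennreal (exp (t - u) * jump_transform m y))"
          using True Suc.IH[of "t - u"] by (intro sum_mono mult_left_mono) auto
        also have "\<dots> = (\<Sum>y\<in>targets x. ennreal (exp (t - u) * (Q x y * jump_transform m y)))"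
          by (intro sum.cong refl, subst ennreal_mult[symmetric])
             (auto simp: jump_transform_nonneg ac_simps dest: rate_pos intro: less_imp_le)
        also have "\<dots> = ennreal (exp (t - u) * ?s)"
          unfolding sum_distrib_left
          by (rule sum_ennreal) (auto simp: jump_transform_nonneg dest: rate_pos intro: less_imp_le)
        finally have "ennreal (exp (- q x * u)) *
          ?E u
          \<le> ennreal (exp (- q x * u)) * ennreal (exp (t - u) * ?s)"
          by (rule mult_left_mono) simp
        also have "\<dots> = ennreal ((exp (- q x * u) * exp (t - u)) * ?s)"
          by (subst ennreal_mult[symmetric])
            (auto simp: jump_transform_nonneg mult.assoc intro!: sum_nonneg mult_nonneg_nonneg dest: rate_pos intro: less_imp_le)
        also have "exp (- q x * u) * exp (t - u) = exp t * exp (- (1 + q x) * u)"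
          by (simp add: exp_add[symmetric] algebra_simps)
        also have "ennreal (exp t * exp (- (1 + q x) * u) * ?s) =
          ennreal (exp t * ?s) * ennreal (exp (- (1 + q x) * u))"
          by (subst ennreal_mult[symmetric])
            (auto simp: jump_transform_nonneg ac_simps intro!: sum_nonneg mult_nonneg_nonneg dest: rate_pos intro: less_imp_le)
        finally show ?thesis using True by simp
      next
        case False
        then show ?thesis by (cases "0 \<le> u") auto
      qed
    qed
    also have "\<dots> = ennreal (exp t * ?s) * ennreal (1 / (1 + q x))"
      by (subst nn_integral_cmult, measurable, subst nn_integral_exp_decay) simp_all
    also have "\<dots> = ennreal (exp t * jump_transform (Suc m) x)"
      by (subst ennreal_mult[symmetric])
        (auto intro!: sum_nonneg mult_nonneg_nonneg simp: jump_transform_nonneg dest: rate_pos intro: less_imp_le)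
    finally show ?thesis .
  qed
qed

text \<open>The limit \<open>L\<close> solves
  \<open>(1 + q y) * L y = (\<Sum>z\<in>targets y. Q y z * L z)\<close>, and \<open>W\<close> is a
  supersolution of this equation. Subtracting a small multiple of \<open>W\<close> leaves a function
  that is positive at most on a finite set. At a positive maximum the terms with the exit rate
  cancel, and the extra 1, the parameter of the transform, forces the value to be
  nonpositive.\<close>

lemma jump_transform_tendsto_0:
  assumes S: "\<And>x. x \<in> S \<Longrightarrow> targets x \<subseteq> S"
    and W_pos: "\<And>x. x \<in> S \<Longrightarrow> 0 < W x"
    and W_finite: "\<And>c. finite {x \<in> S. W x \<le> c}"
    and drift: "\<And>x. x \<in> S \<Longrightarrow> (\<Sum>y\<in>targets x. Q x y * W y) \<le> (1 + q x) * W x"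
    and x: "x \<in> S"
  shows "(\<lambda>m. jump_transform m x) \<longlonglongrightarrow> 0"
proof -
  have le1: "jump_transform m y \<le> 1" for m y
  proof (induction m)
    case (Suc m)
    then show ?case using jump_transform_decreasing[of m y] by linarith
  qed simp
  have "convergent (\<lambda>m. jump_transform m y)" for y
    by (rule Bseq_monoseq_convergent)
      (auto simp: Bseq_def monoseq_Suc jump_transform_nonneg jump_transform_decreasing le1
        simp del: jump_transform.simps(2) intro!: exI[of _ 1])
  then obtain L where L: "\<And>y. (\<lambda>m. jump_transform m y) \<longlonglongrightarrow> L y"
    unfolding convergent_def by metis
  have L_nn: "0 \<le> L y" and L_le: "L y \<le> 1" for y
    using LIMSEQ_le_const[OF L, of 0] LIMSEQ_le_const2[OF L, of _ 1] jump_transform_nonneg le1 by blast+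
  have L_eq: "(1 + q y) * L y = (\<Sum>z\<in>targets y. Q y z * L z)" for y
  proof -
    have "(\<lambda>m. jump_transform (Suc m) y) \<longlonglongrightarrow> (\<Sum>z\<in>targets y. Q y z * L z) / (1 + q y)"
      unfolding jump_transform.simps(2) using L
      by (intro tendsto_intros) auto
    with LIMSEQ_Suc[OF L[of y]] have "L y = (\<Sum>z\<in>targets y. Q y z * L z) / (1 + q y)"
      by (rule LIMSEQ_unique)
    then show ?thesis by (simp add: field_simps)
  qed
  have "L x = 0"
  proof (rule ccontr)
    assume "L x \<noteq> 0"
    then have Lx: "0 < L x" using L_nn[of x] by simp
    \<comment> \<open>Chosen so that \<open>h x = L x / 2\<close> is still positive.\<close>
    define e where "e = L x / (2 * W x)"
    have e: "0 < e" using Lx W_pos[OF x] by (simp add: e_def)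
    define h where "h y = L y - e * W y" for y
    have hx: "0 < h x" using Lx W_pos[OF x] by (simp add: h_def e_def)
    \<comment> \<open>Outside \<open>K\<close> the barrier exceeds \<open>1 / e\<close>, so
      \<open>e * W\<close> exceeds every value of \<open>L\<close>.\<close>
    define K where "K = {y \<in> S. W y \<le> 1 / e}"
    have K: "finite K" unfolding K_def by (rule W_finite)
    have out: "h y \<le> 0" if "y \<in> S - K" for y
      using that e L_le[of y] by (auto simp: K_def h_def field_simps)
    have "x \<in> K" using hx out x by force
    then have "Max (h ` K) \<in> h ` K" using K by (intro Max_in) auto
    then obtain z where "z \<in> K" "Max (h ` K) = h z" by blast
    then have z: "z \<in> K" "\<And>y. y \<in> K \<Longrightarrow> h y \<le> h z"
      using K Max_ge[of "h ` K"] by auto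
    have zS: "z \<in> S" using z by (simp add: K_def)
    have hz: "0 < h z" using z(2)[OF \<open>x \<in> K\<close>] hx by simp
    have max: "h y \<le> h z" if "y \<in> S" for y
      using that z(2)[of y] out[of y] hz by (cases "y \<in> K") auto
    have "(1 + q z) * L z = (\<Sum>y\<in>targets z. Q z y * h y) + e * (\<Sum>y\<in>targets z. Q z y * W y)"
      unfolding L_eq h_def by (simp add: sum_distrib_left sum_subtractf algebra_simps)
    also have "\<dots> \<le> (\<Sum>y\<in>targets z. Q z y * h z) + e * ((1 + q z) * W z)"
      using S[OF zS] e drift[OF zS]
      by (intro add_mono sum_mono mult_left_mono max) (auto dest: rate_pos intro: less_imp_le)
    also have "\<dots> = q z * h z + (1 + q z) * (e * W z)"
      by (simp add: exit_rate_eq sum_distrib_right[symmetric])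
    finally have "h z \<le> 0" by (simp add: h_def algebra_simps)
    then show False using hz by simp
  qed
  then show ?thesis using L[of x] by simp
qed

theorem nonexplosive_criterion:
  assumes "\<And>x. x \<in> S \<Longrightarrow> targets x \<subseteq> S"
    and "\<And>x. x \<in> S \<Longrightarrow> 0 < W x"
    and "\<And>c. finite {x \<in> S. W x \<le> c}"
    and "\<And>x. x \<in> S \<Longrightarrow> (\<Sum>y\<in>targets x. Q x y * W y) \<le> (1 + q x) * W x"
  shows "nonexplosive Q S"
  unfolding nonexplosive_def
proof
  fix x assume "x \<in> S"
  then have lim: "(\<lambda>m. jump_transform m x) \<longlonglongrightarrow> 0"
    using jump_transform_tendsto_0[OF assms] by blast
  let ?Z = "\<lambda>\<omega>. \<Sum>m. holding_time Q x \<omega> m"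
  have "AE \<omega> in N. \<not> ?Z \<omega> \<le> ennreal (real n)" for n :: nat
  proof -
    have "emeasure N {\<omega>. ?Z \<omega> \<le> ennreal (real n)} \<le> ennreal (exp n * jump_transform m x)" for m
    proof -
      have "jump_time Q x \<omega> m \<le> ?Z \<omega>" for \<omega>
        unfolding jump_time_def by (rule sum_le_suminf) auto
      then have "emeasure N {\<omega>. ?Z \<omega> \<le> ennreal (real n)} \<le> emeasure N {\<omega>. jump_time Q x \<omega> m \<le> ennreal (real n)}"
        by (intro emeasure_mono sets_Collect_noise) (auto intro: order_trans, measurable)
      also have "\<dots> \<le> ennreal (exp n * jump_transform m x)"
        by (rule emeasure_jump_time_le) simp
      finally show ?thesis .
    qed
    moreover have "(\<lambda>m. ennreal (exp n * jump_transform m x)) \<longlonglongrightarrow> ennreal (exp n * 0)"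
      by (intro tendsto_ennrealI tendsto_intros lim)
    ultimately have "emeasure N {\<omega>. ?Z \<omega> \<le> ennreal (real n)} \<le> ennreal (exp n * 0)"
      by (intro LIMSEQ_le_const) auto
    then have "emeasure N {\<omega>. ?Z \<omega> \<le> ennreal (real n)} = 0" by simp
    then show ?thesis
      by (intro AE_I[of _ _ "{\<omega>. ?Z \<omega> \<le> ennreal (real n)}"]) (auto intro!: sets_Collect_noise)
  qed
  then have "AE \<omega> in N. \<forall>n::nat. \<not> ?Z \<omega> \<le> ennreal (real n)" by (simp add: AE_all_countable)
  then show "AE \<omega> in N. ?Z \<omega> = \<infinity>"
  proof eventually_elim
    case (elim \<omega>)
    show ?case
    proof (rule ccontr)
      assume "?Z \<omega> \<noteq> \<infinity>"
      then obtain r where r: "?Z \<omega> = ennreal r" "0 \<le> r" by (cases "?Z \<omega>") auto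
      obtain n :: nat where "r \<le> real n" using real_arch_simple by blast
      with elim r show False by auto
    qed
  qed
qed

section \<open>Hitting and return times\<close>

definition avoid_term :: "nat \<Rightarrow> 'x set \<Rightarrow> 'x \<Rightarrow> nat \<Rightarrow> 'x noise \<Rightarrow> ennreal" where
  "avoid_term a B x m \<omega> =
     (if \<forall>k\<in>{a..m}. jump_chain x \<omega> k \<notin> B then holding_time Q x \<omega> m else 0)"

text \<open>The time at which the chain is in \<open>B\<close> at an index at least \<open>a\<close>
  for the first time, since all later terms are zero. For \<open>a = 0\<close> this is a hitting
  time; for \<open>a = 1\<close> the initial state does not count, as a return time requires. If
  there is no such index, all holding times are added up.\<close>

definition avoid_time :: "nat \<Rightarrow> 'x set \<Rightarrow> 'x \<Rightarrow> 'x noise \<Rightarrow> ennreal" where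
  "avoid_time a B x \<omega> = (\<Sum>m. avoid_term a B x m \<omega>)"

lemma measurable_avoid_term [measurable]: "avoid_term a B x m \<in> borel_measurable N"
proof -
  have [measurable]: "Measurable.pred N (\<lambda>\<omega>. jump_chain x \<omega> k \<in> B)" for k
    by (rule measurable_compose[OF measurable_jump_chain]) simp
  show ?thesis unfolding avoid_term_def by measurable
qed

text \<open>Since the holding times add up to infinity, a finite value means that \<open>B\<close>
  is met. Positivity of the noise makes the next holding time nonzero, so the process really is in
  that state at the moment of the jump.\<close>

lemma avoid_time_hits:
  assumes pos: "\<forall>m. 0 < snd \<omega> m" and inf: "(\<Sum>m. holding_time Q x \<omega> m) = \<infinity>"
    and fin: "avoid_time a B x \<omega> \<noteq> \<infinity>"
  obtains k where "a \<le> k" "jump_chain x \<omega> k \<in> B" "jump_time Q x \<omega> k = avoid_time a B x \<omega>"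
    "process Q x (enn2real (avoid_time a B x \<omega>)) \<omega> = Some (jump_chain x \<omega> k)"
proof -
  let ?P = "\<lambda>k. a \<le> k \<and> jump_chain x \<omega> k \<in> B"
  have "\<exists>k. ?P k"
  proof (rule ccontr)
    assume "\<not> (\<exists>k. ?P k)"
    then have "avoid_term a B x m \<omega> = holding_time Q x \<omega> m" for m by (auto simp: avoid_term_def)
    then show False using inf fin by (simp add: avoid_time_def)
  qed
  define k where "k = (LEAST k. ?P k)"
  have k: "?P k" unfolding k_def by (rule LeastI_ex) fact
  have before: "\<not> ?P j" if "j < k" for j using that not_less_Least unfolding k_def by blast
  have "avoid_time a B x \<omega> = (\<Sum>m<k. avoid_term a B x m \<omega>)"
    unfolding avoid_time_def using k by (intro suminf_finite) (auto simp: avoid_term_def)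
  also have "\<dots> = jump_time Q x \<omega> k"
    unfolding jump_time_def using before by (intro sum.cong) (auto simp: avoid_term_def)
  finally have J: "jump_time Q x \<omega> k = avoid_time a B x \<omega>" ..
  have H: "0 < holding_time Q x \<omega> k"
    using pos exit_rate_nonneg[of "jump_chain x \<omega> k"] by (auto simp: holding_time_def Let_def less_le)
  obtain r where r: "avoid_time a B x \<omega> = ennreal r" "0 \<le> r" using fin by (cases "avoid_time a B x \<omega>") auto
  have "ennreal r < ennreal r + holding_time Q x \<omega> k"
    using H r(2) by (cases "holding_time Q x \<omega> k") (auto simp: ennreal_plus[symmetric] ennreal_less_iff simp del: ennreal_plus)
  then have "at_jump x r k (jump_chain x \<omega> k) \<omega>"
    by (simp add: at_jump_def jump_time_Suc J r)
  then have "process Q x (enn2real (avoid_time a B x \<omega>)) \<omega> = Some (jump_chain x \<omega> k)"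
    using r by (auto simp: process_eq_Some_iff)
  with that k J show ?thesis by blast
qed

definition avoid_mean :: "'x set \<Rightarrow> nat \<Rightarrow> 'x \<Rightarrow> ennreal" where
  "avoid_mean B m x = (\<integral>\<^sup>+\<omega>. avoid_term 0 B x m \<omega> \<partial>N)"

lemma nn_integral_avoid_time: "(\<integral>\<^sup>+\<omega>. avoid_time 0 B x \<omega> \<partial>N) = (\<Sum>m. avoid_mean B m x)"
  unfolding avoid_time_def avoid_mean_def by (rule nn_integral_suminf) measurable

lemma avoid_mean_in: "x \<in> B \<Longrightarrow> avoid_mean B m x = 0"
proof -
  assume "x \<in> B"
  then have "avoid_term 0 B x m \<omega> = 0" for \<omega>
    unfolding avoid_term_def by (metis atLeastAtMost_iff jump_chain.simps(1) le0)
  then show ?thesis by (simp add: avoid_mean_def)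
qed

lemma nn_integral_first_holding_time:
  assumes "0 < q x"
  shows "(\<integral>\<^sup>+\<omega>. holding_time Q x \<omega> 0 \<partial>N) = ennreal (1 / q x)"
proof -
  have "(\<integral>\<^sup>+\<omega>. holding_time Q x \<omega> 0 \<partial>N) = (\<integral>\<^sup>+\<omega>. ennreal (snd \<omega> 0 / q x) \<partial>N)"
    using assms by (simp add: holding_time_def)
  also have "\<dots> = (\<integral>\<^sup>+a. \<integral>\<^sup>+y. \<integral>\<^sup>+\<omega>. ennreal (a / q x) \<partial>N \<partial>measure_pmf (jump_pmf Q x) \<partial>std_exponential)"
    by (rule nn_integral_noise_first_step[OF countable_states]) measurable
  also have "\<dots> = (\<integral>\<^sup>+a. ennreal (a / q x) \<partial>std_exponential)"
    by (simp add: N.emeasure_space_1[simplified])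
  also have "\<dots> = (\<integral>\<^sup>+a. ennreal (exp (- a)) * ennreal (a / q x) * indicator {0..} a \<partial>lborel)"
    by (rule nn_integral_std_exponential) measurable
  also have "\<dots> = (\<integral>\<^sup>+a. ennreal (1 / q x) * (ennreal (a ^ 1 * exp (- a)) * indicator {0..} a) \<partial>lborel)"
    using assms by (intro nn_integral_cong)
      (auto simp: ennreal_mult[symmetric] mult.commute split: split_indicator)
  also have "\<dots> = ennreal (1 / q x)"
    using nn_intergal_power_times_exp_Ici[of 1] by (subst nn_integral_cmult) auto
  finally show ?thesis .
qed

lemma nn_integral_avoid_term_Suc:
  assumes q: "0 < q x"
  shows "ennreal (q x) * (\<integral>\<^sup>+\<omega>. avoid_term 1 B x (Suc m) \<omega> \<partial>N) = (\<Sum>y\<in>targets x. ennreal (Q x y) * avoid_mean B m y)"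
proof -
  have shift: "avoid_term 1 B x (Suc m) \<omega> = avoid_term 0 B (fst \<omega> (0, x)) m (shift_noise \<omega>)" for \<omega>
  proof -
    have "(\<forall>k\<in>{1..Suc m}. jump_chain x \<omega> k \<notin> B) \<longleftrightarrow> (\<forall>k\<in>{0..m}. jump_chain x \<omega> (Suc k) \<notin> B)"
    proof -
      have "{1..Suc m} = Suc ` {0..m}" by (simp add: image_Suc_atLeastAtMost)
      then show ?thesis by (simp only: Ball_image_comp o_def)
    qed
    then show ?thesis unfolding avoid_term_def jump_chain_shift holding_time_shift by simp
  qed
  have "(\<integral>\<^sup>+\<omega>. avoid_term 1 B x (Suc m) \<omega> \<partial>N) =
    (\<integral>\<^sup>+u. ennreal (exp (- q x * u)) * (\<Sum>y\<in>targets x. ennreal (Q x y) * avoid_mean B m y) * indicator {0..} u \<partial>lborel)"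
    unfolding shift avoid_mean_def
    by (rule nn_integral_first_step[OF q, where g = "\<lambda>y u \<omega>. avoid_term 0 B y m \<omega>"])
      (rule measurable_compose[OF measurable_snd measurable_avoid_term])
  also have "\<dots> = (\<integral>\<^sup>+u. (\<Sum>y\<in>targets x. ennreal (Q x y) * avoid_mean B m y) * (ennreal (exp (- q x * u)) * indicator {0..} u) \<partial>lborel)"
    by (simp add: ac_simps)
  also have "\<dots> = (\<Sum>y\<in>targets x. ennreal (Q x y) * avoid_mean B m y) * ennreal (1 / q x)"
    using q by (subst nn_integral_cmult) (simp_all add: nn_integral_exp_decay[OF q, simplified])
  finally have "ennreal (q x) * (\<integral>\<^sup>+\<omega>. avoid_term 1 B x (Suc m) \<omega> \<partial>N) =
    ennreal (q x) * ennreal (1 / q x) * (\<Sum>y\<in>targets x. ennreal (Q x y) * avoid_mean B m y)"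
    by (simp add: ac_simps)
  also have "ennreal (q x) * ennreal (1 / q x) = 1"
    using q by (subst ennreal_mult[symmetric]) auto
  finally show ?thesis by simp
qed

lemma avoid_term_start: "avoid_term 0 B x m \<omega> = (if x \<in> B then 0 else avoid_term 1 B x m \<omega>)"
proof -
  have "{0..m} = insert 0 {1..m}" by auto
  then show ?thesis by (simp add: avoid_term_def)
qed

text \<open>The factor \<open>q x\<close> makes the recursion true at absorbing states as well,
  where the mean may be infinite: the product with 0 is 0 in \<open>ennreal\<close>, and the sum
  over the targets is empty.\<close>

lemma avoid_mean_Suc:
  "ennreal (q x) * avoid_mean B (Suc m) x =
    (if x \<in> B then 0 else \<Sum>y\<in>targets x. ennreal (Q x y) * avoid_mean B m y)"
proof (cases "q x = 0")
  case True
  then show ?thesis by (simp add: exit_rate_zero_iff)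
next
  case False
  then have "0 < q x" by (simp add: less_le)
  then show ?thesis
    using nn_integral_avoid_term_Suc[of x B m]
    by (cases "x \<in> B") (simp_all add: avoid_mean_in avoid_mean_def[of B "Suc m"] avoid_term_start del: One_nat_def)
qed

lemma avoid_mean_0: "ennreal (q x) * avoid_mean B 0 x = (if x \<in> B \<or> q x = 0 then 0 else 1)"
proof (cases "x \<in> B \<or> q x = 0")
  case True
  then show ?thesis by (auto simp: avoid_mean_in)
next
  case False
  then have q: "0 < q x" by (simp add: less_le)
  have "avoid_mean B 0 x = ennreal (1 / q x)"
    using False nn_integral_first_holding_time[OF q] by (simp add: avoid_mean_def avoid_term_def)
  then show ?thesis using False q by (simp add: ennreal_mult[symmetric])
qed

text \<open>Foster's drift criterion. The mean hitting time is at most \<open>V x / c\<close>;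
  bounding the time within the first \<open>k\<close> holding periods, by induction on
  \<open>k\<close>, keeps the argument free of finiteness assumptions.\<close>

theorem lyapunov_hitting:
  assumes S: "\<And>x. x \<in> S \<Longrightarrow> targets x \<subseteq> S" and ne: "nonexplosive Q S"
    and V: "\<And>x. x \<in> S \<Longrightarrow> 0 \<le> V x" and c: "0 < c"
    and drift: "\<And>x. x \<in> S - B \<Longrightarrow> (\<Sum>y\<in>targets x. Q x y * V y) + c \<le> q x * V x"
    and x: "x \<in> S"
  shows "AE \<omega> in N. \<exists>t\<ge>0. process Q x t \<omega> \<in> Some ` B"
proof -
  have bound: "(\<Sum>m<k. avoid_mean B m x) \<le> ennreal (V x / c)" if "x \<in> S" for k x
    using that
  proof (induction k arbitrary: x)
    case (Suc k)
    show ?case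
    proof (cases "x \<in> B")
      case True
      then show ?thesis by (simp add: avoid_mean_in)
    next
      case False
      have "0 \<le> (\<Sum>y\<in>targets x. Q x y * V y)"
        using S[OF Suc.prems] V by (intro sum_nonneg mult_nonneg_nonneg) (auto dest: rate_pos intro: less_imp_le)
      \<comment> \<open>The drift condition excludes absorbing states outside
        \<open>B\<close>.\<close>
      then have "0 < q x * V x" using drift[of x] False Suc.prems c by auto
      then have q: "0 < q x" using exit_rate_nonneg[of x] by (auto simp: less_le)
      have "ennreal (q x) * (\<Sum>m<Suc k. avoid_mean B m x) =
        1 + (\<Sum>m<k. \<Sum>y\<in>targets x. ennreal (Q x y) * avoid_mean B m y)"
        unfolding sum.lessThan_Suc_shift using q False
        by (simp add: distrib_left avoid_mean_0 sum_distrib_left avoid_mean_Suc)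
      also have "\<dots> = 1 + (\<Sum>y\<in>targets x. ennreal (Q x y) * (\<Sum>m<k. avoid_mean B m y))"
        unfolding sum_distrib_left by (subst sum.swap) simp
      also have "\<dots> \<le> 1 + (\<Sum>y\<in>targets x. ennreal (Q x y) * ennreal (V y / c))"
        using S[OF Suc.prems] by (intro add_left_mono sum_mono mult_left_mono Suc.IH) auto
      also have "(\<Sum>y\<in>targets x. ennreal (Q x y) * ennreal (V y / c)) = (\<Sum>y\<in>targets x. ennreal (Q x y * (V y / c)))"
        using S[OF Suc.prems] V c
        by (intro sum.cong refl ennreal_mult[symmetric]) (auto dest: rate_pos intro: less_imp_le)
      also have "\<dots> = ennreal (\<Sum>y\<in>targets x. Q x y * (V y / c))"
        using S[OF Suc.prems] V c
        by (intro sum_ennreal mult_nonneg_nonneg) (auto dest: rate_pos intro: less_imp_le)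
      also have "(\<Sum>y\<in>targets x. Q x y * (V y / c)) = (\<Sum>y\<in>targets x. Q x y * V y) / c"
        by (simp add: sum_divide_distrib)
      also have "1 + ennreal \<dots> = ennreal (1 + (\<Sum>y\<in>targets x. Q x y * V y) / c)"
        using \<open>0 \<le> (\<Sum>y\<in>targets x. Q x y * V y)\<close> c by (subst ennreal_plus) auto
      also have "\<dots> \<le> ennreal (q x * (V x / c))"
        using divide_right_mono[OF drift[of x], of c] False Suc.prems c
        by (intro ennreal_leI) (simp add: add_divide_distrib)
      also have "ennreal (q x * (V x / c)) = ennreal (q x) * ennreal (V x / c)"
        using q c V[OF Suc.prems] by (intro ennreal_mult) auto
      finally show ?thesis using q by (simp add: ennreal_mult_le_mult_iff)
    qed
  qed simp
  have "(\<integral>\<^sup>+\<omega>. avoid_time 0 B x \<omega> \<partial>N) \<le> ennreal (V x / c)"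
    unfolding nn_integral_avoid_time by (rule suminf_le_const) (use bound[OF x] in auto)
  then have "(\<integral>\<^sup>+\<omega>. avoid_time 0 B x \<omega> \<partial>N) \<noteq> \<infinity>" by (auto simp: top_unique)
  then have "AE \<omega> in N. avoid_time 0 B x \<omega> \<noteq> \<infinity>"
    by (intro nn_integral_noteq_infinite) (simp_all add: avoid_time_def[abs_def])
  moreover have "AE \<omega> in N. (\<Sum>m. holding_time Q x \<omega> m) = \<infinity>"
    using ne x by (simp add: nonexplosive_def)
  ultimately show ?thesis using AE_noise_positive
  proof eventually_elim
    case (elim \<omega>)
    then obtain k where "jump_chain x \<omega> k \<in> B"
      "process Q x (enn2real (avoid_time 0 B x \<omega>)) \<omega> = Some (jump_chain x \<omega> k)"
      by (blast elim: avoid_time_hits)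
    then show ?case by (intro exI[of _ "enn2real (avoid_time 0 B x \<omega>)"]) auto
  qed
qed

text \<open>At the time \<open>avoid_time 1 {x} x \<omega>\<close> the process is in
  \<open>x\<close> and at least one jump has passed, so this time is a candidate for the infimum in
  \<open>return_time\<close>.\<close>

lemma return_time_le_avoid_time:
  assumes "\<forall>m. 0 < snd \<omega> m" "(\<Sum>m. holding_time Q x \<omega> m) = \<infinity>"
  shows "return_time Q x \<omega> \<le> avoid_time 1 {x} x \<omega>"
proof (cases "avoid_time 1 {x} x \<omega> = \<infinity>")
  case False
  then obtain k where k: "1 \<le> k" "jump_chain x \<omega> k \<in> {x}" "jump_time Q x \<omega> k = avoid_time 1 {x} x \<omega>"
    "process Q x (enn2real (avoid_time 1 {x} x \<omega>)) \<omega> = Some (jump_chain x \<omega> k)"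
    by (rule avoid_time_hits[OF assms])
  have e: "ennreal (enn2real (avoid_time 1 {x} x \<omega>)) = avoid_time 1 {x} x \<omega>"
    using False by (simp add: less_top)
  have "return_time Q x \<omega> \<le> ennreal (enn2real (avoid_time 1 {x} x \<omega>))"
    unfolding return_time_def
    using k jump_time_mono[OF k(1), of x \<omega>] e by (intro Inf_lower imageI) auto
  then show ?thesis unfolding e .
qed simp

end

section \<open>Mean return times of a reversible process\<close>

context reversible_generator
begin

text \<open>\<open>first_hit x m w\<close> is the probability that the jump chain started at \<open>w \<noteq> x\<close> enters \<open>x\<close> for
  the first time at step \<open>m + 1\<close>.\<close>

primrec first_hit :: "'x \<Rightarrow> nat \<Rightarrow> 'x \<Rightarrow> ennreal" where
  "first_hit x 0 w = (if w = x then 0 else ennreal (Q w x / q w))"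
| "first_hit x (Suc m) w = (if w = x then 0 else \<Sum>z\<in>targets w. ennreal (Q w z / q w) * first_hit x m z)"

lemma first_hit_self [simp]: "first_hit x m x = 0"
  by (cases m) auto

text \<open>The events behind the terms are disjoint; with \<open>first_hit\<close> defined by
  recursion this shows in a first step, where the jump either enters \<open>x\<close> or goes to a
  state that satisfies the bound for \<open>k\<close>.\<close>

lemma sum_first_hit_le: "(\<Sum>m<k. first_hit x m w) \<le> 1"
proof (induction k arbitrary: w)
  case (Suc k)
  show ?case
  proof (cases "w = x \<or> q w = 0")
    case True
    then have "first_hit x m w = 0" for m by (cases m) auto
    then show ?thesis by simp
  next
    case False
    then have q: "0 < q w" and wx: "w \<noteq> x" by (auto simp: less_le)
    have "(\<Sum>m<Suc k. first_hit x m w) =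
      ennreal (Q w x / q w) + (\<Sum>m<k. \<Sum>z\<in>targets w. ennreal (Q w z / q w) * first_hit x m z)"
      unfolding sum.lessThan_Suc_shift using wx by simp
    also have "ennreal (Q w x / q w) = (\<Sum>z\<in>targets w. if z = x then ennreal (Q w z / q w) else 0)"
      using wx by (auto simp: targets_def finite_targets)
    also have "(\<Sum>m<k. \<Sum>z\<in>targets w. ennreal (Q w z / q w) * first_hit x m z) =
      (\<Sum>z\<in>targets w. ennreal (Q w z / q w) * (\<Sum>m<k. first_hit x m z))"
      unfolding sum_distrib_left by (rule sum.swap)
    also have "(\<Sum>z\<in>targets w. if z = x then ennreal (Q w z / q w) else 0) + \<dots> \<le> (\<Sum>z\<in>targets w. ennreal (Q w z / q w))"
      unfolding sum.distrib[symmetric]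
    proof (rule sum_mono)
      fix z
      show "(if z = x then ennreal (Q w z / q w) else 0) + ennreal (Q w z / q w) * (\<Sum>m<k. first_hit x m z)
        \<le> ennreal (Q w z / q w)"
        using mult_left_mono[OF Suc.IH[of z], of "ennreal (Q w z / q w)"] by auto
    qed
    also have "\<dots> = ennreal (\<Sum>z\<in>targets w. Q w z / q w)"
      using q by (intro sum_ennreal) (auto dest: rate_pos intro: less_imp_le)
    also have "(\<Sum>z\<in>targets w. Q w z / q w) = 1"
      using q by (simp add: sum_divide_distrib[symmetric] exit_rate_eq[symmetric])
    finally show ?thesis by simp
  qed
qed simp

lemma exit_rate_first_hit_0: "ennreal (q w) * first_hit x 0 w = (if w = x then 0 else ennreal (Q w x))"
proof (cases "w = x \<or> q w = 0")
  case True
  then have "w = x \<or> Q w x = 0" using exit_rate_zero_iff[of w] by (auto simp: targets_def)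
  with True show ?thesis by auto
next
  case False
  then show ?thesis using exit_rate_nonneg[of w] rate_nonneg[of w x] by (simp add: ennreal_mult'[symmetric])
qed

lemma exit_rate_first_hit_Suc:
  "ennreal (q w) * first_hit x (Suc m) w = (if w = x then 0 else \<Sum>z\<in>targets w. ennreal (Q w z) * first_hit x m z)"
proof (cases "q w = 0")
  case True
  then show ?thesis by (simp add: exit_rate_zero_iff)
next
  case False
  then have "ennreal (q w) * ennreal (Q w z / q w) = ennreal (Q w z)" if "z \<in> targets w" for z
    using rate_pos[OF that] by (simp add: ennreal_mult'[symmetric])
  then show ?thesis by (auto simp: sum_distrib_left mult.assoc[symmetric] intro!: sum.cong)
qed

text \<open>Summing over all states instead of \<open>targets w\<close> lets the two ends of a
  transition be interchanged by Tonelli's theorem.\<close>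

lemma nn_integral_targets:
  "(\<Sum>z\<in>targets w. ennreal (Q w z) * h z) =
    (\<integral>\<^sup>+z. (if z = w then 0 else ennreal (Q w z) * h z) \<partial>count_space UNIV)"
  by (subst nn_integral_count_space'[of "targets w"]) (auto simp: targets_def finite_targets intro!: sum.cong)

text \<open>The jump chain killed at \<open>x\<close> is self-adjoint with respect to the weights \<open>\<pi> w * q w\<close>; this turns
  the expected length of an excursion from \<open>x\<close> into a mean of hitting probabilities.\<close>

lemma excursion_adjoint:
  "(\<integral>\<^sup>+w. ennreal (\<pi> w) * (ennreal (q w) * (first_hit x j w * avoid_mean {x} (Suc m) w)) \<partial>count_space UNIV) =
   (\<integral>\<^sup>+w. ennreal (\<pi> w) * (ennreal (q w) * (first_hit x (Suc j) w * avoid_mean {x} m w)) \<partial>count_space UNIV)"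
proof -
  let ?I = "\<lambda>w z. if z = w then 0 else ennreal (\<pi> w) * ennreal (Q w z) * first_hit x j w * avoid_mean {x} m z"
  have "(\<integral>\<^sup>+w. ennreal (\<pi> w) * (ennreal (q w) * (first_hit x j w * avoid_mean {x} (Suc m) w)) \<partial>count_space UNIV) =
    (\<integral>\<^sup>+w. \<integral>\<^sup>+z. ?I w z \<partial>count_space UNIV \<partial>count_space UNIV)"
  proof (intro nn_integral_cong)
    fix w
    have "ennreal (\<pi> w) * (ennreal (q w) * (first_hit x j w * avoid_mean {x} (Suc m) w)) =
      ennreal (\<pi> w) * first_hit x j w * (ennreal (q w) * avoid_mean {x} (Suc m) w)" by (simp add: ac_simps)
    also have "\<dots> = ennreal (\<pi> w) * first_hit x j w * (\<Sum>z\<in>targets w. ennreal (Q w z) * avoid_mean {x} m z)"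
      unfolding avoid_mean_Suc by simp
    also have "\<dots> = (\<integral>\<^sup>+z. ?I w z \<partial>count_space UNIV)"
      unfolding nn_integral_targets
      by (subst nn_integral_cmult[symmetric]) (auto intro!: nn_integral_cong simp: ac_simps)
    finally show "ennreal (\<pi> w) * (ennreal (q w) * (first_hit x j w * avoid_mean {x} (Suc m) w)) =
      (\<integral>\<^sup>+z. ?I w z \<partial>count_space UNIV)" .
  qed
  also have "\<dots> = (\<integral>\<^sup>+z. \<integral>\<^sup>+w. ?I w z \<partial>count_space UNIV \<partial>count_space UNIV)"
    by (rule nn_integral_count_space_nn_integral[OF countable_states]) simp
  also have "\<dots> = (\<integral>\<^sup>+w. ennreal (\<pi> w) * (ennreal (q w) * (first_hit x (Suc j) w * avoid_mean {x} m w)) \<partial>count_space UNIV)"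
  proof (intro nn_integral_cong)
    fix z
    have "ennreal (\<pi> z) * (ennreal (q z) * (first_hit x (Suc j) z * avoid_mean {x} m z)) =
      ennreal (\<pi> z) * avoid_mean {x} m z * (ennreal (q z) * first_hit x (Suc j) z)" by (simp add: ac_simps)
    also have "\<dots> = ennreal (\<pi> z) * avoid_mean {x} m z * (\<Sum>w\<in>targets z. ennreal (Q z w) * first_hit x j w)"
      unfolding exit_rate_first_hit_Suc by (auto simp: avoid_mean_in)
    also have "\<dots> = (\<integral>\<^sup>+w. (if w = z then 0 else (ennreal (\<pi> z) * ennreal (Q z w)) * (first_hit x j w * avoid_mean {x} m z))
      \<partial>count_space UNIV)"
      unfolding nn_integral_targets
      by (subst nn_integral_cmult[symmetric]) (auto intro!: nn_integral_cong simp: ac_simps)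
    also have "\<dots> = (\<integral>\<^sup>+w. ?I w z \<partial>count_space UNIV)"
      by (intro nn_integral_cong) (auto simp: detailed_balance_ennreal[of z] mult.assoc)
    finally show "(\<integral>\<^sup>+w. ?I w z \<partial>count_space UNIV) = ennreal (\<pi> z) * (ennreal (q z) * (first_hit x (Suc j) z * avoid_mean {x} m z))" ..
  qed
  finally show ?thesis .
qed

text \<open>Each use of \<open>excursion_adjoint\<close> moves one step from
  \<open>avoid_mean\<close> to \<open>first_hit\<close>; after \<open>m\<close> of them only a
  single holding time is left, and the factor \<open>q w\<close> compensates its mean.\<close>

lemma excursion_sum:
  "ennreal (\<pi> x) * (\<Sum>z\<in>targets x. ennreal (Q x z) * avoid_mean {x} m z) \<le>
    (\<integral>\<^sup>+w. ennreal (\<pi> w) * first_hit x m w \<partial>count_space UNIV)"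
proof -
  have shift: "(\<integral>\<^sup>+w. ennreal (\<pi> w) * (ennreal (q w) * (first_hit x 0 w * avoid_mean {x} m w)) \<partial>count_space UNIV) =
    (\<integral>\<^sup>+w. ennreal (\<pi> w) * (ennreal (q w) * (first_hit x k w * avoid_mean {x} (m - k) w)) \<partial>count_space UNIV)"
    if "k \<le> m" for k
    using that
  proof (induction k)
    case (Suc k)
    then have "m - k = Suc (m - Suc k)" by simp
    then show ?case using Suc excursion_adjoint[of x k "m - Suc k"] by simp
  qed simp
  have "ennreal (\<pi> x) * (\<Sum>z\<in>targets x. ennreal (Q x z) * avoid_mean {x} m z) =
    (\<integral>\<^sup>+z. ennreal (\<pi> x) * (if z = x then 0 else ennreal (Q x z) * avoid_mean {x} m z) \<partial>count_space UNIV)"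
    unfolding nn_integral_targets by (subst nn_integral_cmult) auto
  also have "\<dots> = (\<integral>\<^sup>+w. ennreal (\<pi> w) * ((ennreal (q w) * first_hit x 0 w) * avoid_mean {x} m w) \<partial>count_space UNIV)"
    unfolding exit_rate_first_hit_0
    by (intro nn_integral_cong) (auto simp: detailed_balance_ennreal[of x] mult.assoc[symmetric])
  also have "\<dots> = (\<integral>\<^sup>+w. ennreal (\<pi> w) * (ennreal (q w) * (first_hit x m w * avoid_mean {x} 0 w)) \<partial>count_space UNIV)"
    using shift[of m] by (simp only: mult.assoc order_refl diff_self_eq_0)
  also have "\<dots> \<le> (\<integral>\<^sup>+w. ennreal (\<pi> w) * first_hit x m w \<partial>count_space UNIV)"
  proof (intro nn_integral_mono mult_left_mono)
    fix w
    have "ennreal (q w) * (first_hit x m w * avoid_mean {x} 0 w) =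
      first_hit x m w * (ennreal (q w) * avoid_mean {x} 0 w)" by (simp add: ac_simps)
    also have "\<dots> \<le> first_hit x m w" unfolding avoid_mean_0 by auto
    finally show "ennreal (q w) * (first_hit x m w * avoid_mean {x} 0 w) \<le> first_hit x m w" .
  qed simp
  finally show ?thesis .
qed

text \<open>Over all \<open>m\<close> the values \<open>first_hit x m w\<close> add up to at most 1,
  so the time spent after the initial holding period has, multiplied by
  \<open>\<pi> x * q x\<close>, a mean of at most the total mass of \<open>\<pi>\<close>. The
  initial period has the finite mean \<open>1 / q x\<close>.\<close>

theorem positive_recurrent:
  assumes x: "x \<in> S" "0 < \<pi> x"
  shows "positive_recurrent_state Q x"
proof (cases "q x = 0")
  case True
  then show ?thesis by (simp add: positive_recurrent_state_def)
next
  case False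
  then have q: "0 < q x" by (simp add: less_le)
  have "AE \<omega> in N. (\<Sum>m. holding_time Q x \<omega> m) = \<infinity>"
    using nonexplosive x by (simp add: nonexplosive_def)
  then have "AE \<omega> in N. return_time Q x \<omega> \<le> avoid_time 1 {x} x \<omega>"
    using AE_noise_positive by eventually_elim (rule return_time_le_avoid_time)
  then have "(\<integral>\<^sup>+\<omega>. return_time Q x \<omega> \<partial>N) \<le> (\<integral>\<^sup>+\<omega>. avoid_time 1 {x} x \<omega> \<partial>N)"
    by (rule nn_integral_mono_AE)
  also have "\<dots> = (\<Sum>m. \<integral>\<^sup>+\<omega>. avoid_term 1 {x} x m \<omega> \<partial>N)"
    unfolding avoid_time_def by (rule nn_integral_suminf) measurable
  also have "\<dots> = (\<integral>\<^sup>+\<omega>. avoid_term 1 {x} x 0 \<omega> \<partial>N) + (\<Sum>m. \<integral>\<^sup>+\<omega>. avoid_term 1 {x} x (Suc m) \<omega> \<partial>N)"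
    using suminf_offset[of "\<lambda>m. \<integral>\<^sup>+\<omega>. avoid_term 1 {x} x m \<omega> \<partial>N" 1] by simp
  finally have le: "(\<integral>\<^sup>+\<omega>. return_time Q x \<omega> \<partial>N) \<le>
    (\<integral>\<^sup>+\<omega>. avoid_term 1 {x} x 0 \<omega> \<partial>N) + (\<Sum>m. \<integral>\<^sup>+\<omega>. avoid_term 1 {x} x (Suc m) \<omega> \<partial>N)" .
  have first: "(\<integral>\<^sup>+\<omega>. avoid_term 1 {x} x 0 \<omega> \<partial>N) < \<infinity>"
    using nn_integral_first_holding_time[OF q] by (simp add: avoid_term_def)
  have "ennreal (\<pi> x) * (ennreal (q x) * (\<Sum>m. \<integral>\<^sup>+\<omega>. avoid_term 1 {x} x (Suc m) \<omega> \<partial>N)) =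
    (\<Sum>m. ennreal (\<pi> x) * (\<Sum>z\<in>targets x. ennreal (Q x z) * avoid_mean {x} m z))"
    by (simp add: ennreal_suminf_cmult[symmetric] nn_integral_avoid_term_Suc[OF q] del: ennreal_suminf_cmult One_nat_def)
  also have "\<dots> \<le> (\<Sum>m. \<integral>\<^sup>+w. ennreal (\<pi> w) * first_hit x m w \<partial>count_space UNIV)"
    by (intro suminf_le excursion_sum) auto
  also have "\<dots> = (\<integral>\<^sup>+w. (\<Sum>m. ennreal (\<pi> w) * first_hit x m w) \<partial>count_space UNIV)"
    by (rule nn_integral_suminf[symmetric]) simp
  also have "\<dots> \<le> (\<integral>\<^sup>+w. ennreal (\<pi> w) \<partial>count_space UNIV)"
  proof (intro nn_integral_mono)
    fix w
    have "(\<Sum>m. first_hit x m w) \<le> 1"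
      by (rule suminf_le_const) (auto simp: sum_first_hit_le)
    from mult_left_mono[OF this, of "ennreal (\<pi> w)"]
    show "(\<Sum>m. ennreal (\<pi> w) * first_hit x m w) \<le> ennreal (\<pi> w)" by simp
  qed
  also have "\<dots> = (\<integral>\<^sup>+w. ennreal (\<pi> w) \<partial>count_space S)"
    by (rule nn_integral_count_space_eq) (auto simp: pi_outside)
  also have "\<dots> = ennreal 1"
    using pi_sum by (subst (asm) has_sum_iff_nn_integral_count_space) (auto simp: pi_nonneg)
  finally have "ennreal (\<pi> x) * (ennreal (q x) * (\<Sum>m. \<integral>\<^sup>+\<omega>. avoid_term 1 {x} x (Suc m) \<omega> \<partial>N)) < \<infinity>"
    by (rule order_le_less_trans) simp
  then have "(\<Sum>m. \<integral>\<^sup>+\<omega>. avoid_term 1 {x} x (Suc m) \<omega> \<partial>N) < \<infinity>"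
    using q x by (auto simp: ennreal_mult_less_top)
  with first have "(\<integral>\<^sup>+\<omega>. return_time Q x \<omega> \<partial>N) < \<infinity>"
    by (intro order_le_less_trans[OF le]) simp
  then show ?thesis by (simp add: positive_recurrent_state_def)
qed

end

section \<open>The network\<close>

lemma leads_to_step: "x \<noteq> y \<Longrightarrow> 0 < Q x y \<Longrightarrow> leads_to Q x y"
  unfolding leads_to_def by blast

lemma leads_to_trans: "leads_to Q x y \<Longrightarrow> leads_to Q y z \<Longrightarrow> leads_to Q x z"
  unfolding leads_to_def by (rule rtranclp_trans)

context reversible_generator
begin

text \<open>By detailed balance a positive flow along a transition is also the flow of its reverse,
  which needs positive weight at the other end.\<close>

lemma positive_closed:
  assumes "leads_to Q x y" "0 < \<pi> x"
  shows "0 < \<pi> y"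
  using assms unfolding leads_to_def
proof (induction rule: rtranclp_induct)
  case (step y z)
  then have "0 < \<pi> z * Q z y" by (metis detailed_balance mult_pos_pos)
  then show ?case using pi_nonneg[of z] by (auto simp: zero_less_mult_iff)
qed

text \<open>Recurrence inside \<open>C\<close> is a matter of detailed balance; the drift condition
  serves only the states from which \<open>C\<close> has yet to be entered.\<close>

theorem positive_recurrent_process_hitting:
  assumes C: "C = {x \<in> S. 0 < \<pi> x}" "C \<noteq> {}"
    and irr: "\<And>x y. x \<in> C \<Longrightarrow> y \<in> C \<Longrightarrow> leads_to Q x y"
    and V: "\<And>x. x \<in> S \<Longrightarrow> 0 \<le> V x" and c: "0 < c"
    and drift: "\<And>x. x \<in> S - C \<Longrightarrow> (\<Sum>y\<in>targets x. Q x y * V y) + c \<le> q x * V x"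
  shows "positive_recurrent_process Q S C"
  unfolding positive_recurrent_process_def
proof (intro conjI ballI)
  show "C \<noteq> {}" "C \<subseteq> S" using C by auto
  show "{y. leads_to Q x y} = C" if "x \<in> C" for x
  proof (intro equalityI subsetI)
    fix y assume "y \<in> {y. leads_to Q x y}"
    then have "0 < \<pi> y" using positive_closed[of x y] that C by auto
    moreover then have "y \<in> S" using pi_outside[of y] by force
    ultimately show "y \<in> C" using C by simp
  qed (use irr that in auto)
  show "positive_recurrent_state Q x" if "x \<in> C" for x
    using positive_recurrent[of x] that C by auto
  show "AE \<omega> in noise_measure Q. \<exists>t\<ge>0. process Q x t \<omega> \<in> Some ` C" if "x \<in> S" for x
    by (rule lyapunov_hitting[where V = V and c = c, OF targets_closed nonexplosive V c drift that])
qed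

end

text \<open>Index sets that depend on the configuration become conditions under sums over all pairs
  of sites, so that a transition and its reverse can be compared by \<open>sum.swap\<close>.\<close>

lemma sum_sum_UNIV:
  fixes g :: "'i::finite \<Rightarrow> 'j::finite \<Rightarrow> 'c::comm_monoid_add"
  shows "(\<Sum>i\<in>A. \<Sum>j\<in>B i. g i j) = (\<Sum>i\<in>UNIV. \<Sum>j\<in>UNIV. if i \<in> A \<and> j \<in> B i then g i j else 0)"
proof -
  have "(\<Sum>i\<in>A. \<Sum>j\<in>B i. g i j) = (\<Sum>i\<in>UNIV. if i \<in> A then \<Sum>j\<in>B i. g i j else 0)"
    by (simp add: sum.If_cases)
  also have "\<dots> = (\<Sum>i\<in>UNIV. \<Sum>j\<in>UNIV. if i \<in> A \<and> j \<in> B i then g i j else 0)"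
    by (intro sum.cong refl) (auto simp: sum.If_cases)
  finally show ?thesis .
qed

lemma prod_fun_upd:
  fixes f :: "'i::finite \<Rightarrow> 'b \<Rightarrow> 'c::comm_monoid_mult"
  shows "(\<Prod>i\<in>UNIV. f i ((g(p := v)) i)) = f p v * (\<Prod>i\<in>UNIV - {p}. f i (g i))"
proof -
  have "(\<Prod>i\<in>UNIV. f i ((g(p := v)) i)) = f p v * (\<Prod>i\<in>UNIV - {p}. f i ((g(p := v)) i))"
    by (subst prod.remove[of UNIV p]) auto
  also have "(\<Prod>i\<in>UNIV - {p}. f i ((g(p := v)) i)) = (\<Prod>i\<in>UNIV - {p}. f i (g i))"
    by (intro prod.cong) auto
  finally show ?thesis .
qed

locale task_network =
  fixes lam mu :: "'s::finite \<Rightarrow> nat \<Rightarrow> 's set \<Rightarrow> real"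
    and gam :: "'s \<Rightarrow> nat \<Rightarrow> real"
    and beta theta eps :: "'s \<Rightarrow> 's \<Rightarrow> nat \<Rightarrow> nat \<Rightarrow> 's set \<Rightarrow> real"
    and tau :: "'s \<Rightarrow> 's \<Rightarrow> ('s \<Rightarrow> nat) \<Rightarrow> 's set \<Rightarrow> real"
    and M :: nat
  assumes M_le: "M \<le> CARD('s)"
    and lam_nonneg: "\<And>i n y. 0 \<le> lam i n y"
    and lam_sup: "\<exists>C. \<forall>i n y. lam i n y \<le> C"
    and mu_inf: "\<exists>c>0. \<forall>i n y. n \<ge> 1 \<longrightarrow> c \<le> mu i n y"
    and lam_support: "\<And>i n y. lam i (n + 1) y > 0 \<Longrightarrow> lam i n y > 0"
    and gam_nonneg: "\<And>i n. 0 \<le> gam i n"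
    and gam_support: "\<And>i n. gam i (n + 1) > 0 \<Longrightarrow> gam i n > 0"
    and gam_bar_pos: "\<And>y j j' m. card y = M \<Longrightarrow> j \<in> y \<Longrightarrow> j' \<notin> y \<Longrightarrow> gam_bar gam j m > 0"
    and beta_pos: "\<And>k l a b y. k \<noteq> l \<Longrightarrow> k \<notin> y \<Longrightarrow> l \<notin> y \<Longrightarrow> beta k l a b y > 0"
    and theta_pos: "\<And>j k a b y. j \<in> y \<Longrightarrow> k \<notin> y \<Longrightarrow> theta j k a b y > 0 \<and> theta k j a b y > 0"
    and eps_pos: "\<And>i j a b y. i \<noteq> j \<Longrightarrow> i \<in> y \<Longrightarrow> j \<in> y \<Longrightarrow> eps i j a b y > 0"
    and tau_pos: "\<And>j j' n y. j \<in> y \<Longrightarrow> j' \<notin> y \<Longrightarrow> tau j j' n y > 0"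
    and beta_balance: "\<And>k l a b y. k \<noteq> l \<Longrightarrow> k \<notin> y \<Longrightarrow> l \<notin> y \<Longrightarrow> a \<ge> 1 \<Longrightarrow>
        lam k (a - 1) y / mu k a y * beta k l a b y =
        lam l b y / mu l (b + 1) y * beta l k (b + 1) (a - 1) y"
    and theta_balance: "\<And>j k a b y. j \<in> y \<Longrightarrow> k \<notin> y \<Longrightarrow> a \<ge> 1 \<Longrightarrow>
        lam j (a - 1) y / mu j a y * theta j k a b y =
        lam k b y / mu k (b + 1) y * theta k j (b + 1) (a - 1) y"
    and eps_balance: "\<And>i j a b y. i \<noteq> j \<Longrightarrow> i \<in> y \<Longrightarrow> j \<in> y \<Longrightarrow> a \<ge> 1 \<Longrightarrow>
        lam i (a - 1) y * gam i (a - 1) / mu i a y * eps i j a b y =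
        lam j b y * gam j b / mu j (b + 1) y * eps j i (b + 1) (a - 1) y"
    and tau_balance: "\<And>j j' n y. j \<in> y \<Longrightarrow> j' \<notin> y \<Longrightarrow>
        tau j j' n y * (\<Prod>q\<in>UNIV. lam_bar lam q (n q) y / mu_bar mu q (n q) y) =
        tau j' j n (move_customer j j' y) *
          (\<Prod>q\<in>UNIV. lam_bar lam q (n q) (move_customer j j' y) /
                      mu_bar mu q (n q) (move_customer j j' y))"
    and U_finite: "\<And>y l. card y = M \<Longrightarrow> l \<notin> y \<Longrightarrow>
        summable (\<lambda>n. lam_bar lam l n y / mu_bar mu l n y)"
    and L_finite: "\<And>y j. card y = M \<Longrightarrow> j \<in> y \<Longrightarrow>
        summable (\<lambda>n. lam_bar lam j n y * gam_bar gam j n / mu_bar mu j n y)"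
begin

section \<open>Product weights of the network\<close>

abbreviation "r \<equiv> rate lam mu gam beta theta eps tau"
abbreviation "R \<equiv> generator lam mu gam beta theta eps tau"
abbreviation "eqm \<equiv> equilibrium lam mu gam M"

lemma mu_pos: "1 \<le> n \<Longrightarrow> 0 < mu i n y"
  using mu_inf by (meson less_le_trans)

lemma gam_bar_nonneg: "0 \<le> gam_bar gam i n"
  by (simp add: gam_bar_def prod_nonneg gam_nonneg)

lemma lam_bar_nonneg: "0 \<le> lam_bar lam i n y"
  by (simp add: lam_bar_def prod_nonneg lam_nonneg)

lemma mu_bar_pos: "0 < mu_bar mu i n y"
  unfolding mu_bar_def by (rule prod_pos) (simp add: mu_pos)

definition arrival :: "'s \<Rightarrow> nat \<Rightarrow> 's set \<Rightarrow> real" where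
  "arrival p m y = lam p m y * gam p m ^ (if p \<in> y then 1 else 0)"

text \<open>The invariant weight of a birth and death chain at one site, with birth rates
  \<open>arrival\<close> and death rates \<open>mu\<close>. Attaching \<open>gam_bar\<close> to the
  occupied sites here makes one product over all sites out of the two in
  \<open>equilibrium\<close>.\<close>

definition weight :: "'s \<Rightarrow> nat \<Rightarrow> 's set \<Rightarrow> real" where
  "weight p m y = lam_bar lam p m y * (if p \<in> y then gam_bar gam p m else 1) / mu_bar mu p m y"

lemma arrival_nonneg: "0 \<le> arrival p m y"
  by (simp add: arrival_def lam_nonneg gam_nonneg)

lemma weight_nonneg: "0 \<le> weight p m y"
  using mu_bar_pos[of p m y] by (simp add: weight_def lam_bar_nonneg gam_bar_nonneg)

lemma weight_0 [simp]: "weight p 0 y = 1"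
  by (simp add: weight_def lam_bar_def gam_bar_def mu_bar_def)

lemma weight_Suc: "weight p (Suc m) y = weight p m y * arrival p m y / mu p (Suc m) y"
  by (simp add: weight_def arrival_def lam_bar_def gam_bar_def mu_bar_def)

lemma weight_pred: "1 \<le> m \<Longrightarrow> weight p m y = weight p (m - 1) y * arrival p (m - 1) y / mu p m y"
  using weight_Suc[of p "m - 1" y] by simp

definition W :: "'s set \<Rightarrow> ('s \<Rightarrow> nat) \<Rightarrow> real" where
  "W y n = (\<Prod>q\<in>UNIV. weight q (n q) y)"

lemma W_eq: "W y n = (\<Prod>q\<in>UNIV. lam_bar lam q (n q) y / mu_bar mu q (n q) y) * (\<Prod>j\<in>y. gam_bar gam j (n j))"
proof -
  have "W y n = (\<Prod>q\<in>UNIV. lam_bar lam q (n q) y / mu_bar mu q (n q) y * (if q \<in> y then gam_bar gam q (n q) else 1))"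
    unfolding W_def weight_def by (intro prod.cong) auto
  also have "\<dots> = (\<Prod>q\<in>UNIV. lam_bar lam q (n q) y / mu_bar mu q (n q) y) *
    (\<Prod>q\<in>UNIV. if q \<in> y then gam_bar gam q (n q) else 1)"
    by (rule prod.distrib)
  also have "(\<Prod>q\<in>UNIV. if q \<in> y then gam_bar gam q (n q) else 1) = (\<Prod>j\<in>y. gam_bar gam j (n j))"
    by (simp add: prod.If_cases)
  finally show ?thesis .
qed

lemma eqm_eq: "eqm (y, n) = (if card y = M then 1 else 0) / Xi lam mu gam M * W y n"
  by (simp add: equilibrium_def W_eq)

lemma W_nonneg: "0 \<le> W y n"
  by (simp add: W_def prod_nonneg weight_nonneg)

lemma W_upd: "W y (n(p := m)) = weight p m y * (\<Prod>q\<in>UNIV - {p}. weight q (n q) y)"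
  unfolding W_def by (rule prod_fun_upd[of "\<lambda>q m. weight q m y"])

lemma W_arrival: "W y n * arrival p (n p) y = W y (n(p := n p + 1)) * mu p (n p + 1) y"
proof -
  have "W y n = weight p (n p) y * (\<Prod>q\<in>UNIV - {p}. weight q (n q) y)"
    using W_upd[of y n p "n p"] by simp
  then show ?thesis
    using mu_pos[of "Suc (n p)" p y] by (simp add: W_upd weight_Suc)
qed

text \<open>Compared with the configuration from which one task at \<open>k\<close> is taken away,
  each of the two states carries one more factor of the form \<open>arrival / mu\<close>, and
  \<open>balance\<close> relates exactly these factors.\<close>

lemma W_move:
  assumes kl: "k \<noteq> l" and nk: "1 \<le> n k"
    and balance: "arrival k (n k - 1) y / mu k (n k) y * a = arrival l (n l) y / mu l (n l + 1) y * b"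
  shows "W y n * a = W y (move_task k l n) * b"
proof -
  let ?P = "\<Prod>q\<in>UNIV - {k} - {l}. weight q (n q) y"
  have two: "W y n' = weight k (n' k) y * (weight l (n' l) y * (\<Prod>q\<in>UNIV - {k} - {l}. weight q (n' q) y))" for n'
    unfolding W_def using kl by (subst prod.remove[of UNIV k], simp, simp, subst prod.remove[of "UNIV - {k}" l]) auto
  have "(\<Prod>q\<in>UNIV - {k} - {l}. weight q (move_task k l n q) y) = ?P"
    by (intro prod.cong) (auto simp: move_task_def)
  then have "W y (move_task k l n) = weight k (n k - 1) y * (weight l (n l + 1) y * ?P)"
    using two[of "move_task k l n"] kl by (simp add: move_task_def)
  then have "W y (move_task k l n) * b = weight k (n k - 1) y * weight l (n l) y * ?P * (arrival l (n l) y / mu l (n l + 1) y * b)"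
    by (simp add: weight_Suc)
  also have "\<dots> = weight k (n k - 1) y * weight l (n l) y * ?P * (arrival k (n k - 1) y / mu k (n k) y * a)"
    unfolding balance ..
  also have "\<dots> = W y n * a"
    unfolding two[of n] weight_pred[OF nk] by simp
  finally show ?thesis ..
qed

lemma card_move_customer: "j \<in> y \<Longrightarrow> j' \<notin> y \<Longrightarrow> card (move_customer j j' y) = card (y :: 's set)"
  using card.remove[of y j] by (simp add: move_customer_def)

text \<open>The inverse of \<open>gam_bar\<close> in the rate cancels the factor which the leaving
  customer contributes to the weight; what is left is the product over \<open>y - {j}\<close>,
  common to both sides, and \<open>tau_balance\<close>.\<close>

lemma W_customer:
  assumes "card y = M" "j \<in> y" "j' \<notin> y"
  shows "W y n * (inverse (gam_bar gam j (n j)) * tau j j' n y) =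
    W (move_customer j j' y) n * (inverse (gam_bar gam j' (n j')) * tau j' j n (move_customer j j' y))"
proof -
  let ?y = "move_customer j j' y"
  have card: "card ?y = M" using assms by (simp add: card_move_customer)
  have j: "j \<noteq> j'" "j \<notin> ?y" "j' \<in> ?y" using assms by (auto simp: move_customer_def)
  have g: "gam_bar gam j (n j) > 0" "gam_bar gam j' (n j') > 0"
    using gam_bar_pos[OF assms] gam_bar_pos[OF card j(3,2)] by auto
  have "(\<Prod>i\<in>y. gam_bar gam i (n i)) = gam_bar gam j (n j) * (\<Prod>i\<in>y - {j}. gam_bar gam i (n i))"
    using assms by (intro prod.remove) auto
  moreover have "(\<Prod>i\<in>?y. gam_bar gam i (n i)) = gam_bar gam j' (n j') * (\<Prod>i\<in>y - {j}. gam_bar gam i (n i))"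
    using assms unfolding move_customer_def by (subst prod.insert) auto
  ultimately show ?thesis
    unfolding W_eq using tau_balance[OF assms(2,3), of n] g by (simp add: field_simps)
qed

section \<open>The rates by kind of transition\<close>

definition arrivals :: "'s state \<Rightarrow> 's state \<Rightarrow> real" where
  "arrivals x x' = (\<Sum>p\<in>UNIV. if fst x' = fst x \<and> snd x' = (snd x)(p := snd x p + 1)
    then arrival p (snd x p) (fst x) else 0)"

definition departures :: "'s state \<Rightarrow> 's state \<Rightarrow> real" where
  "departures x x' = (\<Sum>p\<in>UNIV. if fst x' = fst x \<and> snd x' = (snd x)(p := snd x p - 1) \<and> 1 \<le> snd x p
    then mu p (snd x p) (fst x) else 0)"

text \<open>One form for the four kinds of task moves. The predicate \<open>A\<close> selects the
  admissible pairs of sites, and reversing a move exchanges \<open>k\<close> and \<open>l\<close>: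
  \<open>bpair\<close> and \<open>epair\<close> are symmetric, while \<open>opair\<close> and
  \<open>ipair\<close> are converse to each other.\<close>

definition moves :: "('s \<Rightarrow> 's \<Rightarrow> 's set \<Rightarrow> bool) \<Rightarrow> ('s \<Rightarrow> 's \<Rightarrow> nat \<Rightarrow> nat \<Rightarrow> 's set \<Rightarrow> real) \<Rightarrow>
    's state \<Rightarrow> 's state \<Rightarrow> real" where
  "moves A f x x' = (\<Sum>k\<in>UNIV. \<Sum>l\<in>UNIV. if A k l (fst x) \<and> fst x' = fst x \<and>
      snd x' = move_task k l (snd x) \<and> 1 \<le> snd x k then f k l (snd x k) (snd x l) (fst x) else 0)"

definition customers :: "'s state \<Rightarrow> 's state \<Rightarrow> real" where
  "customers x x' = (\<Sum>j\<in>UNIV. \<Sum>j'\<in>UNIV. if j \<in> fst x \<and> j' \<notin> fst x \<and>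
      fst x' = move_customer j j' (fst x) \<and> snd x' = snd x
      then inverse (gam_bar gam j (snd x j)) * tau j j' (snd x) (fst x) else 0)"

definition "bpair k l y \<longleftrightarrow> k \<noteq> l \<and> k \<notin> y \<and> l \<notin> y"
definition "epair k l y \<longleftrightarrow> k \<noteq> l \<and> k \<in> y \<and> l \<in> y"
definition "opair k l y \<longleftrightarrow> k \<in> y \<and> l \<notin> y"
definition "ipair k l y \<longleftrightarrow> k \<notin> y \<and> l \<in> y"
definition "theta_in k j a b y = theta k j a b y * gam j b"

lemma rate_eq: "r x x' = arrivals x x' + departures x x' + moves bpair beta x x' + moves epair eps x x'
   + moves opair theta x x' + moves ipair theta_in x x' + customers x x'"
proof -
  obtain y n y' n' where x: "x = (y, n)" "x' = (y', n')" by (cases x, cases x') auto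
  have "(\<Sum>k\<in>-y. \<Sum>l\<in>-y - {k}. if y' = y \<and> n' = move_task k l n \<and> n k \<ge> 1
      then beta k l (n k) (n l) y else 0) = moves bpair beta x x'"
    unfolding x moves_def by (subst sum_sum_UNIV) (auto intro!: sum.cong simp: bpair_def)
  moreover have "(\<Sum>i\<in>y. \<Sum>j\<in>y - {i}. if y' = y \<and> n' = move_task i j n \<and> n i \<ge> 1
      then eps i j (n i) (n j) y else 0) = moves epair eps x x'"
    unfolding x moves_def by (subst sum_sum_UNIV) (auto intro!: sum.cong simp: epair_def)
  moreover have "(\<Sum>i\<in>y. \<Sum>l\<in>-y. if y' = y \<and> n' = move_task i l n \<and> n i \<ge> 1
      then theta i l (n i) (n l) y else 0) = moves opair theta x x'"
    unfolding x moves_def by (subst sum_sum_UNIV) (auto intro!: sum.cong simp: opair_def)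
  moreover have "(\<Sum>k\<in>-y. \<Sum>j\<in>y. if y' = y \<and> n' = move_task k j n \<and> n k \<ge> 1
      then theta k j (n k) (n j) y * gam j (n j) else 0) = moves ipair theta_in x x'"
    unfolding x moves_def by (subst sum_sum_UNIV) (auto intro!: sum.cong simp: ipair_def theta_in_def)
  moreover have "(\<Sum>j\<in>y. \<Sum>j'\<in>-y. if y' = move_customer j j' y \<and> n' = n
      then inverse (gam_bar gam j (n j)) * tau j j' n y else 0) = customers x x'"
    unfolding x customers_def by (subst sum_sum_UNIV) (auto intro!: sum.cong)
  moreover have "(\<Sum>p\<in>UNIV. if y' = y \<and> n' = n(p := n p + 1)
      then lam p (n p) y * gam p (n p) ^ (if p \<in> y then 1 else 0) else 0) = arrivals x x'"
    unfolding x arrivals_def arrival_def fst_conv snd_conv ..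
  moreover have "(\<Sum>p\<in>UNIV. if y' = y \<and> n' = n(p := n p - 1) \<and> n p \<ge> 1 then mu p (n p) y else 0) = departures x x'"
    unfolding x departures_def fst_conv snd_conv ..
  ultimately show ?thesis by (simp only: rate_def x Let_def prod.case)
qed

lemma arrivals_nonneg: "0 \<le> arrivals x x'"
  unfolding arrivals_def by (intro sum_nonneg) (simp add: arrival_nonneg)

lemma departures_nonneg: "0 \<le> departures x x'"
  unfolding departures_def by (intro sum_nonneg) (simp add: mu_pos less_imp_le)

lemma moves_nonneg:
  assumes "\<And>k l a b y. A k l y \<Longrightarrow> 0 \<le> f k l a b y"
  shows "0 \<le> moves A f x x'"
  unfolding moves_def by (intro sum_nonneg) (simp add: assms)

lemma all_moves_nonneg: "0 \<le> moves bpair beta x x'" "0 \<le> moves epair eps x x'"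
    "0 \<le> moves opair theta x x'" "0 \<le> moves ipair theta_in x x'"
  using beta_pos eps_pos theta_pos gam_nonneg
  by (auto intro!: moves_nonneg mult_nonneg_nonneg
      simp: bpair_def epair_def opair_def ipair_def theta_in_def less_imp_le)

lemma customers_nonneg: "0 \<le> customers x x'"
  unfolding customers_def by (intro sum_nonneg) (simp add: gam_bar_nonneg tau_pos less_imp_le)

lemmas parts_nonneg = arrivals_nonneg departures_nonneg all_moves_nonneg customers_nonneg

lemma rate_nonneg: "0 \<le> r x x'"
  unfolding rate_eq by (intro add_nonneg_nonneg parts_nonneg)

lemma arrivals_nonzero:
  assumes "arrivals x x' \<noteq> 0"
  obtains p where "fst x' = fst x" "snd x' = (snd x)(p := snd x p + 1)" "arrival p (snd x p) (fst x) \<noteq> 0"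
  using assms unfolding arrivals_def by (auto elim!: sum.not_neutral_contains_not_neutral split: if_splits)

lemma departures_nonzero:
  assumes "departures x x' \<noteq> 0"
  obtains p where "fst x' = fst x" "snd x' = (snd x)(p := snd x p - 1)" "1 \<le> snd x p"
  using assms unfolding departures_def by (auto elim!: sum.not_neutral_contains_not_neutral split: if_splits)

lemma moves_nonzero:
  assumes "moves A f x x' \<noteq> 0"
  obtains k l where "fst x' = fst x" "snd x' = move_task k l (snd x)" "1 \<le> snd x k" "A k l (fst x)"
  using assms unfolding moves_def by (auto elim!: sum.not_neutral_contains_not_neutral split: if_splits)

lemma customers_nonzero:
  assumes "customers x x' \<noteq> 0"
  obtains j j' where "snd x' = snd x" "fst x' = move_customer j j' (fst x)" "j \<in> fst x" "j' \<notin> fst x"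
  using assms unfolding customers_def by (auto elim!: sum.not_neutral_contains_not_neutral split: if_splits)

definition total :: "'s state \<Rightarrow> nat" where "total x = (\<Sum>p\<in>UNIV. snd x p)"

lemma total_upd: "total (y, n(p := m)) + n p = total (y, n) + m"
proof -
  have "total (y, n(p := m)) = m + (\<Sum>q\<in>UNIV - {p}. n q)"
    unfolding total_def by (subst sum.remove[of UNIV p]) (auto intro!: sum.cong)
  moreover have "total (y, n) = n p + (\<Sum>q\<in>UNIV - {p}. n q)"
    unfolding total_def by (subst sum.remove[of UNIV p]) auto
  ultimately show ?thesis by simp
qed

lemma total_arrivals: "arrivals x x' \<noteq> 0 \<Longrightarrow> total x' = Suc (total x)"
proof (erule arrivals_nonzero)
  fix p assume "fst x' = fst x" "snd x' = (snd x)(p := snd x p + 1)"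
  then show "total x' = Suc (total x)"
    using total_upd[of "fst x" "snd x" p "snd x p + 1"] by (simp add: total_def)
qed

lemma total_departures: "departures x x' \<noteq> 0 \<Longrightarrow> Suc (total x') = total x"
proof (erule departures_nonzero)
  fix p assume "fst x' = fst x" "snd x' = (snd x)(p := snd x p - 1)" "1 \<le> snd x p"
  then show "Suc (total x') = total x"
    using total_upd[of "fst x" "snd x" p "snd x p - 1"] by (simp add: total_def)
qed

lemma total_move_task:
  assumes "k \<noteq> l" "1 \<le> n k"
  shows "total (y, move_task k l n) = total (y, n)"
  using total_upd[of y "n(k := n k - 1)" l "n l + 1"] total_upd[of y n k "n k - 1"] assms
  by (simp add: move_task_def)

lemma total_moves: "moves A f x x' \<noteq> 0 \<Longrightarrow> (\<And>k l. A k l (fst x) \<Longrightarrow> k \<noteq> l) \<Longrightarrow> total x' = total x"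
  by (erule moves_nonzero) (use total_move_task[of _ _ "snd x" "fst x"] in \<open>simp add: total_def\<close>)

lemma total_customers: "customers x x' \<noteq> 0 \<Longrightarrow> total x' = total x"
  by (erule customers_nonzero) (simp add: total_def)

lemmas total_all_moves = total_moves[of bpair beta] total_moves[of epair eps]
  total_moves[of opair theta] total_moves[of ipair theta_in]

text \<open>Departures lower the number of tasks, and moves of tasks or customers preserve
  it.\<close>

lemma rate_total_gt: "total x < total x' \<Longrightarrow> r x x' = arrivals x x'"
  unfolding rate_eq
  using total_departures[of x x'] total_all_moves[of x x'] total_customers[of x x']
  by (force simp: bpair_def epair_def opair_def ipair_def)

lemma rate_nonzero_cases:
  assumes "r x x' \<noteq> 0"
  shows "(\<exists>p. x' = (fst x, (snd x)(p := snd x p + 1))) \<or> (\<exists>p. x' = (fst x, (snd x)(p := snd x p - 1))) \<or>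
    (\<exists>k l. x' = (fst x, move_task k l (snd x))) \<or>
    (\<exists>j j'. j \<in> fst x \<and> j' \<notin> fst x \<and> x' = (move_customer j j' (fst x), snd x))"
proof -
  consider "arrivals x x' \<noteq> 0" | "departures x x' \<noteq> 0" | "moves bpair beta x x' \<noteq> 0" | "moves epair eps x x' \<noteq> 0"
    | "moves opair theta x x' \<noteq> 0" | "moves ipair theta_in x x' \<noteq> 0" | "customers x x' \<noteq> 0"
    using assms unfolding rate_eq by force
  then show ?thesis
    by cases (auto elim!: arrivals_nonzero departures_nonzero moves_nonzero customers_nonzero simp: prod_eq_iff)
qed

lemma rate_nonzero_card: "r x x' \<noteq> 0 \<Longrightarrow> card (fst x') = card (fst x)"
  by (drule rate_nonzero_cases) (auto simp: card_move_customer)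

lemma finite_rate: "finite {x'. r x x' \<noteq> 0}"
proof (rule finite_subset)
  let ?A = "range (\<lambda>p. (fst x, (snd x)(p := snd x p + 1)))"
  let ?D = "range (\<lambda>p. (fst x, (snd x)(p := snd x p - 1)))"
  let ?T = "range (\<lambda>p. (fst x, move_task (fst p) (snd p) (snd x)))"
  let ?C = "range (\<lambda>p. (move_customer (fst p) (snd p) (fst x), snd x))"
  show "{x'. r x x' \<noteq> 0} \<subseteq> ?A \<union> ?D \<union> ?T \<union> ?C"
  proof
    fix x' assume "x' \<in> {x'. r x x' \<noteq> 0}"
    then consider p where "x' = (fst x, (snd x)(p := snd x p + 1))" | p where "x' = (fst x, (snd x)(p := snd x p - 1))"
      | k l where "x' = (fst x, move_task k l (snd x))" | j j' where "x' = (move_customer j j' (fst x), snd x)"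
      using rate_nonzero_cases[of x x'] by (elim CollectE) metis
    then show "x' \<in> ?A \<union> ?D \<union> ?T \<union> ?C"
    proof cases
      case 1
      then have "x' \<in> ?A" by (intro range_eqI)
      then show ?thesis by (intro UnI1)
    next
      case 2
      then have "x' \<in> ?D" by (intro range_eqI)
      then show ?thesis by (rule UnI1[OF UnI1[OF UnI2]])
    next
      case (3 k l)
      then have "x' \<in> ?T" by (intro range_eqI[of _ _ "(k, l)"]) simp
      then show ?thesis by (rule UnI1[OF UnI2])
    next
      case (4 j j')
      then have "x' \<in> ?C" by (intro range_eqI[of _ _ "(j, j')"]) simp
      then show ?thesis by (rule UnI2)
    qed
  qed
qed auto

section \<open>The generator and its detailed balance\<close>

lemma generator_off: "x' \<noteq> x \<Longrightarrow> R x x' = r x x'"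
  by (simp add: generator_def)

sublocale G: generator_matrix R
proof
  show "countable (UNIV :: 's state set)"
    using countable_SIGMA[of "UNIV :: 's set set" "\<lambda>_. UNIV :: ('s \<Rightarrow> nat) set"]
    by (simp add: countable_finite)
  show "0 \<le> R x y" if "x \<noteq> y" for x y using that by (simp add: generator_off rate_nonneg)
  have T: "{y. y \<noteq> x \<and> R x y \<noteq> 0} = {y. r x y \<noteq> 0} - {x}" for x by (auto simp: generator_off)
  show "finite {y. y \<noteq> x \<and> R x y \<noteq> 0}" for x unfolding T using finite_rate[of x] by simp
  show "R x x = - (\<Sum>y | y \<noteq> x \<and> R x y \<noteq> 0. R x y)" for x
  proof -
    have "(\<Sum>\<^sub>\<infinity>z\<in>-{x}. r x z) = (\<Sum>\<^sub>\<infinity>z\<in>{y. r x y \<noteq> 0} - {x}. r x z)"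
      by (rule infsum_cong_neutral) auto
    also have "\<dots> = (\<Sum>z\<in>{y. r x y \<noteq> 0} - {x}. r x z)"
      using finite_rate[of x] by simp
    also have "\<dots> = (\<Sum>z\<in>{y. r x y \<noteq> 0} - {x}. R x z)"
      by (intro sum.cong) (auto simp: generator_off)
    finally show ?thesis unfolding T by (simp add: generator_def)
  qed
qed

text \<open>The equality holds term by term if the pair \<open>(k, l)\<close> of one sum is matched
  with \<open>(l, k)\<close> of the other; \<open>k \<noteq> l\<close> is what makes
  \<open>move_task l k\<close> undo \<open>move_task k l\<close>.\<close>

lemma moves_balance:
  assumes A: "\<And>k l y. A k l y \<longleftrightarrow> B l k y" and ne: "\<And>k l y. A k l y \<Longrightarrow> k \<noteq> l"
    and bal: "\<And>k l a b. A k l y \<Longrightarrow> 1 \<le> a \<Longrightarrow> arrival k (a - 1) y / mu k a y * f k l a b y =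
        arrival l b y / mu l (b + 1) y * g l k (b + 1) (a - 1) y"
  shows "W y n * moves A f (y, n) (y', n') = W y' n' * moves B g (y', n') (y, n)"
proof -
  have eq: "W y n * (if A k l y \<and> y' = y \<and> n' = move_task k l n \<and> 1 \<le> n k then f k l (n k) (n l) y else 0) =
    W y' n' * (if B l k y' \<and> y = y' \<and> n = move_task l k n' \<and> 1 \<le> n' l then g l k (n' l) (n' k) y' else 0)" for k l
  proof (cases "A k l y \<and> y' = y \<and> n' = move_task k l n \<and> 1 \<le> n k")
    case True
    then have kl: "k \<noteq> l" using ne by blast
    then have "n = move_task l k n'" "n' l = n l + 1" "n' k = n k - 1"
      using True by (auto simp: move_task_def fun_eq_iff)
    moreover have "W y n * f k l (n k) (n l) y = W y (move_task k l n) * g l k (n l + 1) (n k - 1) y"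
      using True by (intro W_move kl bal) auto
    ultimately show ?thesis using True A by auto
  next
    case False
    have "\<not> (B l k y' \<and> y = y' \<and> n = move_task l k n' \<and> 1 \<le> n' l)"
    proof
      assume H: "B l k y' \<and> y = y' \<and> n = move_task l k n' \<and> 1 \<le> n' l"
      then have "A k l y" using A by blast
      moreover then have kl: "k \<noteq> l" by (rule ne)
      then have "n' = move_task k l n" "1 \<le> n k"
        using H by (auto simp: move_task_def fun_eq_iff)
      ultimately show False using False H by blast
    qed
    then show ?thesis using False by auto
  qed
  have "W y n * moves A f (y, n) (y', n') = (\<Sum>k\<in>UNIV. \<Sum>l\<in>UNIV.
    W y' n' * (if B l k y' \<and> y = y' \<and> n = move_task l k n' \<and> 1 \<le> n' l then g l k (n' l) (n' k) y' else 0))"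
    unfolding moves_def sum_distrib_left fst_conv snd_conv eq ..
  also have "\<dots> = W y' n' * moves B g (y', n') (y, n)"
    unfolding moves_def sum_distrib_left fst_conv snd_conv by (rule sum.swap)
  finally show ?thesis .
qed

lemma arrivals_balance: "W y n * arrivals (y, n) (y', n') = W y' n' * departures (y', n') (y, n)"
proof -
  have "W y n * (if y' = y \<and> n' = n(p := n p + 1) then arrival p (n p) y else 0) =
    W y' n' * (if y = y' \<and> n = n'(p := n' p - 1) \<and> 1 \<le> n' p then mu p (n' p) y' else 0)" for p
  proof (cases "y' = y \<and> n' = n(p := n p + 1)")
    case True
    then show ?thesis using W_arrival[of y n p] by simp
  next
    case False
    then have "\<not> (y = y' \<and> n = n'(p := n' p - 1) \<and> 1 \<le> n' p)" by auto
    then show ?thesis unfolding if_not_P[OF False] by (simp only: if_False mult_zero_right)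
  qed
  then show ?thesis unfolding arrivals_def departures_def sum_distrib_left fst_conv snd_conv by (simp only:)
qed

lemma customers_balance:
  assumes "card y = M"
  shows "W y n * customers (y, n) (y', n') = W y' n' * customers (y', n') (y, n)"
proof -
  have eq: "W y n * (if j \<in> y \<and> j' \<notin> y \<and> y' = move_customer j j' y \<and> n' = n
      then inverse (gam_bar gam j (n j)) * tau j j' n y else 0) =
    W y' n' * (if j' \<in> y' \<and> j \<notin> y' \<and> y = move_customer j' j y' \<and> n = n'
      then inverse (gam_bar gam j' (n' j')) * tau j' j n' y' else 0)" for j j'
  proof (cases "j \<in> y \<and> j' \<notin> y \<and> y' = move_customer j j' y \<and> n' = n")
    case True
    then have "j' \<in> y' \<and> j \<notin> y' \<and> y = move_customer j' j y'" by (auto simp: move_customer_def)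
    then show ?thesis using True W_customer[OF assms, of j j' n] by auto
  next
    case False
    then have "\<not> (j' \<in> y' \<and> j \<notin> y' \<and> y = move_customer j' j y' \<and> n = n')"
      by (auto simp: move_customer_def)
    then show ?thesis using False by auto
  qed
  have "W y n * customers (y, n) (y', n') = (\<Sum>j\<in>UNIV. \<Sum>j'\<in>UNIV.
    W y' n' * (if j' \<in> y' \<and> j \<notin> y' \<and> y = move_customer j' j y' \<and> n = n'
      then inverse (gam_bar gam j' (n' j')) * tau j' j n' y' else 0))"
    unfolding customers_def sum_distrib_left fst_conv snd_conv eq ..
  also have "\<dots> = W y' n' * customers (y', n') (y, n)"
    unfolding customers_def sum_distrib_left fst_conv snd_conv by (rule sum.swap)
  finally show ?thesis .
qed

lemma all_moves_balance:
  "W y n * moves bpair beta (y, n) (y', n') = W y' n' * moves bpair beta (y', n') (y, n)"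
  "W y n * moves epair eps (y, n) (y', n') = W y' n' * moves epair eps (y', n') (y, n)"
  "W y n * moves opair theta (y, n) (y', n') = W y' n' * moves ipair theta_in (y', n') (y, n)"
proof -
  show "W y n * moves bpair beta (y, n) (y', n') = W y' n' * moves bpair beta (y', n') (y, n)"
  proof (rule moves_balance)
    show "arrival k (a - 1) y / mu k a y * beta k l a b y = arrival l b y / mu l (b + 1) y * beta l k (b + 1) (a - 1) y"
      if "bpair k l y" "1 \<le> a" for k l a b
      using beta_balance[of k l y a b] that by (simp add: bpair_def arrival_def)
  qed (auto simp: bpair_def)
  show "W y n * moves epair eps (y, n) (y', n') = W y' n' * moves epair eps (y', n') (y, n)"
  proof (rule moves_balance)
    show "arrival k (a - 1) y / mu k a y * eps k l a b y = arrival l b y / mu l (b + 1) y * eps l k (b + 1) (a - 1) y"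
      if "epair k l y" "1 \<le> a" for k l a b
      using eps_balance[of k l y a b] that by (simp add: epair_def arrival_def)
  qed (auto simp: epair_def)
  show "W y n * moves opair theta (y, n) (y', n') = W y' n' * moves ipair theta_in (y', n') (y, n)"
  proof (rule moves_balance)
    show "arrival k (a - 1) y / mu k a y * theta k l a b y = arrival l b y / mu l (b + 1) y * theta_in l k (b + 1) (a - 1) y"
      if "opair k l y" "1 \<le> a" for k l a b
      \<comment> \<open>The factor \<open>gam k (a - 1)\<close> belongs to the occupied site
        \<open>k\<close>: it completes \<open>lam\<close> to \<open>arrival\<close> on the left and
        \<open>theta\<close> to \<open>theta_in\<close> on the right.\<close>
      using arg_cong[OF theta_balance[of k y l a b], of "\<lambda>z. gam k (a - 1) * z"] that
      by (simp add: opair_def arrival_def theta_in_def ac_simps)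
  qed (auto simp: opair_def ipair_def)
qed

lemma W_rate_balance:
  assumes "card y = M"
  shows "W y n * r (y, n) (y', n') = W y' n' * r (y', n') (y, n)"
  unfolding rate_eq distrib_left
  using arrivals_balance[of y n y' n'] arrivals_balance[of y' n' y n] all_moves_balance[of y n y' n']
    all_moves_balance(3)[of y' n' y n] customers_balance[OF assms, of n y' n'] by linarith

lemma detailed_balance:
  assumes "x \<noteq> x'"
  shows "eqm x * R x x' = eqm x' * R x' x"
proof -
  obtain y n y' n' where x: "x = (y, n)" "x' = (y', n')" by (cases x, cases x') auto
  have R: "R x x' = r x x'" "R x' x = r x' x" using assms by (auto simp: generator_off)
  show ?thesis
  proof (cases "card y = M")
    case True
    show ?thesis
    proof (cases "card y' = M")
      case yes: True
      show ?thesis using W_rate_balance[OF True, of n y' n'] unfolding R unfolding x eqm_eq by (simp add: True yes mult.assoc)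
    next
      case False
      then have "r x x' = 0" using rate_nonzero_card[of x x'] True x by auto
      then show ?thesis using False unfolding R unfolding x eqm_eq by simp
    qed
  next
    case False
    show ?thesis
    proof (cases "card y' = M")
      case yes: True
      then have "r x' x = 0" using rate_nonzero_card[of x' x] False x by auto
      then show ?thesis using False unfolding R unfolding x eqm_eq by simp
    next
      case no: False
      then show ?thesis using False unfolding x eqm_eq by simp
    qed
  qed
qed

section \<open>Normalisation and support of the equilibrium\<close>

definition site_sum :: "'s \<Rightarrow> 's set \<Rightarrow> real" where
  "site_sum p y = (if p \<in> y then L_sum lam mu gam p y else U_sum lam mu p y)"

lemma weight_has_sum:
  assumes "card y = M"
  shows "((\<lambda>m. weight p m y) has_sum site_sum p y) UNIV"
proof -
  have "(\<lambda>m. weight p m y) sums site_sum p y"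
    using L_finite[OF assms, of p] U_finite[OF assms, of p]
    by (cases "p \<in> y") (simp_all add: weight_def site_sum_def L_sum_def U_sum_def summable_sums)
  then show ?thesis
    by (intro sums_nonneg_imp_has_sum_strong) (simp_all add: weight_nonneg)
qed

lemma site_sum_pos:
  assumes "card y = M"
  shows "0 < site_sum p y"
proof -
  \<comment> \<open>The empty site alone contributes 1.\<close>
  have "sum (\<lambda>m. weight p m y) {0} \<le> site_sum p y"
    by (rule finite_sum_le_has_sum[OF weight_has_sum[OF assms]]) (auto simp: weight_nonneg)
  then show ?thesis by simp
qed

lemma W_has_sum:
  assumes "card y = M"
  shows "(W y has_sum (\<Prod>p\<in>UNIV. site_sum p y)) UNIV"
proof -
  have abs: "Infinite_Sum.abs_summable_on (\<lambda>m. weight p m y) UNIV" for p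
    using weight_has_sum[OF assms, of p] by (auto simp: weight_nonneg summable_on_def)
  \<comment> \<open>The product criterion speaks of the absolute summability of
    \<open>Infinite_Set_Sum\<close>, hence the translation there and back.\<close>
  have "Infinite_Set_Sum.abs_summable_on (\<lambda>n. \<Prod>p\<in>UNIV. weight p (n p) y) (PiE UNIV (\<lambda>_. UNIV))"
    using abs by (intro abs_summable_on_prod_PiE abs_summable_equivalent[THEN iffD1]) auto
  then have "W y summable_on UNIV"
    using abs_summable_equivalent abs_summable_summable by (fastforce simp: W_def[abs_def])
  moreover have "infsum (W y) UNIV = (\<Prod>p\<in>UNIV. site_sum p y)"
    using infsum_prod_PiE_abs[of UNIV "\<lambda>p m. weight p m y" "\<lambda>_. UNIV"] abs
    by (simp add: W_def[abs_def] infsumI[OF weight_has_sum[OF assms]])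
  ultimately show ?thesis by (metis has_sum_infsum)
qed

lemma Xi_eq: "Xi lam mu gam M = (\<Sum>y | card y = M. \<Prod>p\<in>UNIV. site_sum p y)"
  by (simp add: Xi_def site_sum_def prod.If_cases Collect_mem_eq)

lemma ex_configuration: "\<exists>y :: 's set. card y = M"
  using obtain_subset_with_card_n[OF M_le] by metis

lemma Xi_pos: "0 < Xi lam mu gam M"
  unfolding Xi_eq using ex_configuration
  by (intro sum_pos prod_pos) (auto simp: site_sum_pos)

lemma states_eq: "states M = Sigma {y. card y = M} (\<lambda>_. UNIV :: ('s \<Rightarrow> nat) set)"
  by (auto simp: states_def)

lemma eqm_has_sum: "(eqm has_sum 1) (states M)"
proof -
  have W: "((\<lambda>n. case (y, n) of (y, n) \<Rightarrow> W y n) has_sum (\<Prod>p\<in>UNIV. site_sum p y)) UNIV"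
    if "y \<in> {y. card y = M}" for y
    using W_has_sum that by simp
  have "(\<lambda>(y, n). W y n) summable_on states M"
    unfolding states_eq by (rule summable_on_SigmaI[OF W]) (auto simp: W_nonneg)
  then have "((\<lambda>(y, n). W y n) has_sum Xi lam mu gam M) (states M)"
    unfolding states_eq Xi_eq by (intro has_sum_SigmaI[OF W]) auto
  from has_sum_cmult_right[OF this, of "1 / Xi lam mu gam M"]
  have "((\<lambda>x. 1 / Xi lam mu gam M * (case x of (y, n) \<Rightarrow> W y n)) has_sum 1) (states M)"
    using Xi_pos by simp
  then show ?thesis
  proof (rule has_sum_cong[THEN iffD1, rotated])
    fix x :: "'s state" assume "x \<in> states M"
    then show "1 / Xi lam mu gam M * (case x of (y, n) \<Rightarrow> W y n) = eqm x"
      by (cases x) (simp add: states_def eqm_eq)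
  qed
qed

lemma eqm_nonneg: "0 \<le> eqm x"
  using Xi_pos W_nonneg by (cases x) (simp add: eqm_eq)

lemma eqm_outside: "x \<notin> states M \<Longrightarrow> eqm x = 0"
  by (cases x) (simp add: eqm_eq states_def)

lemma eqm_pos_iff: "0 < eqm (y, n) \<longleftrightarrow> card y = M \<and> (\<forall>p. 0 < weight p (n p) y)"
proof -
  have "0 < W y n \<longleftrightarrow> (\<forall>p. 0 < weight p (n p) y)"
  proof
    assume "0 < W y n"
    then have "(\<Prod>q\<in>UNIV. weight q (n q) y) \<noteq> 0" unfolding W_def by (rule less_imp_neq[THEN not_sym])
    then have "\<forall>p. weight p (n p) y \<noteq> 0" unfolding prod_zero_iff[OF finite] by blast
    then show "\<forall>p. 0 < weight p (n p) y" by (simp add: weight_nonneg less_le)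
  qed (auto simp: W_def intro: prod_pos)
  then show ?thesis using Xi_pos by (simp add: eqm_eq zero_less_divide_iff)
qed

lemma eqm_empty_pos: "card y = M \<Longrightarrow> 0 < eqm (y, \<lambda>_. 0)"
  by (simp add: eqm_pos_iff)

section \<open>Closedness of the state space and communication of states\<close>

lemma closed_states: "x \<in> states M \<Longrightarrow> {z. z \<noteq> x \<and> R x z \<noteq> 0} \<subseteq> states M"
proof (clarify)
  fix y n assume "x \<in> states M" "(y, n) \<noteq> x" "R x (y, n) \<noteq> 0"
  then show "(y, n) \<in> states M"
    using rate_nonzero_card[of x "(y, n)"] by (cases x) (auto simp: generator_off states_def)
qed

text \<open>Lower bounds replace exact rates here and below: the other terms of the rate are
  nonnegative, so coinciding targets of different transitions do no harm.\<close>

lemma arrival_le_rate: "arrival p (n p) y \<le> R (y, n) (y, n(p := n p + 1))"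
proof -
  have "(\<Sum>k\<in>{p}. arrival k (n k) y) \<le> arrivals (y, n) (y, n(p := n p + 1))"
    unfolding arrivals_def fst_conv snd_conv
    by (rule order_trans[OF _ sum_mono2[of UNIV "{p}"]]) (auto simp: arrival_nonneg)
  then have "arrival p (n p) y \<le> r (y, n) (y, n(p := n p + 1))"
    unfolding rate_eq using parts_nonneg[of "(y, n)" "(y, n(p := n p + 1))"] by simp
  moreover have "(y, n(p := n p + 1)) \<noteq> (y, n)" by (simp add: fun_eq_iff)
  ultimately show ?thesis by (metis generator_off)
qed

lemma departure_le_rate:
  assumes "1 \<le> n p"
  shows "mu p (n p) y \<le> R (y, n) (y, n(p := n p - 1))"
proof -
  have "(\<Sum>k\<in>{p}. mu k (n k) y) \<le> departures (y, n) (y, n(p := n p - 1))"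
    unfolding departures_def fst_conv snd_conv
    by (rule order_trans[OF _ sum_mono2[of UNIV "{p}"]]) (use assms in \<open>auto simp: mu_pos less_imp_le\<close>)
  then have "mu p (n p) y \<le> r (y, n) (y, n(p := n p - 1))"
    unfolding rate_eq using parts_nonneg[of "(y, n)" "(y, n(p := n p - 1))"] by simp
  moreover have "(y, n(p := n p - 1)) \<noteq> (y, n)" using assms by (auto simp: fun_eq_iff)
  ultimately show ?thesis by (metis generator_off)
qed

lemma customer_rate_pos:
  assumes "card y = M" "j \<in> y" "j' \<notin> y"
  shows "0 < R (y, n) (move_customer j j' y, n)"
proof -
  let ?f = "\<lambda>i i'. if i \<in> y \<and> i' \<notin> y \<and> move_customer j j' y = move_customer i i' y \<and> n = n
      then inverse (gam_bar gam i (n i)) * tau i i' n y else 0"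
  have nn: "0 \<le> ?f i i'" for i i' by (simp add: gam_bar_nonneg tau_pos less_imp_le)
  have "0 < ?f j j'" using assms gam_bar_pos[OF assms] tau_pos[of j y j' n] by simp
  also have "?f j j' \<le> (\<Sum>i'\<in>UNIV. ?f j i')" using nn by (intro member_le_sum) auto
  also have "\<dots> \<le> (\<Sum>i\<in>UNIV. \<Sum>i'\<in>UNIV. ?f i i')"
    using nn by (intro member_le_sum[of j UNIV "\<lambda>i. \<Sum>i'\<in>UNIV. ?f i i'"] sum_nonneg) auto
  also have "\<dots> = customers (y, n) (move_customer j j' y, n)" unfolding customers_def fst_conv snd_conv ..
  finally have "0 < r (y, n) (move_customer j j' y, n)"
    unfolding rate_eq using parts_nonneg[of "(y, n)" "(move_customer j j' y, n)"] by simp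
  moreover have "(move_customer j j' y, n) \<noteq> (y, n)" using assms by (auto simp: move_customer_def)
  ultimately show ?thesis by (metis generator_off)
qed

lemma total_zero: "total (y, n) = 0 \<longleftrightarrow> n = (\<lambda>_. 0)"
  by (auto simp: total_def)

lemma total_pos:
  fixes n :: "'s \<Rightarrow> nat"
  assumes "n \<noteq> (\<lambda>_. 0)"
  shows "\<exists>p. 1 \<le> n p"
proof -
  obtain p where "n p \<noteq> 0" using assms by (auto simp: fun_eq_iff)
  then show ?thesis by (intro exI[of _ p]) simp
qed

lemma total_decrease: "1 \<le> n p \<Longrightarrow> Suc (total (y, n(p := n p - 1))) = total (y, n)"
  using total_upd[of y n p "n p - 1"] by simp

lemma leads_to_empty: "leads_to R (y, n) (y, \<lambda>_. 0)"
proof (induction "total (y, n)" arbitrary: n)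
  case 0
  then show ?case by (simp add: total_zero leads_to_def)
next
  case (Suc m)
  then have "n \<noteq> (\<lambda>_. 0)" using total_zero[of y n] by auto
  then obtain p where p: "1 \<le> n p" using total_pos by blast
  have "m = total (y, n(p := n p - 1))" using total_decrease[of n p y, OF p] Suc.hyps(2) by simp
  then have IH: "leads_to R (y, n(p := n p - 1)) (y, \<lambda>_. 0)" by (rule Suc.hyps(1))
  have "(y, n) \<noteq> (y, n(p := n p - 1))" using p by (auto simp: fun_eq_iff)
  moreover have "0 < R (y, n) (y, n(p := n p - 1))"
    using departure_le_rate[of n p y] mu_pos[OF p, of p y] p by linarith
  ultimately show ?case using IH by (rule leads_to_trans[OF leads_to_step])
qed

text \<open>A positive weight at level \<open>n p\<close> contains as factors a positive weight at
  level \<open>n p - 1\<close> and a positive arrival intensity there. So the state can be built up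
  one task at a time within the support.\<close>

lemma leads_to_positive:
  assumes "0 < eqm (y, n)"
  shows "leads_to R (y, \<lambda>_. 0) (y, n)"
  using assms
proof (induction "total (y, n)" arbitrary: n)
  case 0
  then have "n = (\<lambda>_. 0)" using total_zero[of y n] by metis
  then show ?case by (simp add: leads_to_def)
next
  case (Suc m)
  then have "n \<noteq> (\<lambda>_. 0)" using total_zero[of y n] by auto
  then obtain p where p: "1 \<le> n p" using total_pos by blast
  let ?n = "n(p := n p - 1)"
  have w: "0 < weight p (n p) y" using Suc.prems by (simp add: eqm_pos_iff)
  then have pos: "0 < weight p (n p - 1) y" "0 < arrival p (n p - 1) y"
    using weight_pred[OF p, of p y] weight_nonneg[of p "n p - 1" y] arrival_nonneg[of p "n p - 1" y]
    by (auto simp: less_le)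
  then have "0 < eqm (y, ?n)" using Suc.prems by (simp add: eqm_pos_iff)
  moreover have "m = total (y, ?n)" using total_decrease[of n p y, OF p] Suc.hyps(2) by simp
  ultimately have IH: "leads_to R (y, \<lambda>_. 0) (y, ?n)" using Suc.hyps(1) by blast
  have "?n(p := ?n p + 1) = n" using p by (auto simp: fun_eq_iff)
  then have "0 < R (y, ?n) (y, n)" using arrival_le_rate[of p ?n y] pos(2) by simp
  moreover have "(y, ?n) \<noteq> (y, n)" using p by (auto simp: fun_eq_iff)
  ultimately have "leads_to R (y, ?n) (y, n)" by (intro leads_to_step)
  with IH show ?case by (rule leads_to_trans)
qed

text \<open>Customers move one at a time from \<open>y - y'\<close> to \<open>y' - y\<close>; equal
  cardinality keeps a free site of \<open>y'\<close> available.\<close>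

lemma leads_to_configuration:
  assumes "card y = M" "card y' = M"
  shows "leads_to R (y, n) (y', n)"
  using assms
proof (induction "card (y - y')" arbitrary: y)
  case 0
  then have "y \<subseteq> y'" by simp
  then have "y = y'" using 0 by (intro card_subset_eq) auto
  then show ?case by (simp add: leads_to_def)
next
  case (Suc m)
  then obtain j where j: "j \<in> y - y'" by (metis card.empty ex_in_conv nat.distinct(1))
  have "\<not> y' \<subseteq> y"
    using card_subset_eq[of y y'] Suc.prems j by auto
  then obtain j' where j': "j' \<in> y' - y" by blast
  let ?y = "move_customer j j' y"
  have "?y - y' = (y - y') - {j}" using j j' by (auto simp: move_customer_def)
  then have "m = card (?y - y')" using Suc.hyps(2) j by simp
  moreover have "card ?y = M" using card_move_customer[of j y j'] j j' Suc.prems by simp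
  ultimately have IH: "leads_to R (?y, n) (y', n)" using Suc.hyps(1) Suc.prems by blast
  have "(y, n) \<noteq> (?y, n)" using j j' by (auto simp: move_customer_def)
  moreover have "0 < R (y, n) (?y, n)" using customer_rate_pos j j' Suc.prems by simp
  ultimately show ?case using IH by (rule leads_to_trans[OF leads_to_step])
qed

text \<open>The empty states are the hub: departures lead there from everywhere, customers are
  relocated there, and arrivals build up the target, whose weight must be positive for this last
  stretch.\<close>

lemma leads_to_support:
  assumes "card y = M" "0 < eqm x'"
  shows "leads_to R (y, n) x'"
proof -
  obtain y' n' where x': "x' = (y', n')" by (cases x')
  have "card y' = M" using assms x' by (simp add: eqm_pos_iff)
  then show ?thesis
    using leads_to_empty[of y n] leads_to_configuration[OF assms(1), of y' "\<lambda>_. 0"]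
      leads_to_positive[of y' n'] assms(2) unfolding x' by (blast intro: leads_to_trans)
qed

section \<open>States of weight zero and the drift of the number of tasks\<close>

lemma arrival_zero_same:
  assumes "m \<le> k" "arrival p m y = 0"
  shows "arrival p k y = 0"
  using assms
proof (induction k rule: dec_induct)
  case (step k)
  have lam: "lam p (Suc k) y = 0" if "lam p k y = 0"
    using that lam_support[of p k y] lam_nonneg[of p "Suc k" y] by (auto simp: less_le)
  have gam: "gam p (Suc k) = 0" if "gam p k = 0"
    using that gam_support[of p k] gam_nonneg[of p "Suc k"] by (auto simp: less_le)
  have "arrival p k y = 0" using step by simp
  then show ?case using lam gam by (auto simp: arrival_def)
qed

text \<open>In the balance equation for the two sites one side vanishes with the intensity of
  \<open>q\<close> at level \<open>m\<close>; the other is the intensity of \<open>p\<close> at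
  level \<open>b\<close> times a positive number. Both levels are free in these equations, so a
  single zero at one site rules out arrivals at every other site and every level.\<close>

lemma arrival_zero_other:
  assumes y: "card y = M" and qp: "q \<noteq> p" and z: "arrival q m y = 0"
  shows "arrival p b y = 0"
proof -
  have mu: "0 < mu q (m + 1) y" "0 < mu p (b + 1) y" by (simp_all add: mu_pos)
  \<comment> \<open>In the case \<open>q \<in> y\<close>, \<open>p \<notin> y\<close> the unoccupied
    site \<open>p\<close> makes \<open>gam_bar_pos\<close> available. The zero must then come from
    \<open>lam\<close>, which \<open>theta_balance\<close> contains without
    \<open>gam\<close>.\<close>
  have gam: "0 < gam q m" if "j \<in> y" "q \<in> y" "j' \<notin> y" for j j' q m
  proof -
    have "0 < gam_bar gam q (Suc m)" using gam_bar_pos[OF y that(2,3)] .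
    then show ?thesis using gam_nonneg[of q m] by (auto simp: gam_bar_def zero_less_mult_iff less_le)
  qed
  consider "q \<notin> y" "p \<notin> y" | "q \<in> y" "p \<notin> y" | "q \<notin> y" "p \<in> y" | "q \<in> y" "p \<in> y" by blast
  then show ?thesis
  proof cases
    case 1
    then show ?thesis
      using beta_balance[OF qp 1, of "m + 1" b] z mu beta_pos[of p q y "b + 1" m] qp by (auto simp: arrival_def)
  next
    case 2
    then have "lam q m y = 0" using z gam[of q q p m] by (simp add: arrival_def)
    then show ?thesis
      using theta_balance[OF 2, of "m + 1" b] mu 2 theta_pos[of q y p "b + 1" m] by (auto simp: arrival_def)
  next
    case 3
    then have "lam q m y = 0" using z by (simp add: arrival_def)
    then show ?thesis
      using theta_balance[OF 3(2,1), of "b + 1" m] mu 3 theta_pos[of p y q "b + 1" m] by (auto simp: arrival_def)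
  next
    case 4
    then show ?thesis
      using eps_balance[OF qp 4, of "m + 1" b] z mu eps_pos[of p q y "b + 1" m] qp by (auto simp: arrival_def)
  qed
qed

text \<open>A zero weight is caused by a zero arrival intensity at some level below
  \<open>n q\<close>. At the site \<open>q\<close> it persists at higher levels by the support
  conditions, and the arrays spread it to all levels of the other sites.\<close>

lemma transient_state:
  assumes "card y = M" "\<not> 0 < eqm (y, n)"
  shows "\<exists>q. 1 \<le> n q" "arrival p (n p) y = 0"
proof -
  from assms have "\<not> (\<forall>p. 0 < weight p (n p) y)" by (simp only: eqm_pos_iff simp_thms)
  then obtain q where "\<not> 0 < weight q (n q) y" by blast
  then have q: "weight q (n q) y = 0" using weight_nonneg[of q "n q" y] by simp
  have "\<exists>m<k. arrival q m y = 0" if "weight q k y = 0" for k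
    using that
  proof (induction k)
    case (Suc k)
    then have "weight q k y = 0 \<or> arrival q k y = 0"
      using mu_pos[of "Suc k" q y] by (simp add: weight_Suc)
    then show ?case using Suc.IH less_Suc_eq by blast
  qed simp
  then obtain m where m: "m < n q" "arrival q m y = 0" using q by blast
  then show "\<exists>q. 1 \<le> n q" by (auto intro!: exI[of _ q])
  show "arrival p (n p) y = 0"
    using m arrival_zero_same[of m "n q" q y] arrival_zero_other[OF assms(1) _ m(2), of p "n p"]
    by (cases "p = q") auto
qed

text \<open>Only arrivals raise the number of tasks, and by one; every other transition contributes
  a nonpositive term.\<close>

lemma rate_total_change:
  assumes "x' \<noteq> x"
  shows "R x x' * (real (total x') - real (total x)) \<le> arrivals x x'"
proof (cases "total x < total x'")
  case True
  then have R: "R x x' = arrivals x x'" using assms by (simp add: generator_off rate_total_gt)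
  show ?thesis
  proof (cases "arrivals x x' = 0")
    case False
    then have "total x' = Suc (total x)" by (rule total_arrivals)
    then show ?thesis unfolding R by simp
  qed (simp add: R)
next
  case False
  then have "R x x' * (real (total x') - real (total x)) \<le> 0"
    using assms by (intro mult_nonneg_nonpos) (auto simp: generator_off rate_nonneg)
  then show ?thesis using arrivals_nonneg order_trans by blast
qed

lemma sum_arrivals_le: "finite T \<Longrightarrow> (\<Sum>x'\<in>T. arrivals (y, n) x') \<le> (\<Sum>p\<in>UNIV. arrival p (n p) y)"
proof -
  assume T: "finite T"
  have "(\<Sum>x'\<in>T. arrivals (y, n) x') = (\<Sum>p\<in>UNIV. \<Sum>x'\<in>T. if x' = (y, n(p := n p + 1)) then arrival p (n p) y else 0)"
    unfolding arrivals_def fst_conv snd_conv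
    by (subst sum.swap) (intro sum.cong refl if_cong, auto simp: prod_eq_iff)
  also have "\<dots> \<le> (\<Sum>p\<in>UNIV. arrival p (n p) y)"
    using T by (intro sum_mono) (simp add: arrival_nonneg)
  finally show ?thesis .
qed

lemma drift_total: "(\<Sum>z\<in>G.targets x. R x z * (real (total z) + K)) =
   exit_rate R x * (real (total x) + K) + (\<Sum>z\<in>G.targets x. R x z * (real (total z) - real (total x)))"
proof -
  have "(\<Sum>z\<in>G.targets x. R x z * (real (total z) + K)) =
    (\<Sum>z\<in>G.targets x. R x z * (real (total x) + K) + R x z * (real (total z) - real (total x)))"
    by (intro sum.cong) (simp_all add: algebra_simps)
  then show ?thesis by (simp add: sum.distrib G.exit_rate_eq sum_distrib_right)
qed

lemma nonexplosive_bounded: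
  assumes "\<exists>C. \<forall>p n y. card y = M \<longrightarrow> p \<in> y \<longrightarrow> lam p n y * gam p n \<le> C"
  shows "nonexplosive R (states M)"
proof -
  obtain C1 where C1: "\<And>p n y. card y = M \<Longrightarrow> p \<in> y \<Longrightarrow> lam p n y * gam p n \<le> C1" using assms by blast
  obtain C2 where C2: "\<And>i n y. lam i n y \<le> C2" using lam_sup by blast
  \<comment> \<open>An occupied site receives tasks at rate at most \<open>C1\<close>, any other at
    rate at most \<open>C2\<close>, so \<open>K\<close> bounds the total arrival rate.\<close>
  define K where "K = real CARD('s) * max C1 C2"
  have K: "(\<Sum>p\<in>UNIV. arrival p (n p) y) \<le> K" if "card y = M" for y n
  proof -
    have "arrival p (n p) y \<le> max C1 C2" for p
      using C1[OF that, of p "n p"] C2[of p "n p" y] by (auto simp: arrival_def)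
    then show ?thesis unfolding K_def using sum_bounded_above[of UNIV "\<lambda>p. arrival p (n p) y"] by simp
  qed
  have K0: "0 \<le> K"
  proof -
    obtain y :: "'s set" where y: "card y = M" using ex_configuration by blast
    have "0 \<le> (\<Sum>p\<in>UNIV. arrival p 0 y)" by (simp add: sum_nonneg arrival_nonneg)
    also have "\<dots> \<le> K" using K[OF y, of "\<lambda>_. 0"] .
    finally show ?thesis .
  qed
  \<comment> \<open>The drift of \<open>total\<close> is at most \<open>K\<close>. Adding
    \<open>K\<close> to the barrier makes this at most the barrier itself, and the further 1 makes
    the barrier positive.\<close>
  let ?W = "\<lambda>x. real (total x) + (K + 1)"
  show ?thesis
  proof (rule G.nonexplosive_criterion[where W = ?W])
    show "G.targets x \<subseteq> states M" if "x \<in> states M" for x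
      using closed_states[OF that] by (simp add: G.targets_def)
    show "0 < ?W x" for x using K0 by simp
    show "finite {x \<in> states M. ?W x \<le> c}" for c
    proof (rule finite_subset)
      show "{x \<in> states M. ?W x \<le> c} \<subseteq> UNIV \<times> PiE UNIV (\<lambda>_. {..nat \<lceil>c\<rceil>})"
      proof
        fix x assume "x \<in> {x \<in> states M. ?W x \<le> c}"
        then have "real (total x) \<le> c" using K0 by simp
        then have "total x \<le> nat \<lceil>c\<rceil>" by linarith
        moreover have "snd x p \<le> total x" for p unfolding total_def by (intro member_le_sum) auto
        ultimately show "x \<in> UNIV \<times> PiE UNIV (\<lambda>_. {..nat \<lceil>c\<rceil>})"
          by (cases x) (auto simp: PiE_iff intro: order_trans)
      qed
    qed (auto intro!: finite_PiE)
    show "(\<Sum>z\<in>G.targets x. R x z * ?W z) \<le> (1 + exit_rate R x) * ?W x" if "x \<in> states M" for x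
    proof -
      obtain y n where x: "x = (y, n)" "card y = M" using \<open>x \<in> states M\<close> by (auto simp: states_def)
      have "(\<Sum>z\<in>G.targets x. R x z * (real (total z) - real (total x))) \<le> (\<Sum>z\<in>G.targets x. arrivals x z)"
        by (intro sum_mono rate_total_change) (simp add: G.targets_def)
      also have "\<dots> \<le> K" using sum_arrivals_le[of "G.targets x" y n] K[OF x(2), of n] x by simp
      also have "\<dots> \<le> ?W x" by simp
      finally show ?thesis unfolding drift_total by (simp add: distrib_right)
    qed
  qed
qed

text \<open>Without arrivals no transition raises the number of tasks, and a departure from a
  nonempty site alone contributes at most \<open>- c\<close> to the drift.\<close>

lemma drift_transient:
  assumes c: "\<And>i n y. 1 \<le> n \<Longrightarrow> c \<le> mu i n y" and x: "x \<in> states M" "\<not> 0 < eqm x"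
  shows "(\<Sum>z\<in>G.targets x. R x z * real (total z)) + c \<le> exit_rate R x * real (total x)"
proof -
  obtain y n where xy: "x = (y, n)" "card y = M" using x by (auto simp: states_def)
  obtain p where p: "1 \<le> n p" using transient_state(1)[OF xy(2), of n] x xy by blast
  let ?z = "(y, n(p := n p - 1))"
  have "arrivals x z = 0" for z
    unfolding arrivals_def xy fst_conv snd_conv using transient_state(2)[OF xy(2), of n] x xy
    by (intro sum.neutral) auto
  then have le: "R x z * (real (total z) - real (total x)) \<le> 0" if "z \<in> G.targets x" for z
    using rate_total_change[of z x] that by (simp add: G.targets_def)
  have rate: "c \<le> R x ?z" using departure_le_rate[of n p y, OF p] c[OF p, of p y] xy by simp
  have "0 < R x ?z" using departure_le_rate[of n p y, OF p] mu_pos[OF p, of p y] xy by simp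
  then have z: "?z \<in> G.targets x" using p xy by (auto simp: G.targets_def fun_eq_iff)
  let ?f = "\<lambda>z. R x z * (real (total z) - real (total x))"
  have "sum ?f (G.targets x) = ?f ?z + sum ?f (G.targets x - {?z})"
    using z by (intro sum.remove) auto
  also have "\<dots> \<le> ?f ?z" using sum_nonpos[of "G.targets x - {?z}" ?f] le by simp
  also have "\<dots> = - R x ?z"
  proof -
    have "real (total x) = real (total ?z) + 1"
      using total_decrease[of n p y, OF p] unfolding xy(1) by linarith
    then show ?thesis by simp
  qed
  finally show ?thesis using drift_total[of x 0] rate by simp
qed

theorem equilibrium_process:
  assumes ne: "nonexplosive R (states M)"
  shows "positive_recurrent_process R (states M) {x \<in> states M. eqm x > 0} \<and>
         reversible_process R (states M) eqm \<and>
         (\<forall>\<nu>. stationary_distribution R (states M) \<nu> \<longleftrightarrow> (\<forall>x\<in>states M. \<nu> x = eqm x))"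
proof -
  interpret reversible_generator R "states M" eqm
    using closed_states eqm_nonneg eqm_outside eqm_has_sum detailed_balance ne
    by unfold_locales blast+
  let ?C = "{x \<in> states M. 0 < eqm x}"
  obtain y :: "'s set" where y: "card y = M" using ex_configuration by blast
  then have C: "?C \<noteq> {}" using eqm_empty_pos[OF y] by (auto simp: states_def)
  have irr: "leads_to R x x'" if "x \<in> states M" "0 < eqm x'" for x x'
    using leads_to_support[of "fst x" x' "snd x"] that by (auto simp: states_def)
  obtain c where c: "0 < c" "\<And>i n y. 1 \<le> n \<Longrightarrow> c \<le> mu i n y" using mu_inf by blast
  have "positive_recurrent_process R (states M) ?C"
    by (rule positive_recurrent_process_hitting[OF refl C, where V = "\<lambda>x. real (total x)" and c = c])
      (use irr c drift_transient in auto)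
  moreover have "\<nu> x = eqm x" if "stationary_distribution R (states M) \<nu>" "x \<in> states M" for \<nu> x
    by (rule stationary_unique[OF refl C _ _ that]) (use irr C in auto)
  \<comment> \<open>Stationarity involves only the values on \<open>states M\<close>, so
    \<open>\<nu>\<close> may replace \<open>eqm\<close> in every sum.\<close>
  moreover have "stationary_distribution R (states M) \<nu>" if \<nu>: "\<forall>x\<in>states M. \<nu> x = eqm x" for \<nu>
  proof -
    have "(\<nu> has_sum 1) (states M)"
      using pi_sum that by (simp cong: has_sum_cong)
    moreover have "((\<lambda>x. \<nu> x * transition_prob R t x y) has_sum \<nu> y) (states M)"
      if "0 \<le> t" "y \<in> states M" for t y
    proof -
      have "((\<lambda>x. eqm x * transition_prob R t x y) has_sum \<nu> y) (states M)"
        using pi_invariant[OF that] \<nu> that(2) by simp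
      then show ?thesis using \<nu> by (subst has_sum_cong) auto
    qed
    ultimately show ?thesis
      using that eqm_nonneg unfolding stationary_distribution_def by simp
  qed
  ultimately show ?thesis using reversible by blast
qed

end

theorem theorem4p1:
  fixes lam mu :: "'s::finite \<Rightarrow> nat \<Rightarrow> 's set \<Rightarrow> real"
    and gam :: "'s \<Rightarrow> nat \<Rightarrow> real"
    and beta theta eps :: "'s \<Rightarrow> 's \<Rightarrow> nat \<Rightarrow> nat \<Rightarrow> 's set \<Rightarrow> real"
    and tau :: "'s \<Rightarrow> 's \<Rightarrow> ('s \<Rightarrow> nat) \<Rightarrow> 's set \<Rightarrow> real"
    and M :: nat
  defines "R \<equiv> generator lam mu gam beta theta eps tau"
    and "eqm \<equiv> equilibrium lam mu gam M"
  assumes M_le: "M \<le> CARD('s)"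
    and lam_nonneg: "\<And>i n y. 0 \<le> lam i n y"
    and lam_sup: "\<exists>C. \<forall>i n y. lam i n y \<le> C"
    and mu_inf: "\<exists>c>0. \<forall>i n y. n \<ge> 1 \<longrightarrow> c \<le> mu i n y"
    and lam_support: "\<And>i n y. lam i (n + 1) y > 0 \<Longrightarrow> lam i n y > 0"
    and gam_nonneg: "\<And>i n. 0 \<le> gam i n"
    and gam_0: "\<And>i. gam i 0 = 1"
    and gam_support: "\<And>i n. gam i (n + 1) > 0 \<Longrightarrow> gam i n > 0"
    and gam_bar_pos: "\<And>y j j' m. card y = M \<Longrightarrow> j \<in> y \<Longrightarrow> j' \<notin> y \<Longrightarrow> gam_bar gam j m > 0"
    and beta_pos: "\<And>k l a b y. k \<noteq> l \<Longrightarrow> k \<notin> y \<Longrightarrow> l \<notin> y \<Longrightarrow> beta k l a b y > 0"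
    and theta_pos: "\<And>j k a b y. j \<in> y \<Longrightarrow> k \<notin> y \<Longrightarrow> theta j k a b y > 0 \<and> theta k j a b y > 0"
    and eps_pos: "\<And>i j a b y. i \<noteq> j \<Longrightarrow> i \<in> y \<Longrightarrow> j \<in> y \<Longrightarrow> eps i j a b y > 0"
    and tau_pos: "\<And>j j' n y. j \<in> y \<Longrightarrow> j' \<notin> y \<Longrightarrow> tau j j' n y > 0"
    and beta_balance: "\<And>k l a b y. k \<noteq> l \<Longrightarrow> k \<notin> y \<Longrightarrow> l \<notin> y \<Longrightarrow> a \<ge> 1 \<Longrightarrow>
        lam k (a - 1) y / mu k a y * beta k l a b y =
        lam l b y / mu l (b + 1) y * beta l k (b + 1) (a - 1) y"
    and theta_balance: "\<And>j k a b y. j \<in> y \<Longrightarrow> k \<notin> y \<Longrightarrow> a \<ge> 1 \<Longrightarrow>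
        lam j (a - 1) y / mu j a y * theta j k a b y =
        lam k b y / mu k (b + 1) y * theta k j (b + 1) (a - 1) y"
    and eps_balance: "\<And>i j a b y. i \<noteq> j \<Longrightarrow> i \<in> y \<Longrightarrow> j \<in> y \<Longrightarrow> a \<ge> 1 \<Longrightarrow>
        lam i (a - 1) y * gam i (a - 1) / mu i a y * eps i j a b y =
        lam j b y * gam j b / mu j (b + 1) y * eps j i (b + 1) (a - 1) y"
    and tau_balance: "\<And>j j' n y. j \<in> y \<Longrightarrow> j' \<notin> y \<Longrightarrow>
        tau j j' n y * (\<Prod>q\<in>UNIV. lam_bar lam q (n q) y / mu_bar mu q (n q) y) =
        tau j' j n (move_customer j j' y) *
          (\<Prod>q\<in>UNIV. lam_bar lam q (n q) (move_customer j j' y) /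
                      mu_bar mu q (n q) (move_customer j j' y))"
    and U_finite: "\<And>y l. card y = M \<Longrightarrow> l \<notin> y \<Longrightarrow>
        summable (\<lambda>n. lam_bar lam l n y / mu_bar mu l n y)"
    and L_finite: "\<And>y j. card y = M \<Longrightarrow> j \<in> y \<Longrightarrow>
        summable (\<lambda>n. lam_bar lam j n y * gam_bar gam j n / mu_bar mu j n y)"
    and well_defined: "\<not> (\<exists>C. \<forall>p n y. card y = M \<longrightarrow> p \<in> y \<longrightarrow> lam p n y * gam p n \<le> C) \<Longrightarrow>
        nonexplosive R (states M)"
  shows "positive_recurrent_process R (states M) {x \<in> states M. eqm x > 0} \<and>
         reversible_process R (states M) eqm \<and>
         (\<forall>\<nu>. stationary_distribution R (states M) \<nu> \<longleftrightarrow> (\<forall>x\<in>states M. \<nu> x = eqm x))"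
proof -
  interpret N: task_network lam mu gam beta theta eps tau M
    by (unfold_locales; fact)
  have "nonexplosive R (states M)"
    unfolding R_def using N.nonexplosive_bounded well_defined[unfolded R_def] by blast
  then show ?thesis
    unfolding R_def eqm_def by (rule N.equilibrium_process)
qed

end
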